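(* Let $D$ be a link diagram together with a choice of orientation (arrow) at each crossing. Then the odd Khovanov complex of $D$ built from a type X sign assignment and the odd Khovanov complex of $D$ built from a type Y sign assignment are isomorphic as chain complexes of abelian groups.
   Context: Crossing resolutions. Let $D$ have $n$ crossings, numbered $1,\dots,n$. At a crossing, draw the overstrand vertically (ends N, S) and the understrand horizontally (ends W, E). The 0-resolution joins S to W and N to E; the 1-resolution joins N to W and S to E. An orientation of the crossing is an arrow along the short arc joining the two strands of the 0-resolution, pointing either from the SW strand to the NE strand or conversely. For $\alpha\in\{0,1\}^n$ let $D_\alpha$ be the resulting collection of circles in the plane, and $\deg(\alpha)$ the number of 1's in $\alpha$. An edge of the cube $\{0,1\}^n$ is a pair $\alpha,\beta$ differing only in one entry, which is 0 in $\alpha$ and 1 in $\beta$; passing from $D_\alpha$ to $D_\beta$ is surgery along the arrow of that crossing and is either a merge of two circles or a split of one circle. Exterior algebra functor. For a collection $R$ of disjoint planar circles, $V(R)$ is the free abelian group on the circles and $\mathcal F(R)=\Lambda^*V(R)$. To a merge of circles $a_0,a_1$ of $R$ into a circle of $R'$ assign the map $\Lambda^*V(R)\to\Lambda^*V(R)/(a_0-a_1)\cong\Lambda^*V(R')$. To a split of a circle of $R$ into circles $c_0',c_1'$ of $R'$ assign the map $\Lambda^*V(R)\cong\Lambda^*V(R')/(c_0'-c_1')\to\Lambda^*V(R')$, $x\mapsto(c_0'-c_1')\wedge x$, where the labels are chosen so that rotating the surgery arrow by $90^\circ$ clockwise gives an arrow pointing from $c_0'$ to $c_1'$. Let $d_e$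 be the map assigned to the edge $e$. Face signs. Consider a 2-dimensional face of the cube. If the two compositions of edge maps around the face are nonzero, they agree up to sign, and $\sigma=\pm1$ is that sign. The remaining faces are those in which (up to unaffected circles) a single circle is surgered along two arcs with interleaved endpoints, an arc $a$ inside the circle and an arc $b$ outside it. Such a face is of type Y if, going counterclockwise around the circle, one meets tail of $a$, head of $b$, head of $a$, tail of $b$ in this cyclic order, and of type X if one meets tail of $a$, tail of $b$, head of $a$, head of $b$. In the type Y convention $\sigma=-1$ on type Y faces and $\sigma=+1$ on type X faces; in the type X convention $\sigma=-1$ on type X faces and $\sigma=+1$ on type Y faces. A type X (respectively type Y) sign assignment is a choice of sign $\epsilon_e\in\{\pm1\}$ for every edge such that for each 2-dimensional face the product of the four edge signs times $\sigma$ (in the type X, respectively type Y, convention) equals $-1$. The corresponding odd Khovanov complex has $\bigoplus_{\deg(\alpha)=k}\mathcal F(D_\alpha)$ in degree $k-n_-$, where $n_-$ is the number of negative crossings of $D$, and its differential is $\sum_e\epsilon_e d_e$. *)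

theory Defs
  imports
    "HOL-Algebra.Free_Abelian_Groups"
    "HOL-Combinatorics.Orbits"
begin

section \<open>The exterior algebra of a free abelian group\<close>

text \<open>
  The tensor algebra of the free abelian group on \<open>'c\<close> is the monoid ring over the integers of
  the free monoid of words in \<open>'c\<close>.  Its elements of degree one are the elements of the free
  abelian group itself.
\<close>

datatype 'c tensor_word = Word (letters: "'c list")

instantiation tensor_word :: (type) monoid_add
begin
definition zero_tensor_word :: "'a tensor_word" where "0 = Word []"
definition plus_tensor_word :: "'a tensor_word \<Rightarrow> 'a tensor_word \<Rightarrow> 'a tensor_word"
  where "v + w = Word (letters v @ letters w)"
instance by standard (auto simp: zero_tensor_word_def plus_tensor_word_def)
end

type_synonym 'c tensor = "'c tensor_word \<Rightarrow>\<^sub>0 int"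

definition degree_one :: "'c tensor set" where
  "degree_one = {v. \<forall>w \<in> Poly_Mapping.keys v. length (letters w) = 1}"

text \<open>The two-sided ideal generated by the squares \<open>v \<otimes> v\<close>.\<close>

inductive_set ext_ideal :: "'c tensor set" where
  zero: "0 \<in> ext_ideal"
| square: "v \<in> degree_one \<Longrightarrow> a * (v * v) * b \<in> ext_ideal"
| diff: "x \<in> ext_ideal \<Longrightarrow> y \<in> ext_ideal \<Longrightarrow> x - y \<in> ext_ideal"

lemma ext_ideal_uminus: "x \<in> ext_ideal \<Longrightarrow> - x \<in> ext_ideal"
  using ext_ideal.diff[OF ext_ideal.zero] by fastforce

lemma ext_ideal_add: "x \<in> ext_ideal \<Longrightarrow> y \<in> ext_ideal \<Longrightarrow> x + y \<in> ext_ideal"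
  using ext_ideal.diff[OF _ ext_ideal_uminus] by fastforce

lemma ext_ideal_mult_left: "x \<in> ext_ideal \<Longrightarrow> c * x \<in> ext_ideal"
proof (induction rule: ext_ideal.induct)
  case (square v a b)
  then show ?case using ext_ideal.square[of v "c * a" b] by (simp add: mult.assoc)
qed (auto simp: right_diff_distrib intro: ext_ideal.intros)

lemma ext_ideal_mult_right: "x \<in> ext_ideal \<Longrightarrow> x * c \<in> ext_ideal"
proof (induction rule: ext_ideal.induct)
  case (square v a b)
  then show ?case using ext_ideal.square[of v a "b * c"] by (simp add: mult.assoc)
qed (auto simp: left_diff_distrib intro: ext_ideal.intros)

lemma tensor_induct [case_names of_word diff]:
  fixes x :: "'c tensor"
  assumes "\<And>w. P (frag_of w)" "\<And>a b. P a \<Longrightarrow> P b \<Longrightarrow> P (a - b)"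
  shows "P x"
proof -
  have "P 0" using assms(2)[OF assms(1) assms(1), of undefined undefined] by simp
  then show ?thesis
    by (rule frag_induction[of x UNIV, rotated]) (use assms in auto)
qed

lemma frag_of_mult: "frag_of v * frag_of w = (frag_of (v + w) :: 'c tensor)"
  by (simp add: mult_single)

lemma ext_ideal_constant_coeff: "x \<in> ext_ideal \<Longrightarrow> Poly_Mapping.lookup x 0 = 0"
proof (induction rule: ext_ideal.induct)
  case (square v a b)
  have mult: "Poly_Mapping.lookup (x * y) 0
      = Poly_Mapping.lookup x 0 * Poly_Mapping.lookup y 0" for x y :: "'c tensor"
  proof (induction x rule: tensor_induct)
    case (of_word w)
    show ?case
    proof (induction y rule: tensor_induct)
      case (of_word u)
      show ?case
        unfolding frag_of_mult
        by (cases w; cases u)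
           (auto simp: lookup_single zero_tensor_word_def plus_tensor_word_def when_def)
    qed (simp add: right_diff_distrib lookup_minus)
  qed (simp add: left_diff_distrib lookup_minus)
  have "Poly_Mapping.lookup v 0 = 0"
    using square unfolding degree_one_def zero_tensor_word_def
    by (metis (mono_tags, lifting) in_keys_iff list.size(3) mem_Collect_eq
        tensor_word.sel zero_neq_one)
  then show ?case by (simp add: mult)
qed (auto simp: lookup_minus)

quotient_type 'c exterior = "'c tensor" / "\<lambda>x y. x - y \<in> ext_ideal"
proof (rule equivpI)
  show "reflp (\<lambda>x y :: 'c tensor. x - y \<in> ext_ideal)"
    by (simp add: reflp_def ext_ideal.zero)
  show "symp (\<lambda>x y :: 'c tensor. x - y \<in> ext_ideal)"
    using ext_ideal_uminus by (fastforce simp: symp_def)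
  show "transp (\<lambda>x y :: 'c tensor. x - y \<in> ext_ideal)"
    using ext_ideal_add by (fastforce simp: transp_def)
qed

text \<open>The product \<open>*\<close> of this ring is the wedge product.\<close>

instantiation exterior :: (type) ring_1
begin

lift_definition zero_exterior :: "'a exterior" is "0" .

lift_definition one_exterior :: "'a exterior" is "1" .

lift_definition uminus_exterior :: "'a exterior \<Rightarrow> 'a exterior" is "uminus"
  using ext_ideal_uminus by fastforce

lift_definition plus_exterior :: "'a exterior \<Rightarrow> 'a exterior \<Rightarrow> 'a exterior" is "(+)"
  using ext_ideal_add by (fastforce simp: algebra_simps)

lift_definition minus_exterior :: "'a exterior \<Rightarrow> 'a exterior \<Rightarrow> 'a exterior" is "(-)"
proof -
  fix a b c d :: "'a tensor"
  assume "a - b \<in> ext_ideal" "c - d \<in> ext_ideal"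
  from ext_ideal.diff[OF this] show "a - c - (b - d) \<in> ext_ideal"
    by (simp add: algebra_simps)
qed

lift_definition times_exterior :: "'a exterior \<Rightarrow> 'a exterior \<Rightarrow> 'a exterior" is "(*)"
proof -
  fix a b c d :: "'a tensor"
  assume "a - b \<in> ext_ideal" "c - d \<in> ext_ideal"
  then have "(a - b) * c + b * (c - d) \<in> ext_ideal"
    by (intro ext_ideal_add ext_ideal_mult_left ext_ideal_mult_right)
  then show "a * c - b * d \<in> ext_ideal" by (simp add: algebra_simps)
qed

instance
proof
  show "(0 :: 'a exterior) \<noteq> 1"
  proof (transfer, rule notI)
    assume "0 - 1 \<in> (ext_ideal :: 'a tensor set)"
    from ext_ideal_constant_coeff[OF this] show False
      by (simp add: lookup_minus lookup_one)
  qed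
qed (transfer; simp add: algebra_simps ext_ideal.zero)+

end

definition gen :: "'c \<Rightarrow> 'c exterior" where
  "gen c = abs_exterior (frag_of (Word [c]))"

text \<open>
  \<open>exterior_on R\<close> is the exterior algebra of the free abelian group on the set \<open>R\<close>.  That group
  is a direct summand of the free abelian group on the whole type, so its exterior algebra is the
  subring of \<open>'c exterior\<close> consisting of the classes of tensors in the elements of \<open>R\<close>.
\<close>

definition exterior_on :: "'c set \<Rightarrow> 'c exterior set" where
  "exterior_on R = abs_exterior ` {x. \<forall>w \<in> Poly_Mapping.keys x. set (letters w) \<subseteq> R}"

definition exterior_group :: "'c set \<Rightarrow> 'c exterior monoid" where
  "exterior_group R = \<lparr>carrier = exterior_on R, monoid.mult = (+), one = 0\<rparr>"

definition tensor_map :: "('c \<Rightarrow> 'd) \<Rightarrow> 'c tensor \<Rightarrow> 'd tensor" where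
  "tensor_map f = frag_extend (\<lambda>w. frag_of (Word (map f (letters w))))"

lemma tensor_map_diff: "tensor_map f (x - y) = tensor_map f x - tensor_map f y"
  by (simp add: tensor_map_def frag_extend_diff)

lemma tensor_map_mult: "tensor_map f (x * y) = tensor_map f x * tensor_map f y"
proof (induction x rule: tensor_induct)
  case (of_word w)
  show ?case
    by (induction y rule: tensor_induct)
       (simp_all add: tensor_map_diff right_diff_distrib frag_of_mult,
        simp add: tensor_map_def frag_of_mult plus_tensor_word_def)
qed (simp add: tensor_map_diff left_diff_distrib)

lemma tensor_map_degree_one:
  assumes "v \<in> degree_one" shows "tensor_map f v \<in> degree_one"
proof -
  have "Poly_Mapping.keys (tensor_map f v)
      \<subseteq> (\<Union>w \<in> Poly_Mapping.keys v. {Word (map f (letters w))})"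
    unfolding tensor_map_def by (rule order_trans[OF keys_frag_extend]) auto
  with assms show ?thesis by (fastforce simp: degree_one_def)
qed

lemma tensor_map_ideal: "x \<in> ext_ideal \<Longrightarrow> tensor_map f x \<in> ext_ideal"
  by (induction rule: ext_ideal.induct)
     (auto simp: tensor_map_diff tensor_map_mult tensor_map_degree_one intro: ext_ideal.intros,
      simp add: tensor_map_def ext_ideal.zero)

text \<open>The ring homomorphism of exterior algebras induced by a map of generators.\<close>

lift_definition exterior_map :: "('c \<Rightarrow> 'd) \<Rightarrow> 'c exterior \<Rightarrow> 'd exterior" is tensor_map
  using tensor_map_ideal by (metis tensor_map_diff)


section \<open>Link diagrams\<close>

text \<open>
  A link diagram is encoded by its underlying planar 4-valent graph.  Every crossing has four
  ends, named as if the overstrand were vertical and the understrand horizontal.  The involution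
  \<open>arc\<close> pairs the ends that are joined by an arc of the diagram outside the crossings.
  \<open>nloops\<close> is the number of components without crossings.  \<open>outward\<close> encodes the orientation of
  the link: \<open>outward (End i d)\<close> holds if the strand through crossing \<open>i\<close> leaves it at end \<open>d\<close>.
\<close>

datatype compass = North | West | South | East

datatype dpoint = End nat compass | Loop nat

record link_diagram =
  ncross :: nat
  arc :: "dpoint \<Rightarrow> dpoint"
  nloops :: nat
  outward :: "dpoint \<Rightarrow> bool"

definition crossings :: "link_diagram \<Rightarrow> nat set" where
  "crossings D = {1..ncross D}"

definition ends :: "link_diagram \<Rightarrow> dpoint set" where
  "ends D = {End i d | i d. i \<in> crossings D}"

definition points :: "link_diagram \<Rightarrow> dpoint set" where
  "points D = ends D \<union> Loop ` {..<nloops D}"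

fun on_end :: "(nat \<Rightarrow> compass \<Rightarrow> compass) \<Rightarrow> dpoint \<Rightarrow> dpoint" where
  "on_end f (End i d) = End i (f i d)"
| "on_end f (Loop j) = Loop j"

fun ccw :: "compass \<Rightarrow> compass" where
  "ccw North = West" | "ccw West = South" | "ccw South = East" | "ccw East = North"

definition opposite :: "dpoint \<Rightarrow> dpoint" where
  "opposite = on_end (\<lambda>_ d. ccw (ccw d))"

text \<open>
  The faces of the ribbon surface of the diagram are the orbits of \<open>face_step\<close>, which runs along
  an arc and turns to the adjacent end of the crossing reached.
\<close>

definition face_step :: "link_diagram \<Rightarrow> dpoint \<Rightarrow> dpoint" where
  "face_step D h = on_end (\<lambda>_. ccw) (arc D h)"

definition faces :: "link_diagram \<Rightarrow> dpoint set set" where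
  "faces D = orbit (face_step D) ` ends D"

definition graph_components :: "link_diagram \<Rightarrow> dpoint set set" where
  "graph_components D = (\<lambda>h. {k. (h, k) \<in>
     ({(p, arc D p) | p. p \<in> ends D} \<union> {(p, on_end (\<lambda>_. ccw) p) | p. p \<in> ends D})\<^sup>*}) ` ends D"

text \<open>
  The last condition is planarity.  There are \<open>n\<close> vertices and \<open>2 n\<close> edges, so it says that the
  Euler characteristic \<open>n - 2 n + card (faces D)\<close> is twice the number of components, that is,
  every component of the graph is drawn on a sphere.  The position of the components of the graph
  (and of the loops) relative to each other in the plane is not recorded.
\<close>

definition is_link_diagram :: "link_diagram \<Rightarrow> bool" where
  "is_link_diagram D \<longleftrightarrow>
     (\<forall>h \<in> ends D. arc D h \<in> ends D \<and> arc D h \<noteq> h \<and> arc D (arc D h) = h) \<and>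
     (\<forall>h \<in> ends D. outward D (arc D h) \<noteq> outward D h \<and> outward D (opposite h) \<noteq> outward D h) \<and>
     card (faces D) = ncross D + 2 * card (graph_components D)"

text \<open>
  Turn the crossing so that the overstrand runs from South to North.  It is positive if the
  understrand runs from East to West, and negative if it runs from West to East.
\<close>

definition negative_crossings :: "link_diagram \<Rightarrow> nat set" where
  "negative_crossings D =
     {i \<in> crossings D. outward D (End i North) = outward D (End i East)}"


section \<open>Resolutions\<close>

text \<open>A vertex \<open>\<alpha>\<close> of the cube is represented by the set \<open>A\<close> of all \<open>i\<close> with \<open>\<alpha>\<^sub>i = 1\<close>.\<close>

fun smooth0 :: "compass \<Rightarrow> compass" where
  "smooth0 South = West" | "smooth0 West = South" | "smooth0 North = East" | "smooth0 East = North"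

fun smooth1 :: "compass \<Rightarrow> compass" where
  "smooth1 North = West" | "smooth1 West = North" | "smooth1 South = East" | "smooth1 East = South"

definition smooth :: "nat set \<Rightarrow> dpoint \<Rightarrow> dpoint" where
  "smooth A = on_end (\<lambda>i. if i \<in> A then smooth1 else smooth0)"

type_synonym circle = "dpoint set"

text \<open>A circle of the resolution is identified with the set of the points of the diagram on it.\<close>

definition circle_at :: "link_diagram \<Rightarrow> nat set \<Rightarrow> dpoint \<Rightarrow> circle" where
  "circle_at D A h = {k. (h, k) \<in>
     ({(p, arc D p) | p. p \<in> ends D} \<union> {(p, smooth A p) | p. p \<in> ends D})\<^sup>*}"

definition circles :: "link_diagram \<Rightarrow> nat set \<Rightarrow> circle set" where
  "circles D A = circle_at D A ` points D"


section \<open>Edge maps\<close>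

datatype arrow = SW_to_NE | NE_to_SW

text \<open>
  The map induced by \<open>a0, a1 \<mapsto> a'\<close> is the projection to the quotient by \<open>a0 - a1\<close> followed by
  its identification with the exterior algebra on the new circles.
\<close>

definition merge_map :: "'c \<Rightarrow> 'c \<Rightarrow> 'c \<Rightarrow> 'c exterior \<Rightarrow> 'c exterior" where
  "merge_map a0 a1 a' = exterior_map (\<lambda>c. if c = a0 \<or> c = a1 then a' else c)"

text \<open>
  The class modulo \<open>c0 - c1\<close> that corresponds to \<open>x\<close> is represented by replacing the split circle
  \<open>c\<close> by \<open>c0\<close>; the product with \<open>c0 - c1\<close> does not depend on the representative.
\<close>

definition split_map :: "'c \<Rightarrow> 'c \<Rightarrow> 'c \<Rightarrow> 'c exterior \<Rightarrow> 'c exterior" where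
  "split_map c c0 c1 x = (gen c0 - gen c1) * exterior_map (\<lambda>b. if b = c then c0 else b) x"

text \<open>
  The edge from \<open>A\<close> to \<open>insert i A\<close>.  The SW and NE strands of the 0-resolution contain the South
  and North ends, the NW and SE strands of the 1-resolution contain the West and East ends.
  Rotating an arrow from SW to NE clockwise by a right angle gives an arrow from NW to SE.
\<close>

definition edge_map ::
  "link_diagram \<Rightarrow> (nat \<Rightarrow> arrow) \<Rightarrow> nat set \<Rightarrow> nat \<Rightarrow> circle exterior \<Rightarrow> circle exterior" where
  "edge_map D arr A i =
     (let sw = circle_at D A (End i South);
          ne = circle_at D A (End i North);
          nw' = circle_at D (insert i A) (End i West);
          se' = circle_at D (insert i A) (End i East)
      in if sw \<noteq> ne then merge_map sw ne nw'
         else case arr i of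
             SW_to_NE \<Rightarrow> split_map sw nw' se'
           | NE_to_SW \<Rightarrow> split_map sw se' nw')"


section \<open>Face signs and sign assignments\<close>

text \<open>
  The permutation \<open>traverse D A\<close> runs along the circles of a resolution; a point \<open>End k d\<close> of an
  orbit stands for passing the strand at crossing \<open>k\<close> that is entered at the end \<open>d\<close>.  Of a
  strand of the 0-resolution, the surgery arc lies on the left if the strand is entered at its
  West or East end, and on the right if it is entered at its South or North end.
\<close>

definition traverse :: "link_diagram \<Rightarrow> nat set \<Rightarrow> dpoint \<Rightarrow> dpoint" where
  "traverse D A h = arc D (smooth A h)"

fun tail_left :: "(nat \<Rightarrow> arrow) \<Rightarrow> nat \<Rightarrow> dpoint" where
  "tail_left arr k = End k (case arr k of SW_to_NE \<Rightarrow> West | NE_to_SW \<Rightarrow> East)"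

fun head_left :: "(nat \<Rightarrow> arrow) \<Rightarrow> nat \<Rightarrow> dpoint" where
  "head_left arr k = End k (case arr k of SW_to_NE \<Rightarrow> East | NE_to_SW \<Rightarrow> West)"

fun tail_right :: "(nat \<Rightarrow> arrow) \<Rightarrow> nat \<Rightarrow> dpoint" where
  "tail_right arr k = End k (case arr k of SW_to_NE \<Rightarrow> South | NE_to_SW \<Rightarrow> North)"

fun head_right :: "(nat \<Rightarrow> arrow) \<Rightarrow> nat \<Rightarrow> dpoint" where
  "head_right arr k = End k (case arr k of SW_to_NE \<Rightarrow> North | NE_to_SW \<Rightarrow> South)"

text \<open>A single run through the orbit of \<open>h0\<close> meets \<open>h0, h1, h2, h3\<close> in this cyclic order.\<close>

definition cyclic_order :: "('p \<Rightarrow> 'p) \<Rightarrow> 'p \<Rightarrow> 'p \<Rightarrow> 'p \<Rightarrow> 'p \<Rightarrow> bool" where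
  "cyclic_order f h0 h1 h2 h3 \<longleftrightarrow>
     (\<exists>p q r. 0 < p \<and> p < q \<and> q < r \<and>
        (f ^^ p) h0 = h1 \<and> (f ^^ q) h0 = h2 \<and> (f ^^ r) h0 = h3 \<and>
        (\<forall>m. 0 < m \<and> m \<le> r \<longrightarrow> (f ^^ m) h0 \<noteq> h0))"

datatype face_type = TypeX | TypeY

text \<open>
  For a circle traversed counterclockwise, the inside is on the left and the outside on the right.
  A clockwise traversal has the outside on the left; it reverses the cyclic order and exchanges
  the roles of \<open>a\<close> and \<open>b\<close>, and both cyclic patterns below are preserved by this.  Hence the type
  of a face depends only on the sides and not on the choice of the unbounded region.
\<close>

fun arcs_of_type ::
  "face_type \<Rightarrow> link_diagram \<Rightarrow> (nat \<Rightarrow> arrow) \<Rightarrow> nat set \<Rightarrow> nat \<Rightarrow> nat \<Rightarrow> bool" where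
  "arcs_of_type TypeY D arr A a b \<longleftrightarrow>
     cyclic_order (traverse D A)
       (tail_left arr a) (head_right arr b) (head_left arr a) (tail_right arr b)"
| "arcs_of_type TypeX D arr A a b \<longleftrightarrow>
     cyclic_order (traverse D A)
       (tail_left arr a) (tail_right arr b) (head_left arr a) (head_right arr b)"

text \<open>
  The face with the vertices \<open>A\<close>, \<open>A \<union> {i}\<close>, \<open>A \<union> {j}\<close>, \<open>A \<union> {i, j}\<close>; either of the two
  surgery arcs may be the inner one.
\<close>

definition face_of_type ::
  "face_type \<Rightarrow> link_diagram \<Rightarrow> (nat \<Rightarrow> arrow) \<Rightarrow> nat set \<Rightarrow> nat \<Rightarrow> nat \<Rightarrow> bool" where
  "face_of_type t D arr A i j \<longleftrightarrow> arcs_of_type t D arr A i j \<or> arcs_of_type t D arr A j i"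

definition face_composition ::
  "link_diagram \<Rightarrow> (nat \<Rightarrow> arrow) \<Rightarrow> nat set \<Rightarrow> nat \<Rightarrow> nat \<Rightarrow> circle exterior \<Rightarrow> circle exterior"
where
  "face_composition D arr A i j x = edge_map D arr (insert i A) j (edge_map D arr A i x)"

definition face_sign ::
  "face_type \<Rightarrow> link_diagram \<Rightarrow> (nat \<Rightarrow> arrow) \<Rightarrow> nat set \<Rightarrow> nat \<Rightarrow> nat \<Rightarrow> int" where
  "face_sign t D arr A i j =
     (let F = exterior_on (circles D A);
          f = face_composition D arr A i j;
          g = face_composition D arr A j i
      in if (\<exists>x \<in> F. f x \<noteq> 0) \<and> (\<exists>x \<in> F. g x \<noteq> 0)
         then THE s. (s = 1 \<or> s = -1) \<and> (\<forall>x \<in> F. f x = of_int s * g x)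
         else if face_of_type t D arr A i j then -1 else 1)"

text \<open>\<open>e A i\<close> is the sign of the edge from \<open>A\<close> to \<open>insert i A\<close>.\<close>

definition sign_assignment ::
  "face_type \<Rightarrow> link_diagram \<Rightarrow> (nat \<Rightarrow> arrow) \<Rightarrow> (nat set \<Rightarrow> nat \<Rightarrow> int) \<Rightarrow> bool" where
  "sign_assignment t D arr e \<longleftrightarrow>
     (\<forall>A i. A \<subseteq> crossings D \<and> i \<in> crossings D - A \<longrightarrow> e A i = 1 \<or> e A i = -1) \<and>
     (\<forall>A i j. A \<subseteq> crossings D \<and> i \<in> crossings D - A \<and> j \<in> crossings D - A \<and> i \<noteq> j \<longrightarrow>
        e A i * e (insert i A) j * e A j * e (insert j A) i * face_sign t D arr A i j = -1)"


section \<open>The odd Khovanov complex\<close>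

record 'g cochain_complex =
  group_at :: "int \<Rightarrow> 'g monoid"
  diff_at :: "int \<Rightarrow> 'g \<Rightarrow> 'g"

definition isomorphic_complexes :: "'g cochain_complex \<Rightarrow> 'h cochain_complex \<Rightarrow> bool" where
  "isomorphic_complexes C C' \<longleftrightarrow>
     (\<exists>\<phi>. \<forall>k. \<phi> k \<in> iso (group_at C k) (group_at C' k) \<and>
        (\<forall>x \<in> carrier (group_at C k). \<phi> (k + 1) (diff_at C k x) = diff_at C' k (\<phi> k x)))"

definition cube_vertices :: "link_diagram \<Rightarrow> int \<Rightarrow> nat set set" where
  "cube_vertices D k =
     {A. A \<subseteq> crossings D \<and> int (card A) - int (card (negative_crossings D)) = k}"

text \<open>
  The component of the differential at the vertex \<open>B\<close> collects the edges that end there; these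
  come from the vertices \<open>B - {i}\<close> with \<open>i \<in> B\<close>.
\<close>

definition odd_khovanov_complex ::
  "link_diagram \<Rightarrow> (nat \<Rightarrow> arrow) \<Rightarrow> (nat set \<Rightarrow> nat \<Rightarrow> int)
     \<Rightarrow> (nat set \<Rightarrow> circle exterior) cochain_complex" where
  "odd_khovanov_complex D arr e =
     \<lparr>group_at = (\<lambda>k. sum_group (cube_vertices D k) (\<lambda>A. exterior_group (circles D A))),
      diff_at = (\<lambda>k x. \<lambda>B \<in> cube_vertices D (k + 1).
        \<Sum>i \<in> B. of_int (e (B - {i}) i) * edge_map D arr (B - {i}) i (x (B - {i})))\<rparr>"

end

theory Submission
  imports Defs "HOL-Library.Z2"
begin

text \<open>
  Colour the regions of the diagram black and white like a checkerboard. The surgery arc of a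
  crossing lies in a region of the same colour in every resolution, and the two arcs of a face of
  type X or Y lie in regions of different colours. It follows that the faces of type X or Y are
  exactly those with an odd number of edges that are merges along black arcs. Up to a coboundary,
  the two sign assignments therefore differ by the sign that is \<open>-1\<close> on these edges.

  This sign is absorbed by automorphisms that are not diagonal. Within a component of the diagram
  the differences of circles are the direct sum of those generated by pairs of circles that border
  a common black region and those generated by pairs that border a common white region. Let
  \<open>g\<close> be \<open>1\<close> on the first summand, \<open>-1\<close> on the second one, and fix the circle through a base point.
  Merges commute with \<open>\<Lambda>g\<close>. So do splits, up to sign: a split along a white arc multiplies by an
  element of the first summand, and a split along a black arc by one of the second. Multiplying
  \<open>\<Lambda>g\<close> at each vertex by \<open>-1\<close> for every black crossing with a 1-resolution moves the sign
  from the black splits to the black merges.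

  Both the colouring and the direct sum decomposition are primitives of closed cochains on a
  planar map.
\<close>

section \<open>Orbits and transpositions\<close>

text \<open>Signs at vertices change the edge signs by factors whose product around every face is 1,
  while the two given assignments differ by -1 around each face of type X or Y. This is the obstacle
  to a diagonal isomorphism. A non-diagonal one comes from the integral involution 1 - 2q, where q
  is the projection of the differences of circles to the white summand. The summands are never
  formed: the proof keeps only q of the circle at an end minus the circle at the base end, as a
  function determined by its increments from end to end. Every compatibility then reduces to a
  comparison of increments. The same function takes the place of Jordan curve arguments. At a
  crossing, q keeps the difference of the two circles entirely or kills it, depending on colour and
  resolution, so the colours of two crossings that join the same two circles can be compared.
  Planarity enters through the Euler count, which is carried along an induction over the edges of
  the diagram. Circles are cycles of one permutation, each run with black on its left; changing a
  resolution multiplies this permutation by a transposition.\<close>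

lemma equiv_symD: "equiv E R \<Longrightarrow> (x, y) \<in> R \<Longrightarrow> (y, x) \<in> R"
  unfolding equiv_def by (auto dest: symD)

lemma equiv_transD: "equiv E R \<Longrightarrow> (x, y) \<in> R \<Longrightarrow> (y, z) \<in> R \<Longrightarrow> (x, z) \<in> R"
  unfolding equiv_def by (auto dest: transD)

text \<open>Forward iterates suffice: on a finite set permuted by \<open>f\<close> every point
  returns, so this is already an equivalence.\<close>

definition orbit_rel :: "('a \<Rightarrow> 'a) \<Rightarrow> 'a set \<Rightarrow> 'a rel" where
  "orbit_rel f E = {(x, y). x \<in> E \<and> (\<exists>n. y = (f ^^ n) x)}"

lemma orbit_relI: "x \<in> E \<Longrightarrow> (x, (f ^^ n) x) \<in> orbit_rel f E"
  by (auto simp: orbit_rel_def)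

lemma orbit_rel_refl: "x \<in> E \<Longrightarrow> (x, x) \<in> orbit_rel f E"
  using orbit_relI[of x E 0 f] by simp

lemma orbit_rel_step: "x \<in> E \<Longrightarrow> (x, f x) \<in> orbit_rel f E"
  using orbit_relI[of x E 1 f] by simp

lemma funpow_closed:
  assumes "bij_betw f E E" "x \<in> E" shows "(f ^^ n) x \<in> E"
  using assms by (induction n) (auto dest: bij_betwE)

lemma funpow_inj_on:
  assumes "bij_betw f E E" "x \<in> E" "y \<in> E" "(f ^^ n) x = (f ^^ n) y" shows "x = y"
  using assms
proof (induction n)
  case (Suc n)
  then show ?case
    using funpow_closed[OF Suc.prems(1)] by (auto simp: bij_betw_def inj_on_eq_iff)
qed auto

lemma funpow_period:
  assumes "finite E" "bij_betw f E E" "x \<in> E"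
  obtains N where "0 < N" "(f ^^ N) x = x" "\<And>m. 0 < m \<Longrightarrow> m < N \<Longrightarrow> (f ^^ m) x \<noteq> x"
proof -
  have "\<not> inj_on (\<lambda>n. (f ^^ n) x) {..card E}"
    using card_inj_on_le[of "\<lambda>n. (f ^^ n) x" "{..card E}" E] funpow_closed[OF assms(2,3)] assms(1)
    by auto
  then obtain a b where "(f ^^ a) x = (f ^^ b) x" "a \<noteq> b"
    by (auto simp: inj_on_def)
  then obtain a b where ab: "(f ^^ a) x = (f ^^ b) x" "a < b"
    by (metis linorder_neqE_nat)
  have "(f ^^ a) ((f ^^ (b - a)) x) = (f ^^ a) x"
    using ab by (metis funpow_add le_add_diff_inverse nat_less_le o_apply)
  then have "(f ^^ (b - a)) x = x"
    using funpow_inj_on[OF assms(2)] funpow_closed[OF assms(2,3)] assms(3) by metis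
  then have ex: "\<exists>N. 0 < N \<and> (f ^^ N) x = x" using ab(2) by (intro exI[of _ "b - a"]) auto
  show ?thesis
    by (rule that[of "LEAST N. 0 < N \<and> (f ^^ N) x = x"])
       (use LeastI_ex[OF ex] not_less_Least[of _ "\<lambda>N. 0 < N \<and> (f ^^ N) x = x"] in blast)+
qed

lemma equiv_orbit_rel:
  assumes "finite E" "bij_betw f E E" shows "equiv E (orbit_rel f E)"
proof (intro equivI)
  show sub: "orbit_rel f E \<subseteq> E \<times> E"
    using funpow_closed[OF assms(2)] by (auto simp: orbit_rel_def)
  show "refl_on E (orbit_rel f E)"
    using sub by (auto simp: refl_on_def orbit_rel_refl)
  show "sym (orbit_rel f E)"
  proof (intro symI)
    fix x y assume "(x, y) \<in> orbit_rel f E"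
    then obtain n where x: "x \<in> E" and y: "y = (f ^^ n) x" by (auto simp: orbit_rel_def)
    obtain N where N: "0 < N" "(f ^^ N) x = x" using funpow_period[OF assms x] .
    have "(f ^^ (N * m)) x = x" for m
      by (induction m) (simp_all add: funpow_add N(2))
    moreover have "n \<le> N * n" using N(1) by simp
    ultimately have "(f ^^ (N * n - n)) y = x"
      unfolding y by (metis add.commute funpow_add le_add_diff_inverse o_apply)
    moreover have "y \<in> E" using y funpow_closed[OF assms(2) x] by simp
    ultimately show "(y, x) \<in> orbit_rel f E" by (auto simp: orbit_rel_def)
  qed
  show "trans (orbit_rel f E)"
  proof (intro transI)
    fix x y z assume "(x, y) \<in> orbit_rel f E" "(y, z) \<in> orbit_rel f E"
    then show "(x, z) \<in> orbit_rel f E"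
      by (auto simp: orbit_rel_def) (metis funpow_add o_apply)
  qed
qed

text \<open>The standard way below to bound an orbit relation: only a single step of
  \<open>f\<close> has to be checked.\<close>

lemma orbit_rel_least:
  assumes "equiv E R" "\<And>x. x \<in> E \<Longrightarrow> (x, f x) \<in> R"
  shows "orbit_rel f E \<subseteq> R"
proof -
  have "(x, (f ^^ n) x) \<in> R" if "x \<in> E" for x n
  proof (induction n)
    case 0 show ?case using assms(1) that by (simp add: equiv_def refl_on_def)
  next
    case (Suc n)
    moreover have "(f ^^ n) x \<in> E" using Suc assms(1) equiv_class_eq_iff by metis
    ultimately show ?case using assms by (auto simp: equiv_def dest: transD)
  qed
  then show ?thesis by (auto simp: orbit_rel_def)
qed

lemma orbit_rel_cong:
  assumes "finite E" "bij_betw f E E" "\<And>x. x \<in> E \<Longrightarrow> f x = g x"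
  shows "orbit_rel f E = orbit_rel g E"
proof
  have g: "bij_betw g E E" using assms(2,3) bij_betw_cong by metis
  show "orbit_rel f E \<subseteq> orbit_rel g E"
    by (rule orbit_rel_least[OF equiv_orbit_rel[OF assms(1) g]]) (simp add: assms(3) orbit_rel_step)
  show "orbit_rel g E \<subseteq> orbit_rel f E"
    by (rule orbit_rel_least[OF equiv_orbit_rel[OF assms(1,2)]])
       (simp add: assms(3)[symmetric] orbit_rel_step)
qed

text \<open>For an equivalence \<open>R\<close> this is the equivalence generated by
  \<open>R\<close> and \<open>(u, v)\<close>: a chain needs to cross the new pair at most once, in
  one direction or the other.\<close>

definition join_rel :: "'a rel \<Rightarrow> 'a \<Rightarrow> 'a \<Rightarrow> 'a rel" where
  "join_rel R u v = R \<union> {(x, y). (x, u) \<in> R \<and> (v, y) \<in> R} \<union> {(x, y). (x, v) \<in> R \<and> (u, y) \<in> R}"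

lemma join_rel_absorb:
  assumes "equiv E R" "(u, v) \<in> R" shows "join_rel R u v = R"
proof -
  have "(x, z) \<in> R" if "(x, y) \<in> R" "(y, z) \<in> R" for x y z
    using assms(1) that by (auto simp: equiv_def dest: transD)
  moreover have "(y, x) \<in> R" if "(x, y) \<in> R" for x y
    using assms(1) that by (auto simp: equiv_def dest: symD)
  ultimately show ?thesis using assms(2) unfolding join_rel_def by blast
qed

lemma equiv_join_rel:
  assumes "equiv E R" "u \<in> E" "v \<in> E" shows "equiv E (join_rel R u v)"
proof (cases "(u, v) \<in> R")
  case False
  have R: "R \<subseteq> E \<times> E" "refl_on E R" "sym R" "trans R" using assms(1) by (auto simp: equiv_def)
  show ?thesis
  proof (intro equivI)
    show "join_rel R u v \<subseteq> E \<times> E" using R(1) by (auto simp: join_rel_def)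
    show "refl_on E (join_rel R u v)" using R(2) by (auto simp: refl_on_def join_rel_def)
    show "sym (join_rel R u v)" using R(3) by (auto simp: sym_def join_rel_def)
    have tr: "(x, z) \<in> R" if "(x, y) \<in> R" "(y, z) \<in> R" for x y z
      using R(4) that by (auto dest: transD)
    have sy: "(y, x) \<in> R" if "(x, y) \<in> R" for x y
      using R(3) that by (auto dest: symD)
    show "trans (join_rel R u v)"
      unfolding join_rel_def by (intro transI) (use tr sy in blast)
  qed
qed (use assms in \<open>simp add: join_rel_absorb\<close>)

lemma join_rel_least:
  assumes "equiv E R" "S \<subseteq> R" "(u, v) \<in> R" shows "join_rel S u v \<subseteq> R"
proof -
  have "(x, z) \<in> R" if "(x, y) \<in> R" "(y, z) \<in> R" for x y z
    using assms(1) that by (auto simp: equiv_def dest: transD)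
  moreover have "(y, x) \<in> R" if "(x, y) \<in> R" for x y
    using assms(1) that by (auto simp: equiv_def dest: symD)
  ultimately show ?thesis using assms(2,3) unfolding join_rel_def by blast
qed

lemma join_rel_class:
  assumes "equiv E R" "u \<in> E" "v \<in> E" "x \<in> E"
  shows "join_rel R u v `` {x} =
    (if (x, u) \<in> R \<or> (x, v) \<in> R then R `` {u} \<union> R `` {v} else R `` {x})"
proof -
  have "join_rel R u v `` {x} = R `` {x} \<union> (if (x, u) \<in> R then R `` {v} else {})
      \<union> (if (x, v) \<in> R then R `` {u} else {})"
    by (auto simp: join_rel_def)
  moreover have "R `` {x} = R `` {u}" if "(x, u) \<in> R" using equiv_class_eq[OF assms(1) that] .
  moreover have "R `` {x} = R `` {v}" if "(x, v) \<in> R" using equiv_class_eq[OF assms(1) that] .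
  ultimately show ?thesis by (cases "(x, u) \<in> R"; cases "(x, v) \<in> R") auto
qed

lemma card_join_rel:
  assumes "finite E" "equiv E R" "u \<in> E" "v \<in> E" "(u, v) \<notin> R"
  shows "card (E // R) = Suc (card (E // join_rel R u v))"
proof -
  let ?U = "R `` {u}" and ?V = "R `` {v}"
  have UV: "?U \<in> E // R" "?V \<in> E // R" "?U \<noteq> ?V"
    using assms by (auto simp: quotientI eq_equiv_class_iff)
  have fin: "finite (E // R)" using assms(1,2) finite_quotient equiv_def by metis
  have eq: "E // join_rel R u v = insert (?U \<union> ?V) (E // R - {?U, ?V})"
  proof (intro equalityI subsetI)
    fix C assume "C \<in> E // join_rel R u v"
    then obtain x where x: "x \<in> E" "C = join_rel R u v `` {x}" by (auto elim: quotientE)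
    show "C \<in> insert (?U \<union> ?V) (E // R - {?U, ?V})"
      using x join_rel_class[OF assms(2-4) x(1)] eq_equiv_class_iff[OF assms(2) x(1)] assms(3,4)
      by (auto simp: quotientI)
  next
    fix C assume C: "C \<in> insert (?U \<union> ?V) (E // R - {?U, ?V})"
    then show "C \<in> E // join_rel R u v"
    proof
      assume "C = ?U \<union> ?V"
      moreover have "(u, u) \<in> R" using assms(2,3) by (simp add: equiv_def refl_on_def)
      ultimately have "C = join_rel R u v `` {u}" using join_rel_class[OF assms(2-4,3)] by auto
      then show ?thesis using assms(3) by (simp add: quotientI)
    next
      assume "C \<in> E // R - {?U, ?V}"
      then obtain x where x: "x \<in> E" "C = R `` {x}" "R `` {x} \<noteq> ?U" "R `` {x} \<noteq> ?V"
        unfolding quotient_def by blast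
      then have "C = join_rel R u v `` {x}"
        using join_rel_class[OF assms(2-4) x(1)] equiv_class_eq[OF assms(2), of x u]
          equiv_class_eq[OF assms(2), of x v] by metis
      then show ?thesis using x(1) by (simp add: quotientI)
    qed
  qed
  have "?U \<union> ?V \<notin> E // R"
  proof
    assume "?U \<union> ?V \<in> E // R"
    then have "?U = ?U \<union> ?V" "?V = ?U \<union> ?V"
      using quotient_disj[OF assms(2) UV(1), of "?U \<union> ?V"]
        quotient_disj[OF assms(2) UV(2), of "?U \<union> ?V"]
        equiv_class_self[OF assms(2,3)] equiv_class_self[OF assms(2,4)] by blast+
    then show False using UV(3) by simp
  qed
  then have "card (E // join_rel R u v) = Suc (card (E // R - {?U, ?V}))"
    unfolding eq using fin by (subst card_insert_disjoint) auto
  moreover have "card (E // R - {?U, ?V}) = card (E // R) - 2"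
    using UV fin by (subst card_Diff_subset) auto
  moreover have "card (E // R) \<ge> 2"
    using card_mono[OF fin, of "{?U, ?V}"] UV by auto
  ultimately show ?thesis by simp
qed

section \<open>Multiplying a permutation by a transposition\<close>

lemma bij_betw_transpose_comp:
  assumes "bij_betw f E E" "x \<in> E" "y \<in> E"
  shows "bij_betw (f \<circ> transpose x y) E E"
  using assms permutes_swap_id[of x E y] by (blast intro: bij_betw_trans permutes_imp_bij)

text \<open>The modified map sends \<open>y\<close> to where \<open>f\<close> sends
  \<open>x\<close>, and then follows \<open>f\<close> as long as the walk avoids both
  points.\<close>

lemma orbit_transpose_segment:
  assumes "x \<noteq> y" "0 < k" "(f ^^ k) x = y" "\<And>m. 0 < m \<Longrightarrow> m < k \<Longrightarrow> (f ^^ m) x \<noteq> x \<and> (f ^^ m) x \<noteq> y"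
  shows "0 < m \<Longrightarrow> m \<le> k \<Longrightarrow> ((f \<circ> transpose x y) ^^ m) y = (f ^^ m) x"
proof (induction m)
  case (Suc m)
  then show ?case
    using assms(4)[of m] by (cases "m = 0") auto
qed simp

text \<open>The stretch after \<open>x\<close> up to \<open>y\<close> closes to a cycle. It contains
  \<open>y\<close> but not \<open>x\<close>, and this asymmetry later tells the two sides of a cut
  apart.\<close>

lemma orbit_rel_cut_class:
  assumes "finite E" "bij_betw f E E" "x \<in> E" "x \<noteq> y" "0 < k" "(f ^^ k) x = y"
    "\<And>m. 0 < m \<Longrightarrow> m < k \<Longrightarrow> (f ^^ m) x \<noteq> x \<and> (f ^^ m) x \<noteq> y"
  shows "orbit_rel (f \<circ> transpose x y) E `` {y} = (\<lambda>m. (f ^^ m) x) ` {1..k}"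
proof -
  let ?g = "f \<circ> transpose x y"
  have y: "y \<in> E" using assms(2,3,6) funpow_closed by metis
  note seg = orbit_transpose_segment[OF assms(4-7)]
  have k: "(?g ^^ k) y = y" using seg[of k] assms(5,6) by simp
  show ?thesis
  proof (intro equalityI subsetI)
    fix z assume "z \<in> orbit_rel ?g E `` {y}"
    then obtain n where z: "z = (?g ^^ n) y" by (auto simp: orbit_rel_def)
    have z: "z = (?g ^^ (n mod k)) y" using funpow_mod_eq[OF k] z by simp
    show "z \<in> (\<lambda>m. (f ^^ m) x) ` {1..k}"
    proof (cases "n mod k = 0")
      case True then show ?thesis using z assms(5,6) by auto
    next
      case False
      moreover have "n mod k \<le> k" using assms(5) by (simp add: less_imp_le)
      ultimately show ?thesis using z seg[of "n mod k"] by auto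
    qed
  next
    fix z assume "z \<in> (\<lambda>m. (f ^^ m) x) ` {1..k}"
    then show "z \<in> orbit_rel ?g E `` {y}"
      using seg y by (auto simp: orbit_rel_def) (metis Suc_le_lessD)
  qed
qed

text \<open>The least time of reaching \<open>y\<close> precedes every return to \<open>x\<close>,
  because after a return \<open>y\<close> would have been reached sooner.\<close>

lemma orbit_rel_first_hit:
  assumes "finite E" "bij_betw f E E" "(x, y) \<in> orbit_rel f E" "x \<noteq> y"
  obtains k where "0 < k" "(f ^^ k) x = y" "\<And>m. 0 < m \<Longrightarrow> m < k \<Longrightarrow> (f ^^ m) x \<noteq> x \<and> (f ^^ m) x \<noteq> y"
proof -
  have ex: "\<exists>n. (f ^^ n) x = y" using assms(3) by (auto simp: orbit_rel_def)
  define k where "k = (LEAST n. (f ^^ n) x = y)"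
  have k: "(f ^^ k) x = y" unfolding k_def using LeastI_ex[OF ex] .
  have less: "(f ^^ m) x \<noteq> y" if "m < k" for m using that not_less_Least unfolding k_def by blast
  have ret: "(f ^^ m) x \<noteq> x" if m: "0 < m" "m < k" for m
  proof
    assume "(f ^^ m) x = x"
    then have "(f ^^ (k - m)) x = (f ^^ (k - m)) ((f ^^ m) x)" by simp
    also have "\<dots> = y" using k m by (metis comp_apply funpow_add le_add_diff_inverse2 less_imp_le)
    finally show False using less[of "k - m"] m by simp
  qed
  have "0 < k" using k assms(4) by (cases k) auto
  then show ?thesis using that k less ret by blast
qed

lemma orbit_rel_cut:
  assumes "finite E" "bij_betw f E E" "(x, y) \<in> orbit_rel f E" "x \<noteq> y"
  shows "(x, y) \<notin> orbit_rel (f \<circ> transpose x y) E"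
proof
  have x: "x \<in> E" and y: "y \<in> E"
    using assms(3) funpow_closed[OF assms(2)] by (auto simp: orbit_rel_def)
  assume "(x, y) \<in> orbit_rel (f \<circ> transpose x y) E"
  then have "(y, x) \<in> orbit_rel (f \<circ> transpose x y) E"
    using equiv_orbit_rel[OF assms(1) bij_betw_transpose_comp[OF assms(2) x y]]
    by (auto simp: equiv_def dest: symD)
  moreover obtain k where k: "0 < k" "(f ^^ k) x = y"
    "\<And>m. 0 < m \<Longrightarrow> m < k \<Longrightarrow> (f ^^ m) x \<noteq> x \<and> (f ^^ m) x \<noteq> y"
    using orbit_rel_first_hit[OF assms] by metis
  ultimately have "x \<in> (\<lambda>m. (f ^^ m) x) ` {1..k}"
    using orbit_rel_cut_class[OF assms(1,2) x assms(4) k] by blast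
  then obtain m where m: "m \<in> {1..k}" "x = (f ^^ m) x" by (rule imageE)
  then have "0 < m" "m < k" using k(2) assms(4) by (auto simp: nat_less_le)
  then show False using k(3) m(2) by metis
qed

text \<open>The modified walk from \<open>y\<close> runs once through the old cycle of
  \<open>x\<close>, which does not contain \<open>y\<close>, and arrives at \<open>x\<close>; this
  links the two cycles.\<close>

lemma orbit_rel_merge:
  assumes "finite E" "bij_betw f E E" "x \<in> E" "y \<in> E" "(x, y) \<notin> orbit_rel f E"
  shows "orbit_rel (f \<circ> transpose x y) E = join_rel (orbit_rel f E) x y"
proof
  let ?g = "f \<circ> transpose x y"
  let ?R = "orbit_rel f E" and ?S = "orbit_rel ?g E"
  have xy: "x \<noteq> y" using assms(3,5) orbit_rel_refl by metis
  have eR: "equiv E ?R" using equiv_orbit_rel[OF assms(1,2)] .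
  have eS: "equiv E ?S" using equiv_orbit_rel[OF assms(1) bij_betw_transpose_comp[OF assms(2-4)]] .
  have trS: "(a, c) \<in> ?S" if "(a, b) \<in> ?S" "(b, c) \<in> ?S" for a b c
    using eS that by (auto simp: equiv_def dest: transD)
  have symS: "(b, a) \<in> ?S" if "(a, b) \<in> ?S" for a b
    using eS that by (auto simp: equiv_def dest: symD)
  have J: "equiv E (join_rel ?R x y)" using equiv_join_rel[OF eR assms(3,4)] .
  show "?S \<subseteq> join_rel ?R x y"
  proof (rule orbit_rel_least[OF J])
    fix p assume p: "p \<in> E"
    show "(p, ?g p) \<in> join_rel ?R x y"
      using p orbit_rel_step[of _ E f] orbit_rel_refl[of _ E f] assms(3,4)
      by (auto simp: join_rel_def transpose_def)
  qed
  obtain N where N: "0 < N" "(f ^^ N) x = x" "\<And>m. 0 < m \<Longrightarrow> m < N \<Longrightarrow> (f ^^ m) x \<noteq> x"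
    using funpow_period[OF assms(1-3)] by metis
  have "(?g ^^ m) y = (f ^^ m) x" if "0 < m" "m \<le> N" for m
    using that
  proof (induction m)
    case (Suc m)
    have "(f ^^ m) x \<noteq> y" using assms(3,5) orbit_relI[of x E m f] by metis
    then show ?case using Suc N(3)[of m] by (cases "m = 0") auto
  qed simp
  then have "(y, x) \<in> ?S" using N(1,2) orbit_relI[OF assms(4), of N ?g] by simp
  then have xyS: "(x, y) \<in> ?S" by (rule symS)
  have "?R \<subseteq> ?S"
  proof (rule orbit_rel_least[OF eS])
    fix p assume p: "p \<in> E"
    have "?g x = f y" "?g y = f x" by auto
    with p xyS trS symS orbit_rel_step[of _ E ?g] assms(3,4)
    have "p = x \<Longrightarrow> (p, f p) \<in> ?S" "p = y \<Longrightarrow> (p, f p) \<in> ?S"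
      by metis+
    moreover have "p \<noteq> x \<Longrightarrow> p \<noteq> y \<Longrightarrow> (p, f p) \<in> ?S"
      using orbit_rel_step[OF p, of ?g] by simp
    ultimately show "(p, f p) \<in> ?S" by blast
  qed
  then show "join_rel ?R x y \<subseteq> ?S" using join_rel_least[OF eS _ xyS] by blast
qed

text \<open>A second multiplication by the transposition restores \<open>f\<close>, so this is the
  merging lemma applied to the cut permutation.\<close>

lemma orbit_rel_split:
  assumes "finite E" "bij_betw f E E" "(x, y) \<in> orbit_rel f E" "x \<noteq> y"
  shows "orbit_rel f E = join_rel (orbit_rel (f \<circ> transpose x y) E) x y"
proof -
  have xy: "x \<in> E" "y \<in> E"
    using assms(3) funpow_closed[OF assms(2)] by (auto simp: orbit_rel_def)
  have "f \<circ> transpose x y \<circ> transpose x y = f" by (simp add: fun_eq_iff)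
  then show ?thesis
    using orbit_rel_merge[OF assms(1) bij_betw_transpose_comp[OF assms(2) xy] xy orbit_rel_cut[OF assms]]
    by simp
qed

section \<open>Exactness of cochains of genus zero\<close>

text \<open>Edges are inserted one at a time, each multiplying the face permutation by one
  transposition; the list is what the induction over edges runs on.\<close>

fun glue :: "('a \<Rightarrow> 'a) \<Rightarrow> ('a \<times> 'a) list \<Rightarrow> 'a \<Rightarrow> 'a" where
  "glue s [] = s"
| "glue s ((u, v) # L) = glue s L \<circ> transpose u v"

fun glue_conn :: "('a \<Rightarrow> 'a) \<Rightarrow> 'a set \<Rightarrow> ('a \<times> 'a) list \<Rightarrow> 'a rel" where
  "glue_conn s E [] = orbit_rel s E"
| "glue_conn s E ((u, v) # L) = join_rel (glue_conn s E L) u v"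

lemma bij_betw_glue:
  assumes "bij_betw s E E" "set L \<subseteq> E \<times> E" shows "bij_betw (glue s L) E E"
  using assms(2) by (induction L) (auto simp: assms(1) simp del: o_apply intro!: bij_betw_transpose_comp)

lemma equiv_glue_conn:
  assumes "finite E" "bij_betw s E E" "set L \<subseteq> E \<times> E" shows "equiv E (glue_conn s E L)"
  using assms(3) by (induction L) (auto simp: equiv_orbit_rel[OF assms(1,2)] intro!: equiv_join_rel)

lemma glue_conn_mono: "glue_conn s E L \<subseteq> glue_conn s E ((u, v) # L)"
  by (auto simp: join_rel_def)

lemma orbit_subset_glue_conn: "orbit_rel s E \<subseteq> glue_conn s E L"
  by (induction L) (auto simp: join_rel_def)

lemma glue_conn_pair:
  assumes "finite E" "bij_betw s E E" "set L \<subseteq> E \<times> E" "(u, v) \<in> set L"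
  shows "(u, v) \<in> glue_conn s E L"
  using assms(3,4)
proof (induction L)
  case (Cons e L)
  obtain a b where e: "e = (a, b)" by force
  have "refl_on E (glue_conn s E L)"
    using equiv_glue_conn[OF assms(1,2)] Cons.prems(1) by (auto simp: equiv_def)
  then show ?case
    using Cons unfolding e by (auto simp: join_rel_def refl_on_def)
qed simp

lemma orbit_glue_subset_conn:
  assumes "finite E" "bij_betw s E E" "set L \<subseteq> E \<times> E"
  shows "orbit_rel (glue s L) E \<subseteq> glue_conn s E L"
  using assms(3)
proof (induction L)
  case (Cons e L)
  obtain u v where e: "e = (u, v)" by force
  have uv: "u \<in> E" "v \<in> E" "set L \<subseteq> E \<times> E" using Cons.prems e by auto
  have eq: "equiv E (glue_conn s E (e # L))" using equiv_glue_conn[OF assms(1,2) Cons.prems] .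
  have bij: "bij_betw (glue s L) E E" using bij_betw_glue[OF assms(2) uv(3)] .
  have IH: "(p, glue s L p) \<in> glue_conn s E (e # L)" if "p \<in> E" for p
    unfolding e using glue_conn_mono Cons.IH[OF uv(3)] orbit_rel_step[OF that] by (meson subsetD)
  have pair: "(u, v) \<in> glue_conn s E (e # L)"
    using glue_conn_pair[OF assms(1,2) Cons.prems] e by simp
  note tr = equiv_transD[OF eq] and sy = equiv_symD[OF eq]
  have re: "(p, p) \<in> glue_conn s E (e # L)" if "p \<in> E" for p
    using eq that unfolding equiv_def by (blast dest: refl_onD)
  show ?case
  proof (rule orbit_rel_least[OF eq])
    fix p assume p: "p \<in> E"
    have "glue s (e # L) p = glue s L (transpose u v p)" by (simp add: e)
    moreover have "(p, transpose u v p) \<in> glue_conn s E (e # L)"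
      using pair sy[OF pair] re[OF p] by (metis transpose_apply_first transpose_apply_other transpose_apply_second)
    moreover have "transpose u v p \<in> E" using p uv by (simp add: transpose_def)
    ultimately show "(p, glue s (e # L) p) \<in> glue_conn s E (e # L)"
      using IH tr by metis
  qed
qed simp

lemma sum_union_of_classes:
  fixes w :: "'a \<Rightarrow> 'g :: comm_monoid_add"
  assumes "finite E" "equiv E R" "X \<subseteq> E" "\<And>x. x \<in> X \<Longrightarrow> R `` {x} \<subseteq> X"
    "\<And>x. x \<in> X \<Longrightarrow> sum w (R `` {x}) = 0"
  shows "sum w X = 0"
proof -
  let ?C = "(\<lambda>x. R `` {x}) ` X"
  have "X = \<Union> ?C" using assms(2-4) equiv_class_self[OF assms(2)] by blast
  moreover have "sum w (\<Union> ?C) = sum (sum w) ?C"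
  proof (rule sum.Union_disjoint[THEN trans])
    show "\<forall>A\<in>?C. finite A"
      using assms(3,4) finite_subset[OF _ assms(1)] by (metis (no_types, lifting) imageE order_trans)
    show "\<forall>A\<in>?C. \<forall>B\<in>?C. A \<noteq> B \<longrightarrow> A \<inter> B = {}"
    proof (intro ballI impI)
      fix A B assume AB: "A \<in> ?C" "B \<in> ?C" "A \<noteq> B"
      then have "A \<in> E // R" "B \<in> E // R" using assms(3) unfolding quotient_def by blast+
      then show "A \<inter> B = {}" using quotient_disj[OF assms(2)] AB(3) by blast
    qed
  qed simp
  moreover have "sum (sum w) ?C = 0" using assms(5) by (intro sum.neutral) auto
  ultimately show ?thesis by simp
qed

lemma sum_telescope_bij:
  fixes H w :: "'a \<Rightarrow> 'g :: ab_group_add"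
  assumes "bij_betw f X X" "\<And>x. x \<in> X \<Longrightarrow> w (f x) = H (f x) - H x"
  shows "sum w X = 0"
proof -
  have "sum w X = (\<Sum>x\<in>X. w (f x))" using sum.reindex_bij_betw[OF assms(1), of w] by simp
  also have "\<dots> = (\<Sum>x\<in>X. H (f x)) - sum H X" by (simp add: assms(2) sum_subtractf)
  also have "(\<Sum>x\<in>X. H (f x)) = sum H X" by (rule sum.reindex_bij_betw[OF assms(1)])
  finally show ?thesis by simp
qed

lemma bij_betw_class:
  assumes "finite E" "bij_betw f E E" "equiv E R" "orbit_rel f E \<subseteq> R" "x \<in> E"
  shows "bij_betw f (R `` {x}) (R `` {x})"
proof -
  have sub: "R `` {x} \<subseteq> E" using assms(3) by (auto simp: equiv_def)
  have "f ` (R `` {x}) \<subseteq> R `` {x}"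
  proof
    fix z assume "z \<in> f ` (R `` {x})"
    then obtain y where y: "(x, y) \<in> R" "z = f y" by auto
    moreover have "(y, f y) \<in> R" using assms(4) orbit_rel_step[of y E f] sub y(1) by auto
    ultimately show "z \<in> R `` {x}" using assms(3) by (auto simp: equiv_def dest: transD)
  qed
  moreover have "inj_on f (R `` {x})" using assms(2) sub by (meson bij_betw_def inj_on_subset)
  moreover have "finite (R `` {x})" using sub assms(1) finite_subset by blast
  ultimately show ?thesis by (simp add: bij_betw_def endo_inj_surj)
qed

text \<open>The transpositions do not change \<open>H\<close>, so along a face its increments come
  from \<open>s\<close> alone.\<close>

lemma glue_potential:
  assumes "\<And>p. p \<in> E \<Longrightarrow> H (s p) = H p + w (s p)" "\<And>u v. (u, v) \<in> set L \<Longrightarrow> H u = H v"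
    "set L \<subseteq> E \<times> E" "t \<in> E"
  shows "H (glue s L t) = H t + w (glue s L t)"
  using assms(2-4)
proof (induction L arbitrary: t)
  case (Cons e L)
  obtain u v where e: "e = (u, v)" by force
  have "H (transpose u v t) = H t" using Cons.prems(1)[of u v] e by (auto simp: transpose_def)
  moreover have "transpose u v t \<in> E" using Cons.prems e by (auto simp: transpose_def)
  ultimately show ?case using Cons e by (metis glue.simps(2) list.set_intros(2) o_apply set_subset_Cons subset_trans)
qed (use assms(1) in auto)

text \<open>
  The orbits of \<open>s\<close>, the list \<open>L\<close> and the orbits of \<open>glue s L\<close> are the vertices, edges and faces
  of a map on a closed surface. Adding an edge that joins two components merges two faces, and
  adding an edge within a component changes the number of faces by one. In genus zero every
  edge of the second kind therefore splits a face, so that the cycle closed by it bounds one.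
\<close>

theorem genus_zero_exact:
  fixes w :: "'a \<Rightarrow> 'g :: ab_group_add"
  assumes E: "finite E" "bij_betw s E E"
    and H0: "\<And>p. p \<in> E \<Longrightarrow> H0 (s p) = H0 p + w (s p)"
    and L: "set L \<subseteq> E \<times> E" "\<And>u v. (u, v) \<in> set L \<Longrightarrow> u \<noteq> v"
  shows "card (E // orbit_rel (glue s L) E) + card (E // orbit_rel s E)
           \<le> 2 * card (E // glue_conn s E L) + length L \<and>
         (card (E // orbit_rel (glue s L) E) + card (E // orbit_rel s E)
             = 2 * card (E // glue_conn s E L) + length L \<and>
          (\<forall>p\<in>E. sum w (orbit_rel (glue s L) E `` {p}) = 0) \<longrightarrow>
          (\<exists>H. (\<forall>p\<in>E. H (s p) = H p + w (s p)) \<and> (\<forall>(u, v)\<in>set L. H u = H v)))"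
  using L
proof (induction L)
  case Nil
  then show ?case using H0 by (auto intro!: exI[of _ H0])
next
  case (Cons e L)
  obtain u v where e: "e = (u, v)" by force
  have uv: "u \<in> E" "v \<in> E" "u \<noteq> v" "set L \<subseteq> E \<times> E" using Cons.prems e by auto
  let ?f = "glue s L" and ?R = "glue_conn s E L"
  let ?g = "?f \<circ> transpose u v" and ?S = "join_rel ?R u v"
  let ?orb = "\<lambda>f. orbit_rel f E"
  have bf: "bij_betw ?f E E" using bij_betw_glue[OF E(2) uv(4)] .
  have bg: "bij_betw ?g E E" using bij_betw_transpose_comp[OF bf uv(1,2)] .
  have ef: "equiv E (?orb ?f)" and eg: "equiv E (?orb ?g)"
    using equiv_orbit_rel[OF E(1)] bf bg by auto
  have eR: "equiv E ?R" using equiv_glue_conn[OF E uv(4)] .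
  have fR: "?orb ?f \<subseteq> ?R" using orbit_glue_subset_conn[OF E uv(4)] .
  have IH: "card (E // ?orb ?f) + card (E // ?orb s) \<le> 2 * card (E // ?R) + length L"
    and IH_ex: "\<lbrakk>card (E // ?orb ?f) + card (E // ?orb s) = 2 * card (E // ?R) + length L;
      \<And>p. p \<in> E \<Longrightarrow> sum w (?orb ?f `` {p}) = 0\<rbrakk> \<Longrightarrow>
      \<exists>H. (\<forall>p\<in>E. H (s p) = H p + w (s p)) \<and> (\<forall>(u, v)\<in>set L. H u = H v)"
    using Cons.IH[OF uv(4)] Cons.prems(2) by auto
  have glue: "glue s (e # L) = ?g" "glue_conn s E (e # L) = ?S" "length (e # L) = Suc (length L)"
    by (simp_all add: e)
  consider "(u, v) \<notin> ?R" | "(u, v) \<in> ?orb ?f" | "(u, v) \<in> ?R" "(u, v) \<notin> ?orb ?f"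
    using fR by blast
  then show ?case
  proof cases
    case 1
    then have nf: "(u, v) \<notin> ?orb ?f" using fR by blast
    have og: "?orb ?g = join_rel (?orb ?f) u v" using orbit_rel_merge[OF E(1) bf uv(1,2) nf] .
    have c: "card (E // ?orb ?f) = Suc (card (E // ?orb ?g))"
      "card (E // ?R) = Suc (card (E // ?S))"
      using card_join_rel[OF E(1) ef uv(1,2) nf] card_join_rel[OF E(1) eR uv(1,2) 1] og by auto
    \<comment> \<open>The increments of \<open>H0\<close> make the total weight of each component
      vanish. This supplies the one face sum that the new faces do not give.\<close>
    have cR: "sum w (?R `` {x}) = 0" if "x \<in> E" for x
    proof (rule sum_telescope_bij)
      show "bij_betw s (?R `` {x}) (?R `` {x})"
        using bij_betw_class[OF E eR orbit_subset_glue_conn that] .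
    next
      fix y assume "y \<in> ?R `` {x}"
      then have "y \<in> E" using eR by (auto simp: equiv_def)
      then show "w (s y) = H0 (s y) - H0 y" using H0 by simp
    qed
    have "\<exists>H. (\<forall>p\<in>E. H (s p) = H p + w (s p)) \<and> (\<forall>(u, v)\<in>set (e # L). H u = H v)"
      if eqn: "card (E // ?orb ?g) + card (E // ?orb s) = 2 * card (E // ?S) + Suc (length L)"
        and cl: "\<And>p. p \<in> E \<Longrightarrow> sum w (?orb ?g `` {p}) = 0"
    proof -
      have other: "sum w (?orb ?f `` {p}) = 0"
        if "p \<in> E" "(p, u) \<notin> ?orb ?f" "(p, v) \<notin> ?orb ?f" for p
        using cl[OF that(1)] join_rel_class[OF ef uv(1,2) that(1)] that(2,3) by (simp add: og)
      \<comment> \<open>Among the faces of its component, only the one at the attaching point is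
        changed by the new edge. Its sum is the total of the component minus sums known to be
        0.\<close>
      have one: "sum w (?orb ?f `` {x}) = 0"
        if x: "x \<in> E" "(x, u) \<in> ?orb ?f \<and> (v, x) \<notin> ?R \<or> (x, v) \<in> ?orb ?f \<and> (u, x) \<notin> ?R" for x
      proof -
        let ?U = "?R `` {x}" and ?C = "?orb ?f `` {x}"
        have sub: "?C \<subseteq> ?U" "?U \<subseteq> E" using fR eR by (auto simp: equiv_def)
        have trR: "(a, c) \<in> ?R" if "(a, b) \<in> ?R" "(b, c) \<in> ?R" for a b c
          using equiv_transD[OF eR that] .
        have syR: "(b, a) \<in> ?R" if "(a, b) \<in> ?R" for a b
          using equiv_symD[OF eR that] .
        have trf: "(a, c) \<in> ?orb ?f" if "(a, b) \<in> ?orb ?f" "(b, c) \<in> ?orb ?f" for a b c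
          using equiv_transD[OF ef that] .
        have syf: "(b, a) \<in> ?orb ?f" if "(a, b) \<in> ?orb ?f" for a b
          using equiv_symD[OF ef that] .
        have "sum w (?U - ?C) = 0"
        proof (rule sum_union_of_classes[OF E(1) ef])
          show "?U - ?C \<subseteq> E" using sub by blast
        next
          fix y assume y: "y \<in> ?U - ?C"
          show "?orb ?f `` {y} \<subseteq> ?U - ?C"
            using y fR trR trf syf by blast
          have "(y, u) \<notin> ?orb ?f" "(y, v) \<notin> ?orb ?f"
            using x(2) y fR trR syR trf syf by blast+
          then show "sum w (?orb ?f `` {y}) = 0" using other y sub by blast
        qed
        moreover have "sum w ?U = sum w (?U - ?C) + sum w ?C"
          using sum.subset_diff[OF sub(1)] finite_subset[OF sub(2) E(1)] by blast
        ultimately show ?thesis using cR[OF x(1)] by simp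
      qed
      have nvu: "(v, u) \<notin> ?R" using 1 equiv_symD[OF eR] by blast
      have "sum w (?orb ?f `` {p}) = 0" if p: "p \<in> E" for p
      proof -
        have trR: "(a, c) \<in> ?R" if "(a, b) \<in> ?R" "(b, c) \<in> ?R" for a b c
          using equiv_transD[OF eR that] .
        have "(p, u) \<in> ?orb ?f \<Longrightarrow> (v, p) \<notin> ?R" "(p, v) \<in> ?orb ?f \<Longrightarrow> (u, p) \<notin> ?R"
          using 1 nvu trR fR by blast+
        then show ?thesis using one[OF p] other[OF p] by blast
      qed
      then obtain H where H: "\<And>p. p \<in> E \<Longrightarrow> H (s p) = H p + w (s p)" "\<forall>(u, v)\<in>set L. H u = H v"
        using IH_ex eqn c by auto
      \<comment> \<open>A constant shift on the component of \<open>v\<close> makes the values at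
        \<open>u\<close> and \<open>v\<close> agree and disturbs no old edge.\<close>
      define H' where "H' p = (if (v, p) \<in> ?R then H p + (H u - H v) else H p)" for p
      have same: "(v, a) \<in> ?R \<longleftrightarrow> (v, b) \<in> ?R" if "(a, b) \<in> ?R" for a b
        using equiv_transD[OF eR] equiv_symD[OF eR] that by blast
      have "(v, v) \<in> ?R" using eR uv(2) by (auto simp: equiv_def refl_on_def)
      then have "H' u = H' v" using nvu by (simp add: H'_def)
      moreover have "H' a = H' b" if "(a, b) \<in> set L" for a b
        using H(2) that same[OF glue_conn_pair[OF E uv(4) that]] by (auto simp: H'_def)
      moreover have "H' (s p) = H' p + w (s p)" if "p \<in> E" for p
        using H(1)[OF that] same[of p "s p"] orbit_rel_step[OF that, of s] orbit_subset_glue_conn[of s E L]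
        by (auto simp: H'_def algebra_simps)
      ultimately show ?thesis unfolding e by (intro exI[of _ H']) auto
    qed
    then show ?thesis unfolding glue using IH c by (intro conjI impI; (elim conjE)?) (linarith, blast)
  next
    case 2
    then have R: "(u, v) \<in> ?R" using fR by blast
    have S: "?S = ?R" using join_rel_absorb[OF eR R] .
    have cut: "(u, v) \<notin> ?orb ?g" using orbit_rel_cut[OF E(1) bf 2 uv(3)] .
    have og: "?orb ?f = join_rel (?orb ?g) u v" using orbit_rel_split[OF E(1) bf 2 uv(3)] .
    have c: "card (E // ?orb ?g) = Suc (card (E // ?orb ?f))"
      using card_join_rel[OF E(1) eg uv(1,2) cut] og by simp
    have "\<exists>H. (\<forall>p\<in>E. H (s p) = H p + w (s p)) \<and> (\<forall>(u, v)\<in>set (e # L). H u = H v)"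
      if eqn: "card (E // ?orb ?g) + card (E // ?orb s) = 2 * card (E // ?S) + Suc (length L)"
        and cl: "\<And>p. p \<in> E \<Longrightarrow> sum w (?orb ?g `` {p}) = 0"
    proof -
      \<comment> \<open>The old face through \<open>u\<close> and \<open>v\<close> is the disjoint
        union of the two new ones; the other faces are unchanged.\<close>
      have "sum w (?orb ?f `` {p}) = 0" if p: "p \<in> E" for p
      proof -
        have "?orb ?g `` {u} \<inter> ?orb ?g `` {v} = {}"
          using quotient_disj[OF eg quotientI[OF uv(1)] quotientI[OF uv(2)]]
            eq_equiv_class_iff[OF eg uv(1,2)] cut by blast
        moreover have "finite (?orb ?g `` {u})" "finite (?orb ?g `` {v})"
          using eg E(1) by (auto simp: equiv_def intro: finite_subset)
        ultimately have "sum w (?orb ?g `` {u} \<union> ?orb ?g `` {v}) = 0"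
          using cl[OF uv(1)] cl[OF uv(2)] by (simp add: sum.union_disjoint)
        then show ?thesis
          using cl[OF p] join_rel_class[OF eg uv(1,2) p] by (simp add: og)
      qed
      then obtain H where H: "\<And>p. p \<in> E \<Longrightarrow> H (s p) = H p + w (s p)" "\<forall>(u, v)\<in>set L. H u = H v"
        using IH_ex eqn c S by auto
      obtain k where k: "0 < k" "(?f ^^ k) u = v"
        "\<And>m. 0 < m \<Longrightarrow> m < k \<Longrightarrow> (?f ^^ m) u \<noteq> u \<and> (?f ^^ m) u \<noteq> v"
        using orbit_rel_first_hit[OF E(1) bf 2 uv(3)] by metis
      have step: "H (?f t) = H t + w (?f t)" if "t \<in> E" for t
        by (rule glue_potential[where E = E and H = H and s = s and w = w and L = L])
           (use H uv(4) that in \<open>simp_all, blast\<close>)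
      \<comment> \<open>The walk along the old face from \<open>u\<close> to \<open>v\<close>
        collects exactly the weights of the new face through \<open>v\<close>, whose sum is
        0.\<close>
      have walk: "H ((?f ^^ m) u) = H u + (\<Sum>i=1..m. w ((?f ^^ i) u))" for m
        by (induction m) (use step funpow_closed[OF bf uv(1)] in \<open>auto simp: add.assoc\<close>)
      have inj: "inj_on (\<lambda>m. (?f ^^ m) u) {1..k}"
      proof (rule linorder_inj_onI)
        fix a b assume ab: "a < b" "a \<in> {1..k}" "b \<in> {1..k}"
        show "(?f ^^ a) u \<noteq> (?f ^^ b) u"
        proof
          assume eq: "(?f ^^ a) u = (?f ^^ b) u"
          have "(?f ^^ (k - b + a)) u = (?f ^^ (k - b)) ((?f ^^ b) u)"
            using eq by (simp add: funpow_add)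
          also have "\<dots> = v" using ab k(2) funpow_add[of "k - b" b ?f] by simp
          finally have "(?f ^^ (k - b + a)) u = v" .
          moreover have "0 < k - b + a" "k - b + a < k" using ab by auto
          note k(3)[OF this]
          ultimately show False by simp
        qed
      qed auto
      have "sum w (?orb ?g `` {v}) = (\<Sum>i=1..k. w ((?f ^^ i) u))"
        using orbit_rel_cut_class[OF E(1) bf uv(1) uv(3) k] sum.reindex[OF inj, of w]
        by (simp del: o_apply add: comp_def[of w])
      then have "H v = H u" using walk[of k] k(2) cl[OF uv(2)] by simp
      then show ?thesis using H unfolding e by (intro exI[of _ H]) auto
    qed
    then show ?thesis using IH c unfolding glue S by (intro conjI impI; (elim conjE)?) (linarith, blast)
  next
    case 3
    have S: "?S = ?R" using join_rel_absorb[OF eR 3(1)] .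
    \<comment> \<open>A face is lost and no component is: the left side of the count drops while the
      right side grows, so equality is impossible.\<close>
    have "card (E // ?orb ?f) = Suc (card (E // ?orb ?g))"
      using card_join_rel[OF E(1) ef uv(1,2) 3(2)] orbit_rel_merge[OF E(1) bf uv(1,2) 3(2)] by simp
    then show ?thesis unfolding glue S using IH by (intro conjI impI; (elim conjE)?) linarith+
  qed
qed

text \<open>One transposition per two-element orbit. For the arcs of a diagram this gives the list
  of edges that turns the crossing permutation into the face permutation.\<close>

lemma involution_glue:
  assumes "finite X" "\<And>p. p \<in> X \<Longrightarrow> a p \<in> X \<and> a p \<noteq> p \<and> a (a p) = p"
  shows "\<exists>L. 2 * length L = card X \<and> (\<forall>(u, v)\<in>set L. u \<in> X \<and> v = a u) \<and>
    (\<forall>p\<in>X. (p, a p) \<in> set L \<or> (a p, p) \<in> set L) \<and>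
    (\<forall>s p. glue s L p = s (if p \<in> X then a p else p))"
  using assms
proof (induction "card X" arbitrary: X rule: less_induct)
  case less
  show ?case
  proof (cases "X = {}")
    case True then show ?thesis by (intro exI[of _ "[]"]) auto
  next
    case False
    then obtain u where u: "u \<in> X" by blast
    let ?Y = "X - {u, a u}"
    have au: "a u \<in> X" "a u \<noteq> u" "a (a u) = u" using less.prems u by auto
    have card: "card X = card ?Y + 2"
      using less.prems(1) u au card_Diff_subset[of "{u, a u}" X] card_mono[of X "{u, a u}"] by auto
    have clY: "a p \<in> ?Y \<and> a p \<noteq> p \<and> a (a p) = p" if "p \<in> ?Y" for p
      using less.prems(2)[of p] that au by auto
    obtain L where L: "2 * length L = card ?Y" "\<forall>(u, v)\<in>set L. u \<in> ?Y \<and> v = a u"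
      "\<forall>p\<in>?Y. (p, a p) \<in> set L \<or> (a p, p) \<in> set L"
      "\<forall>s p. glue s L p = s (if p \<in> ?Y then a p else p)"
      using less.hyps[of ?Y] card less.prems(1) clY by (metis (no_types, lifting) finite_Diff less_add_same_cancel1 zero_less_numeral)
    have "glue s ((u, a u) # L) p = s (if p \<in> X then a p else p)" for s p
      using L(4) u au by (auto simp: transpose_def)
    moreover have "\<forall>p\<in>X. (p, a p) \<in> set ((u, a u) # L) \<or> (a p, p) \<in> set ((u, a u) # L)"
      using L(3) au by auto
    ultimately show ?thesis
      using L(1,2) card u by (intro exI[of _ "(u, a u) # L"]) auto
  qed
qed

section \<open>Checkerboard colouring\<close>

text \<open>The closure by which both circles and graph components are defined, with the two maps
  left open.\<close>

definition reach :: "('a \<Rightarrow> 'a) \<Rightarrow> ('a \<Rightarrow> 'a) \<Rightarrow> 'a set \<Rightarrow> 'a rel" where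
  "reach f g E = {(p, q). p \<in> E \<and> (p, q) \<in> ({(p, f p) | p. p \<in> E} \<union> {(p, g p) | p. p \<in> E})\<^sup>*}"

lemma reach_least:
  assumes "equiv E R" "\<And>p. p \<in> E \<Longrightarrow> (p, f p) \<in> R" "\<And>p. p \<in> E \<Longrightarrow> (p, g p) \<in> R"
  shows "reach f g E \<subseteq> R"
proof
  fix z assume "z \<in> reach f g E"
  then obtain p q where z: "z = (p, q)" "p \<in> E"
    "(p, q) \<in> ({(p, f p) | p. p \<in> E} \<union> {(p, g p) | p. p \<in> E})\<^sup>*"
    by (auto simp: reach_def)
  have "(p, q) \<in> R"
    using z(3)
  proof (induction rule: rtrancl_induct)
    case base then show ?case using assms(1) z(2) by (auto simp: equiv_def dest: refl_onD)
  next
    case (step y z)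
    then have "(y, z) \<in> R" using assms(2,3) by auto
    then show ?case using equiv_transD[OF assms(1)] step by blast
  qed
  then show "z \<in> R" using z by simp
qed

lemma reach_step: "p \<in> E \<Longrightarrow> (p, f p) \<in> reach f g E" "p \<in> E \<Longrightarrow> (p, g p) \<in> reach f g E"
  unfolding reach_def by (auto intro!: r_into_rtrancl)

lemma reach_trans: "(p, q) \<in> reach f g E \<Longrightarrow> (q, r) \<in> reach f g E \<Longrightarrow> (p, r) \<in> reach f g E"
  unfolding reach_def by (auto intro: rtrancl_trans)

text \<open>Symmetry holds because on a finite set the inverse of a bijection is reached by
  iterating it.\<close>

lemma equiv_reach:
  assumes "finite E" "bij_betw f E E" "bij_betw g E E" shows "equiv E (reach f g E)"
proof (intro equivI)
  have re: "(p, p) \<in> reach f g E" if "p \<in> E" for p using that by (auto simp: reach_def)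
  have orb: "(p, (h ^^ n) p) \<in> reach f g E" if "p \<in> E" "h = f \<or> h = g" for p h n
  proof (induction n)
    case (Suc n)
    have "(h ^^ n) p \<in> E" using that assms(2,3) funpow_closed by metis
    then have "((h ^^ n) p, h ((h ^^ n) p)) \<in> reach f g E" using that(2) reach_step by metis
    then show ?case using Suc reach_trans by force
  qed (simp add: re that)
  have bwd: "(h p, p) \<in> reach f g E" if p: "p \<in> E" and h: "h = f \<or> h = g" for p h
  proof -
    have bij: "bij_betw h E E" using h assms(2,3) by blast
    have "(h p, p) \<in> orbit_rel h E"
      using equiv_symD[OF equiv_orbit_rel[OF assms(1) bij] orbit_rel_step[OF p]] .
    then have "h p \<in> E" "\<exists>n. p = (h ^^ n) (h p)" by (simp_all add: orbit_rel_def)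
    then obtain n where "h p \<in> E" "(h ^^ n) (h p) = p" by metis
    then show ?thesis using orb[of "h p" h n] h by simp
  qed
  show sub: "reach f g E \<subseteq> E \<times> E"
  proof
    fix z assume "z \<in> reach f g E"
    then obtain p q where z: "z = (p, q)" "p \<in> E"
      "(p, q) \<in> ({(p, f p) | p. p \<in> E} \<union> {(p, g p) | p. p \<in> E})\<^sup>*"
      by (auto simp: reach_def)
    from z(3) have "q \<in> E"
      by induction (use z(2) assms(2,3) in \<open>auto dest: bij_betwE\<close>)
    then show "z \<in> E \<times> E" using z by simp
  qed
  show "refl_on E (reach f g E)" using re sub by (auto simp: refl_on_def)
  show "trans (reach f g E)" using reach_trans by (intro transI)
  show "sym (reach f g E)"
  proof (intro symI)
    fix p q assume "(p, q) \<in> reach f g E"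
    then have p: "p \<in> E" "(p, q) \<in> ({(p, f p) | p. p \<in> E} \<union> {(p, g p) | p. p \<in> E})\<^sup>*"
      by (auto simp: reach_def)
    from p(2) show "(q, p) \<in> reach f g E"
    proof induction
      case base show ?case using re p(1) .
    next
      case (step y z)
      then have "(z, y) \<in> reach f g E" using bwd by auto
      then show ?case using step reach_trans by metis
    qed
  qed
qed

lemma orbit_eq_class:
  assumes "finite E" "bij_betw f E E" "x \<in> E" shows "orbit f x = orbit_rel f E `` {x}"
proof -
  obtain N where "0 < N" "(f ^^ N) x = x" using funpow_period[OF assms] by metis
  then have "\<exists>m>0. (f ^^ n) x = (f ^^ m) x" for n
    by (cases "n = 0") auto
  then show ?thesis
    using assms(3) unfolding orbit_altdef by (auto simp: orbit_rel_def)
qed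

section \<open>The permutations of the ends of a diagram\<close>

abbreviation turn :: "dpoint \<Rightarrow> dpoint" where "turn \<equiv> on_end (\<lambda>_. ccw)"

lemma UNIV_compass: "(UNIV :: compass set) = {North, West, South, East}"
  using compass.exhaust by blast

lemma ccw4 [simp]: "ccw (ccw (ccw (ccw d))) = d"
  by (cases d) auto

lemma smooth_involution [simp]: "smooth0 (smooth0 d) = d" "smooth1 (smooth1 d) = d"
  by (cases d; simp)+

lemma smooth_smooth [simp]: "smooth A (smooth A p) = p"
  by (cases p) (auto simp: smooth_def)

lemma bij_involution: "(\<And>p. p \<in> X \<Longrightarrow> a p \<in> X \<and> a (a p) = p) \<Longrightarrow> bij_betw a X X"
  by (rule bij_betw_byWitness[where f' = a]) auto

lemma turn4 [simp]: "turn (turn (turn (turn p))) = p"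
  by (cases p) auto

locale planar_diagram =
  fixes D :: link_diagram
  assumes diagram: "is_link_diagram D"
begin

lemma End_in_ends [simp]: "End i d \<in> ends D \<longleftrightarrow> i \<in> crossings D"
  by (auto simp: ends_def)

lemma Loop_notin_ends [simp]: "Loop j \<notin> ends D"
  by (auto simp: ends_def)

lemma endsE:
  assumes "p \<in> ends D" obtains i d where "p = End i d" "i \<in> crossings D"
  using assms by (auto simp: ends_def)

lemma ends_eq: "ends D = (\<lambda>(i, d). End i d) ` (crossings D \<times> UNIV)"
  by (auto simp: ends_def)

lemma finite_crossings [simp]: "finite (crossings D)"
  by (simp add: crossings_def)

lemma finite_ends [simp]: "finite (ends D)"
  unfolding ends_eq by (auto simp: UNIV_compass)

lemma card_ends: "card (ends D) = 4 * ncross D"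
proof -
  have "inj_on (\<lambda>(i, d). End i d) (crossings D \<times> UNIV)" by (auto simp: inj_on_def)
  then show ?thesis
    unfolding ends_eq by (simp add: card_image card_cartesian_product UNIV_compass crossings_def)
qed

lemma arc [simp]:
  assumes "p \<in> ends D" shows "arc D p \<in> ends D" "arc D p \<noteq> p" "arc D (arc D p) = p"
  using diagram assms by (auto simp: is_link_diagram_def)

lemma turn_in_ends [simp]: "turn p \<in> ends D \<longleftrightarrow> p \<in> ends D"
  by (cases p) auto

lemma smooth_in_ends [simp]: "smooth A p \<in> ends D \<longleftrightarrow> p \<in> ends D"
  by (cases p) (auto simp: smooth_def)

lemma bij_arc: "bij_betw (arc D) (ends D) (ends D)"
  by (rule bij_involution) auto

lemma bij_smooth: "bij_betw (smooth A) (ends D) (ends D)"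
  by (rule bij_involution) auto

lemma bij_turn: "bij_betw turn (ends D) (ends D)"
  by (rule bij_betw_byWitness[where f' = "\<lambda>p. turn (turn (turn p))"]) auto

lemma face_step_eq: "face_step D = turn \<circ> arc D"
  by (auto simp: face_step_def)

lemma bij_face_step: "bij_betw (face_step D) (ends D) (ends D)"
  unfolding face_step_eq using bij_arc bij_turn by (rule bij_betw_trans)

lemma faces_eq: "faces D = ends D // orbit_rel (face_step D) (ends D)"
  unfolding faces_def quotient_def using orbit_eq_class[OF finite_ends bij_face_step] by auto

lemma turn_class:
  assumes "i \<in> crossings D" shows "orbit_rel turn (ends D) `` {End i d} = range (End i)"
proof -
  have pow: "(turn ^^ n) (End i d) = End i ((ccw ^^ n) d)" for n by (induction n) auto
  have "\<exists>n. e = (ccw ^^ n) d" for e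
    by (rule exI[of _ "if e = d then 0 else if e = ccw d then 1 else if e = ccw (ccw d) then 2 else 3"])
       (cases d; cases e; simp add: numeral_eq_Suc)
  then show ?thesis using assms pow by (auto simp: orbit_rel_def)
qed

lemma card_turn_classes: "card (ends D // orbit_rel turn (ends D)) = ncross D"
proof -
  have "ends D // orbit_rel turn (ends D) = (\<lambda>i. range (End i)) ` crossings D"
  proof (intro equalityI subsetI)
    fix C assume "C \<in> ends D // orbit_rel turn (ends D)"
    then obtain p where p: "p \<in> ends D" "C = orbit_rel turn (ends D) `` {p}" by (rule quotientE)
    then show "C \<in> (\<lambda>i. range (End i)) ` crossings D"
      using turn_class by (elim endsE) auto
  next
    fix C assume "C \<in> (\<lambda>i. range (End i)) ` crossings D"
    then obtain i where "i \<in> crossings D" "C = range (End i)" by auto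
    then show "C \<in> ends D // orbit_rel turn (ends D)"
      using turn_class[of i North] quotientI[of "End i North" "ends D" "orbit_rel turn (ends D)"] by simp
  qed
  moreover have "inj_on (\<lambda>i. range (End i)) (crossings D)" by (auto simp: inj_on_def)
  ultimately show ?thesis by (simp add: card_image crossings_def)
qed

definition conn :: "dpoint rel" where "conn = reach (arc D) turn (ends D)"

lemma equiv_conn: "equiv (ends D) conn"
  unfolding conn_def by (rule equiv_reach[OF finite_ends bij_arc bij_turn])

lemma graph_components_eq: "graph_components D = ends D // conn"
  unfolding graph_components_def quotient_def conn_def reach_def by auto

text \<open>The weight \<open>w (turn p)\<close> sits on the corner between \<open>p\<close> and
  \<open>turn p\<close>. Each corner belongs to one crossing and one face, and the hypotheses say
  that the weights are closed around both; crossings are the vertices and arcs the edges in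
  \<open>genus_zero_exact\<close>.\<close>

lemma potential_exists:
  fixes w :: "dpoint \<Rightarrow> 'g :: ab_group_add"
  assumes vertex: "\<And>i. i \<in> crossings D \<Longrightarrow>
      w (End i North) + w (End i West) + w (End i South) + w (End i East) = 0"
    and face: "\<And>h. h \<in> ends D \<Longrightarrow> sum w (orbit_rel (face_step D) (ends D) `` {h}) = 0"
  shows "\<exists>H. (\<forall>p\<in>ends D. H (turn p) = H p + w (turn p)) \<and> (\<forall>p\<in>ends D. H (arc D p) = H p)"
proof -
  let ?E = "ends D"
  \<comment> \<open>Partial sums around a crossing, started at \<open>North\<close>; the vertex
    hypothesis closes them up at the turn from \<open>East\<close> back to
    \<open>North\<close>.\<close>
  define H0 where "H0 p = (case p of Loop j \<Rightarrow> 0 | End i d \<Rightarrow> (case d of North \<Rightarrow> 0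
      | West \<Rightarrow> w (End i West) | South \<Rightarrow> w (End i West) + w (End i South)
      | East \<Rightarrow> w (End i West) + w (End i South) + w (End i East)))" for p
  have H0: "H0 (turn p) = H0 p + w (turn p)" if "p \<in> ?E" for p
    using that
  proof (elim endsE)
    fix i d assume "p = End i d" "i \<in> crossings D"
    then show ?thesis using vertex[of i] by (cases d) (auto simp: H0_def algebra_simps)
  qed
  obtain L where L: "2 * length L = card ?E" "\<forall>(u, v)\<in>set L. u \<in> ?E \<and> v = arc D u"
    "\<forall>p\<in>?E. (p, arc D p) \<in> set L \<or> (arc D p, p) \<in> set L"
    "\<And>s p. glue s L p = s (if p \<in> ?E then arc D p else p)"
    using involution_glue[OF finite_ends, of "arc D"] by auto
  have Lsub: "set L \<subseteq> ?E \<times> ?E" and Lneq: "\<And>u v. (u, v) \<in> set L \<Longrightarrow> u \<noteq> v"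
    using L(2) arc by fastforce+
  have len: "length L = 2 * ncross D" using L(1) card_ends by simp
  have bij: "bij_betw (glue turn L) ?E ?E" by (rule bij_betw_glue[OF bij_turn Lsub])
  have orb: "orbit_rel (glue turn L) ?E = orbit_rel (face_step D) ?E"
    by (rule orbit_rel_cong[OF finite_ends bij]) (simp add: L(4) face_step_def)
  have eqg: "equiv ?E (glue_conn turn ?E L)" by (rule equiv_glue_conn[OF finite_ends bij_turn Lsub])
  have gc: "glue_conn turn ?E L = conn"
  proof
    have "orbit_rel turn ?E \<subseteq> conn"
      by (rule orbit_rel_least[OF equiv_conn]) (simp add: conn_def reach_step)
    moreover have "glue_conn turn ?E M \<subseteq> conn" if "set M \<subseteq> set L" "orbit_rel turn ?E \<subseteq> conn" for M
      using that
    proof (induction M)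
      case (Cons e M)
      obtain u v where e: "e = (u, v)" by force
      then have "u \<in> ?E" "v = arc D u" using L(2) Cons.prems by auto
      then have "(u, v) \<in> conn" by (simp add: conn_def reach_step)
      then show ?case using Cons e join_rel_least[OF equiv_conn] by simp
    qed simp
    ultimately show "glue_conn turn ?E L \<subseteq> conn" by blast
    have "(p, arc D p) \<in> glue_conn turn ?E L" if "p \<in> ?E" for p
      using L(3) that glue_conn_pair[OF finite_ends bij_turn Lsub] equiv_symD[OF eqg] by blast
    moreover have "(p, turn p) \<in> glue_conn turn ?E L" if "p \<in> ?E" for p
      using orbit_subset_glue_conn orbit_rel_step[OF that] by blast
    ultimately show "conn \<subseteq> glue_conn turn ?E L"
      unfolding conn_def by (intro reach_least[OF eqg])
  qed
  have planar: "card (faces D) = ncross D + 2 * card (graph_components D)"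
    using diagram by (simp add: is_link_diagram_def)
  \<comment> \<open>With \<open>n\<close> vertices and \<open>2 n\<close> edges, the planarity
    condition is the equality case of the count.\<close>
  obtain H where H: "\<forall>p\<in>?E. H (turn p) = H p + w (turn p)" "\<forall>(u, v)\<in>set L. H u = H v"
    using genus_zero_exact[OF finite_ends bij_turn, of H0 w L] H0 Lsub Lneq face planar
    by (simp add: orb gc card_turn_classes len faces_eq graph_components_eq) blast
  have "H (arc D p) = H p" if "p \<in> ?E" for p
    using L(3) H(2) that by fastforce
  then show ?thesis using H(1) by blast
qed

lemma outward [simp]:
  assumes "p \<in> ends D"
  shows "outward D (arc D p) \<longleftrightarrow> \<not> outward D p" "outward D (turn (turn p)) \<longleftrightarrow> \<not> outward D p"
proof -
  have "opposite p = turn (turn p)" by (cases p) (auto simp: opposite_def)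
  moreover have "outward D (arc D p) \<noteq> outward D p" "outward D (opposite p) \<noteq> outward D p"
    using diagram assms unfolding is_link_diagram_def by blast+
  ultimately show "outward D (arc D p) \<longleftrightarrow> \<not> outward D p"
    "outward D (turn (turn p)) \<longleftrightarrow> \<not> outward D p" by auto
qed

text \<open>\<open>H\<close> is to be the colour on the left of an arc followed in the direction of
  the link, and adding \<open>ow\<close> converts it to the direction into the crossing. Since the
  colour flips at each turn, the increment of \<open>H\<close> is forced to be
  \<open>1 + ow p + ow (turn p)\<close>, which is \<open>w (turn p)\<close>.\<close>

lemma colouring_exists:
  "\<exists>c. \<forall>p\<in>ends D. c (arc D p) = (\<not> c p) \<and> c (turn p) = (\<not> c p)"
proof -
  define ow :: "dpoint \<Rightarrow> bit" where "ow p = of_bool (outward D p)" for p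
  define w where "w p = ow p + ow (turn p)" for p
  have o2: "ow (turn (turn p)) = 1 + ow p" if "p \<in> ends D" for p
    using that by (simp add: ow_def)
  have "\<exists>H. (\<forall>p\<in>ends D. H (turn p) = H p + w (turn p)) \<and> (\<forall>p\<in>ends D. H (arc D p) = H p)"
  proof (rule potential_exists)
    fix i assume i: "i \<in> crossings D"
    have "ow (End i South) = 1 + ow (End i North)" "ow (End i East) = 1 + ow (End i West)"
      using o2[of "End i North"] o2[of "End i West"] i by auto
    then show "w (End i North) + w (End i West) + w (End i South) + w (End i East) = 0"
      by (cases "ow (End i North)"; cases "ow (End i West)") (simp_all add: w_def)
  next
    fix h assume h: "h \<in> ends D"
    let ?C = "orbit_rel (face_step D) (ends D) `` {h}"
    show "sum w ?C = 0"
    proof (rule sum_telescope_bij)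
      show "bij_betw (face_step D) ?C ?C"
        by (rule bij_betw_class[OF finite_ends bij_face_step
              equiv_orbit_rel[OF finite_ends bij_face_step] subset_refl h])
    next
      fix p assume "p \<in> ?C"
      then have p: "p \<in> ends D"
        using equiv_orbit_rel[OF finite_ends bij_face_step] by (auto simp: equiv_def)
      \<comment> \<open>The arc and the half turn that follows it each flip the orientation, so the
        weights telescope around a face.\<close>
      have "ow (turn (face_step D p)) = ow p"
        using p by (simp add: face_step_def ow_def)
      then show "w (face_step D p) = ow (face_step D p) - ow p"
        unfolding w_def by (cases "ow p"; cases "ow (face_step D p)") simp_all
    qed
  qed
  then obtain H where H: "\<And>p. p \<in> ends D \<Longrightarrow> H (turn p) = H p + w (turn p)"
    "\<And>p. p \<in> ends D \<Longrightarrow> H (arc D p) = H p" by blast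
  have 1: "H (turn p) + ow (turn p) = 1 + (H p + ow p)" if "p \<in> ends D" for p
    using H(1)[OF that] o2[OF that]
    by (cases "H p"; cases "ow p"; cases "ow (turn p)") (simp_all add: w_def)
  have 2: "H (arc D p) + ow (arc D p) = 1 + (H p + ow p)" if "p \<in> ends D" for p
    using H(2)[OF that] that by (simp add: ow_def)
  have b: "1 + x = 1 \<longleftrightarrow> x \<noteq> 1" for x :: bit by (cases x) auto
  show ?thesis
  proof (intro exI[of _ "\<lambda>p. H p + ow p = 1"] ballI)
    fix p assume "p \<in> ends D"
    then show "(H (arc D p) + ow (arc D p) = 1) = (H p + ow p \<noteq> 1) \<and>
        (H (turn p) + ow (turn p) = 1) = (H p + ow p \<noteq> 1)"
      by (simp only: 1 2 b)
  qed
qed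

text \<open>
  The colour of the region on the left of a strand that enters a crossing at a given end.
\<close>

definition col :: "dpoint \<Rightarrow> bool" where
  "col = (SOME c. \<forall>p\<in>ends D. c (arc D p) = (\<not> c p) \<and> c (turn p) = (\<not> c p))"

lemma col_arc [simp]: "p \<in> ends D \<Longrightarrow> col (arc D p) \<longleftrightarrow> \<not> col p"
  and col_turn [simp]: "p \<in> ends D \<Longrightarrow> col (turn p) \<longleftrightarrow> \<not> col p"
  using someI_ex[OF colouring_exists, folded col_def] by auto

lemma col_End [simp]:
  assumes "i \<in> crossings D"
  shows "col (End i North) \<longleftrightarrow> \<not> col (End i West)" "col (End i South) \<longleftrightarrow> \<not> col (End i West)"
    "col (End i East) \<longleftrightarrow> col (End i West)"
  using col_turn[of "End i North"] col_turn[of "End i West"] col_turn[of "End i South"] assms by auto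

text \<open>A smoothing joins adjacent ends. Its flip cancels the flip along an arc, so
  \<open>traverse\<close> keeps the colour on its left.\<close>

lemma col_smooth [simp]: "p \<in> ends D \<Longrightarrow> col (smooth A p) \<longleftrightarrow> \<not> col p"
  by (elim endsE; rename_tac i d; case_tac d) (auto simp: smooth_def)

end

section \<open>Circles of a resolution\<close>

context planar_diagram
begin

text \<open>Each arc has exactly one black end. On these ends \<open>traverse\<close> runs through
  every circle once, with black on the left; on all ends it would run through each circle in both
  directions.\<close>

definition black_ends :: "dpoint set" where "black_ends = {p \<in> ends D. col p}"

definition black_end :: "dpoint \<Rightarrow> dpoint" where
  "black_end p = (if col p then p else arc D p)"

definition circle_rel :: "nat set \<Rightarrow> dpoint rel" where
  "circle_rel A = orbit_rel (traverse D A) black_ends"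

lemma finite_black_ends [simp]: "finite black_ends"
  by (simp add: black_ends_def)

lemma black_end_in [simp]: "p \<in> ends D \<Longrightarrow> black_end p \<in> black_ends"
  by (simp add: black_ends_def black_end_def)

lemma black_end_id [simp]: "p \<in> black_ends \<Longrightarrow> black_end p = p"
  by (simp add: black_ends_def black_end_def)

lemma black_ends_sub: "p \<in> black_ends \<Longrightarrow> p \<in> ends D"
  by (simp add: black_ends_def)

lemma bij_traverse_ends: "bij_betw (traverse D A) (ends D) (ends D)"
proof -
  have "traverse D A = arc D \<circ> smooth A" by (simp add: traverse_def fun_eq_iff)
  then show ?thesis using bij_betw_trans[OF bij_smooth bij_arc] by simp
qed

lemma bij_traverse: "bij_betw (traverse D A) black_ends black_ends"
proof -
  have "traverse D A ` black_ends \<subseteq> black_ends"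
    by (auto simp: black_ends_def traverse_def)
  moreover have "inj_on (traverse D A) black_ends"
    using bij_traverse_ends[of A] unfolding bij_betw_def black_ends_def
    by (auto intro: inj_on_subset)
  ultimately show ?thesis by (simp add: bij_betw_def endo_inj_surj)
qed

lemma equiv_circle_rel: "equiv black_ends (circle_rel A)"
  unfolding circle_rel_def by (rule equiv_orbit_rel[OF finite_black_ends bij_traverse])

definition same_circle :: "nat set \<Rightarrow> dpoint rel" where
  "same_circle A = reach (arc D) (smooth A) (ends D)"

lemma equiv_same_circle: "equiv (ends D) (same_circle A)"
  unfolding same_circle_def by (rule equiv_reach[OF finite_ends bij_arc bij_smooth])

lemma circle_at_eq: "p \<in> ends D \<Longrightarrow> circle_at D A p = same_circle A `` {p}"
  by (auto simp: circle_at_def same_circle_def reach_def)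

lemma circle_at_Loop [simp]: "circle_at D A (Loop j) = {Loop j}"
proof -
  have "k = Loop j" if "(Loop j, k) \<in> ({(p, arc D p) | p. p \<in> ends D} \<union> {(p, smooth A p) | p. p \<in> ends D})\<^sup>*" for k
    using that by (induction rule: rtrancl_induct) auto
  then show ?thesis by (auto simp: circle_at_def)
qed

lemma circle_at_eq_iff:
  "p \<in> ends D \<Longrightarrow> q \<in> ends D \<Longrightarrow> circle_at D A p = circle_at D A q \<longleftrightarrow> (p, q) \<in> same_circle A"
  by (simp add: circle_at_eq eq_equiv_class_iff[OF equiv_same_circle])

lemma circle_at_arc [simp]: "p \<in> ends D \<Longrightarrow> circle_at D A (arc D p) = circle_at D A p"
  using circle_at_eq_iff[of p "arc D p" A] reach_step(1)[of p "ends D" "arc D" "smooth A"]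
  by (simp add: same_circle_def)

lemma circle_at_smooth [simp]: "p \<in> ends D \<Longrightarrow> circle_at D A (smooth A p) = circle_at D A p"
  using circle_at_eq_iff[of p "smooth A p" A] reach_step(2)[of p "ends D" "smooth A" "arc D"]
  by (simp add: same_circle_def)

lemma circle_at_black_end [simp]: "p \<in> ends D \<Longrightarrow> circle_at D A (black_end p) = circle_at D A p"
  by (simp add: black_end_def)

text \<open>One direction follows the steps of \<open>traverse\<close>. For the other,
  \<open>circle_rel\<close> is pulled back along \<open>black_end\<close>; at an end that is not
  black, the smoothing is a traversal step read backwards.\<close>

lemma circle_at_eq_iff_rel:
  assumes "p \<in> ends D" "q \<in> ends D"
  shows "circle_at D A p = circle_at D A q \<longleftrightarrow> (black_end p, black_end q) \<in> circle_rel A"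
proof
  assume "(black_end p, black_end q) \<in> circle_rel A"
  then have "(black_end p, black_end q) \<in> orbit_rel (traverse D A) (ends D)"
    using assms black_ends_sub by (auto simp: circle_rel_def orbit_rel_def)
  also have "\<dots> \<subseteq> same_circle A"
  proof (rule orbit_rel_least[OF equiv_same_circle])
    fix x assume "x \<in> ends D"
    then show "(x, traverse D A x) \<in> same_circle A"
      by (simp flip: circle_at_eq_iff add: traverse_def)
  qed
  finally have "circle_at D A (black_end p) = circle_at D A (black_end q)"
    using assms black_ends_sub black_end_in by (simp add: circle_at_eq_iff del: circle_at_black_end)
  then show "circle_at D A p = circle_at D A q" using assms by simp
next
  let ?R = "{(p, q). p \<in> ends D \<and> q \<in> ends D \<and> (black_end p, black_end q) \<in> circle_rel A}"
  have eq: "equiv (ends D) ?R"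
  proof (intro equivI)
    show "?R \<subseteq> ends D \<times> ends D" by auto
    show "refl_on (ends D) ?R"
      using equiv_circle_rel by (auto simp: refl_on_def equiv_def)
    show "sym ?R" using equiv_symD[OF equiv_circle_rel] by (auto simp: sym_def)
    show "trans ?R" unfolding trans_def using equiv_transD[OF equiv_circle_rel] by blast
  qed
  have refl: "(b, b) \<in> circle_rel A" if "b \<in> black_ends" for b
    using equiv_circle_rel that by (auto simp: refl_on_def equiv_def)
  have step: "(b, traverse D A b) \<in> circle_rel A" if "b \<in> black_ends" for b
    unfolding circle_rel_def using that by (rule orbit_rel_step)
  have "same_circle A \<subseteq> ?R"
    unfolding same_circle_def
  proof (rule reach_least[OF eq])
    fix p assume p: "p \<in> ends D"
    have "black_end (arc D p) = black_end p" using p by (simp add: black_end_def)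
    then show "(p, arc D p) \<in> ?R" using p refl by simp
    show "(p, smooth A p) \<in> ?R"
    proof (cases "col p")
      case True
      then have "p \<in> black_ends" "black_end (smooth A p) = traverse D A p"
        using p by (simp_all add: black_end_def black_ends_def traverse_def)
      then show ?thesis using p step by simp
    next
      case False
      then have "smooth A p \<in> black_ends" "black_end p = traverse D A (smooth A p)"
        using p by (simp_all add: black_end_def black_ends_def traverse_def)
      then show ?thesis using p step equiv_symD[OF equiv_circle_rel] by fastforce
    qed
  qed
  moreover assume "circle_at D A p = circle_at D A q"
  ultimately show "(black_end p, black_end q) \<in> circle_rel A"
    using assms by (auto simp: circle_at_eq_iff)
qed

lemma circle_at_eq_set:
  assumes "p \<in> ends D"
  shows "circle_at D A p = {k \<in> ends D. black_end k \<in> circle_rel A `` {black_end p}}"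
proof -
  have "same_circle A \<subseteq> ends D \<times> ends D" using equiv_same_circle by (simp add: equiv_def)
  then have "circle_at D A p = {k \<in> ends D. (p, k) \<in> same_circle A}"
    using assms by (auto simp: circle_at_eq)
  then show ?thesis
    using assms circle_at_eq_iff circle_at_eq_iff_rel by auto
qed

lemma circle_at_self: "p \<in> ends D \<Longrightarrow> p \<in> circle_at D A p"
  using equiv_class_self[OF equiv_same_circle] by (simp add: circle_at_eq)

text \<open>Translates a join of cycles to circles as point sets, loops included. The two
  resolutions are arbitrary because a merge reads the join forwards and a split backwards.\<close>

lemma circle_at_join:
  assumes join: "circle_rel A' = join_rel (circle_rel A) u v"
    and uv: "u \<in> black_ends" "v \<in> black_ends" and p: "p \<in> points D"
  shows "circle_at D A' p = (if circle_at D A p = circle_at D A u \<or> circle_at D A p = circle_at D A v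
    then circle_at D A' u else circle_at D A p)"
proof (cases "p \<in> ends D")
  case True
  have uv': "u \<in> ends D" "v \<in> ends D" using uv black_ends_sub by auto
  have bp: "black_end p \<in> black_ends" using True by simp
  have uR: "(u, u) \<in> circle_rel A" using equiv_circle_rel uv(1) by (auto simp: equiv_def refl_on_def)
  have "circle_at D A p = circle_at D A u \<longleftrightarrow> (black_end p, u) \<in> circle_rel A"
    "circle_at D A p = circle_at D A v \<longleftrightarrow> (black_end p, v) \<in> circle_rel A"
    using circle_at_eq_iff_rel[OF True uv'(1)] circle_at_eq_iff_rel[OF True uv'(2)] uv by auto
  then show ?thesis
    using join_rel_class[OF equiv_circle_rel[of A] uv bp] join_rel_class[OF equiv_circle_rel[of A] uv uv(1)] uR uv(1)
    unfolding circle_at_eq_set[OF True] circle_at_eq_set[OF uv'(1)] join[symmetric] by simp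
next
  case False
  then obtain j where j: "p = Loop j" using p by (auto simp: points_def)
  have "u \<in> circle_at D A u" "v \<in> circle_at D A v" using uv black_ends_sub circle_at_self by auto
  moreover have "u \<noteq> Loop j" "v \<noteq> Loop j" using uv black_ends_sub Loop_notin_ends by metis+
  ultimately show ?thesis unfolding j by auto
qed

text \<open>The surgery arc of crossing \<open>i\<close> lies in a black region.\<close>

definition black :: "nat \<Rightarrow> bool" where "black i = col (End i West)"

text \<open>
  The two black ends at a crossing, named after the strands of the 1-resolution that contain them.
\<close>

definition nw_end :: "nat \<Rightarrow> dpoint" where
  "nw_end i = End i (if black i then West else North)"

definition se_end :: "nat \<Rightarrow> dpoint" where
  "se_end i = End i (if black i then East else South)"

section \<open>Surgery at one crossing\<close>

lemma nw_se_black [simp]: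
  assumes "i \<in> crossings D" shows "nw_end i \<in> black_ends" "se_end i \<in> black_ends"
  using assms by (auto simp: nw_end_def se_end_def black_def black_ends_def)

lemma nw_neq_se [simp]: "nw_end i \<noteq> se_end i"
  by (simp add: nw_end_def se_end_def)

text \<open>The two smoothings pair the two black entrances of the crossing with the same two exits,
  but in exchanged order.\<close>

lemma traverse_insert:
  assumes "i \<in> crossings D" "i \<notin> A" "p \<in> black_ends"
  shows "traverse D (insert i A) p = (traverse D A \<circ> transpose (nw_end i) (se_end i)) p"
proof (cases "\<exists>d. p = End i d")
  case True
  then obtain d where d: "p = End i d" by blast
  have "col (End i d)" using assms(3) d by (simp add: black_ends_def)
  then show ?thesis
    using assms(1,2) unfolding d
    by (cases d; cases "black i")
       (auto simp: traverse_def smooth_def nw_end_def se_end_def transpose_def black_def)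
next
  case False
  then have "p \<noteq> nw_end i" "p \<noteq> se_end i" by (auto simp: nw_end_def se_end_def)
  moreover have "smooth (insert i A) p = smooth A p"
    using False by (cases p) (auto simp: smooth_def)
  ultimately show ?thesis by (simp add: traverse_def)
qed

lemma circle_rel_insert:
  assumes "i \<in> crossings D" "i \<notin> A"
  shows "circle_rel (insert i A)
    = orbit_rel (traverse D A \<circ> transpose (nw_end i) (se_end i)) black_ends"
  unfolding circle_rel_def using traverse_insert[OF assms]
  by (intro orbit_rel_cong[OF finite_black_ends bij_traverse]) auto

definition merges :: "nat set \<Rightarrow> nat \<Rightarrow> bool" where
  "merges A i \<longleftrightarrow> circle_at D A (End i South) \<noteq> circle_at D A (End i North)"

lemma circle_at_ends0:
  assumes "i \<in> crossings D" "i \<notin> A"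
  shows "circle_at D A (End i West) = circle_at D A (End i South)"
    "circle_at D A (End i East) = circle_at D A (End i North)"
  using circle_at_smooth[of "End i South" A] circle_at_smooth[of "End i North" A] assms
  by (simp_all add: smooth_def)

lemma circle_at_ends1:
  assumes "i \<in> crossings D" "i \<in> A"
  shows "circle_at D A (End i North) = circle_at D A (End i West)"
    "circle_at D A (End i South) = circle_at D A (End i East)"
  using circle_at_smooth[of "End i West" A] circle_at_smooth[of "End i East" A] assms
  by (simp_all add: smooth_def)

lemma circle_at_nw_se0:
  assumes "i \<in> crossings D" "i \<notin> A"
  shows "circle_at D A (nw_end i) = circle_at D A (End i (if black i then South else North))"
    "circle_at D A (se_end i) = circle_at D A (End i (if black i then North else South))"
  using circle_at_ends0[OF assms] by (auto simp: nw_end_def se_end_def)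

lemma circle_at_nw_se1:
  assumes "i \<in> crossings D" "i \<in> A"
  shows "circle_at D A (nw_end i) = circle_at D A (End i West)"
    "circle_at D A (se_end i) = circle_at D A (End i East)"
  using circle_at_ends1[OF assms] by (auto simp: nw_end_def se_end_def)

lemma merges_iff:
  assumes "i \<in> crossings D" "i \<notin> A"
  shows "merges A i \<longleftrightarrow> (nw_end i, se_end i) \<notin> circle_rel A"
proof -
  have "circle_at D A (nw_end i) = circle_at D A (se_end i) \<longleftrightarrow> (nw_end i, se_end i) \<in> circle_rel A"
    using assms(1) circle_at_eq_iff_rel[of "nw_end i" "se_end i" A] nw_se_black[of i] black_ends_sub by simp
  then show ?thesis using circle_at_nw_se0[OF assms]
    by (cases "black i") (simp_all add: merges_def eq_commute)
qed

lemma circle_rel_merge: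
  assumes "i \<in> crossings D" "i \<notin> A" "merges A i"
  shows "circle_rel (insert i A) = join_rel (circle_rel A) (nw_end i) (se_end i)"
proof -
  have "(nw_end i, se_end i) \<notin> orbit_rel (traverse D A) black_ends"
    using assms(3) by (simp add: merges_iff[OF assms(1,2)] circle_rel_def)
  then show ?thesis
    unfolding circle_rel_insert[OF assms(1,2)] unfolding circle_rel_def
    by (rule orbit_rel_merge[OF finite_black_ends bij_traverse nw_se_black[OF assms(1)]])
qed

lemma circle_rel_split:
  assumes "i \<in> crossings D" "i \<notin> A" "\<not> merges A i"
  shows "circle_rel A = join_rel (circle_rel (insert i A)) (nw_end i) (se_end i)"
    "(nw_end i, se_end i) \<notin> circle_rel (insert i A)"
proof -
  have "(nw_end i, se_end i) \<in> orbit_rel (traverse D A) black_ends"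
    using assms(3) by (simp add: merges_iff[OF assms(1,2)] circle_rel_def)
  note * = finite_black_ends bij_traverse this nw_neq_se
  show "circle_rel A = join_rel (circle_rel (insert i A)) (nw_end i) (se_end i)"
    "(nw_end i, se_end i) \<notin> circle_rel (insert i A)"
    using orbit_rel_split[OF *] orbit_rel_cut[OF *]
    unfolding circle_rel_insert[OF assms(1,2)] unfolding circle_rel_def .
qed

lemma circle_at_merge:
  assumes "i \<in> crossings D" "i \<notin> A" "merges A i" "p \<in> points D"
  shows "circle_at D (insert i A) p =
    (if circle_at D A p = circle_at D A (End i South) \<or> circle_at D A p = circle_at D A (End i North)
     then circle_at D (insert i A) (End i West) else circle_at D A p)"
  using circle_at_join[OF circle_rel_merge[OF assms(1-3)] nw_se_black[OF assms(1)] assms(4)]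
    circle_at_nw_se0[OF assms(1,2)] circle_at_nw_se1[OF assms(1), of "insert i A"]
  by (cases "black i") (simp_all add: disj_commute)

lemma circle_at_split:
  assumes "i \<in> crossings D" "i \<notin> A" "\<not> merges A i" "p \<in> points D"
  shows "circle_at D A p =
    (if circle_at D (insert i A) p = circle_at D (insert i A) (End i West)
      \<or> circle_at D (insert i A) p = circle_at D (insert i A) (End i East)
     then circle_at D A (End i South) else circle_at D (insert i A) p)"
  using circle_at_join[OF circle_rel_split(1)[OF assms(1-3)] nw_se_black[OF assms(1)] assms(4)]
    circle_at_nw_se0[OF assms(1,2)] circle_at_nw_se1[OF assms(1), of "insert i A"] assms(3)
  by (cases "black i") (simp_all add: merges_def)

lemma split_circles_neq:
  assumes "i \<in> crossings D" "i \<notin> A" "\<not> merges A i"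
  shows "circle_at D (insert i A) (End i West) \<noteq> circle_at D (insert i A) (End i East)"
proof -
  have "circle_at D (insert i A) (nw_end i) \<noteq> circle_at D (insert i A) (se_end i)"
    using circle_at_eq_iff_rel[of "nw_end i" "se_end i"] nw_se_black[OF assms(1)] black_ends_sub
      circle_rel_split(2)[OF assms] by simp
  then show ?thesis using circle_at_nw_se1[OF assms(1), of "insert i A"] by simp
qed

lemma card_circle_rel:
  assumes "i \<in> crossings D" "i \<notin> A"
  shows "int (card (black_ends // circle_rel (insert i A)))
    = int (card (black_ends // circle_rel A)) + (if merges A i then -1 else 1)"
proof (cases "merges A i")
  case True
  then show ?thesis
    using card_join_rel[OF finite_black_ends equiv_circle_rel nw_se_black[OF assms(1)]]
      circle_rel_merge[OF assms True] merges_iff[OF assms] by fastforce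
next
  case False
  then show ?thesis
    using card_join_rel[OF finite_black_ends equiv_circle_rel nw_se_black[OF assms(1)]]
      circle_rel_split[OF assms False] by fastforce
qed

end

section \<open>Homomorphisms of exterior algebras\<close>

definition ext_degree_one :: "'c exterior set" where
  "ext_degree_one = abs_exterior ` degree_one"

lemma abs_exterior_simps:
  "abs_exterior (x + y) = abs_exterior x + abs_exterior y"
  "abs_exterior (x - y) = abs_exterior x - abs_exterior y"
  "abs_exterior (x * y) = abs_exterior x * abs_exterior y"
  "abs_exterior 0 = 0" "abs_exterior 1 = 1"
  by (simp_all add: plus_exterior.abs_eq minus_exterior.abs_eq times_exterior.abs_eq
      zero_exterior_def one_exterior_def)

lemma abs_exterior_eq_iff: "abs_exterior x = abs_exterior y \<longleftrightarrow> x - y \<in> ext_ideal"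
  by (rule exterior.abs_eq_iff)

lemma abs_exterior_surj: "\<exists>t. x = abs_exterior t"
  by (metis Quotient3_abs_rep Quotient3_exterior)

lemma ext_degree_one_diff:
  assumes "x \<in> ext_degree_one" "y \<in> ext_degree_one" shows "x - y \<in> ext_degree_one"
proof -
  obtain u v where uv: "u \<in> degree_one" "v \<in> degree_one" "x = abs_exterior u" "y = abs_exterior v"
    using assms by (auto simp: ext_degree_one_def)
  then have "u - v \<in> degree_one" using keys_diff[of u v] by (auto simp: degree_one_def)
  then show ?thesis using uv by (auto simp: ext_degree_one_def simp flip: abs_exterior_simps)
qed

lemma ext_degree_one_0 [simp]: "0 \<in> ext_degree_one"
  unfolding ext_degree_one_def abs_exterior_simps(4)[symmetric] by (auto simp: degree_one_def)

lemma ext_degree_one_uminus: "x \<in> ext_degree_one \<Longrightarrow> - x \<in> ext_degree_one"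
  using ext_degree_one_diff[OF ext_degree_one_0] by fastforce

lemma ext_degree_one_add: "x \<in> ext_degree_one \<Longrightarrow> y \<in> ext_degree_one \<Longrightarrow> x + y \<in> ext_degree_one"
  using ext_degree_one_diff[OF _ ext_degree_one_uminus] by fastforce

lemma gen_degree_one [simp]: "gen c \<in> ext_degree_one"
  unfolding gen_def ext_degree_one_def by (auto simp: degree_one_def)

lemma ext_degree_one_square: "x \<in> ext_degree_one \<Longrightarrow> x * x = 0"
  using ext_ideal.square[of _ 1 1]
  by (auto simp: ext_degree_one_def abs_exterior_eq_iff simp flip: abs_exterior_simps(3,4))

lemma ext_degree_one_anticommute:
  assumes "x \<in> ext_degree_one" "y \<in> ext_degree_one" shows "x * y = - (y * x)"
proof -
  have "(x + y) * (x + y) = 0" using assms ext_degree_one_square ext_degree_one_add by blast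
  then have "x * y + y * x = 0"
    using assms ext_degree_one_square[of x] ext_degree_one_square[of y] by (simp add: distrib_left distrib_right add.commute)
  then show ?thesis by (simp add: eq_neg_iff_add_eq_0)
qed

text \<open>The ring homomorphism on the free ring that extends \<open>f\<close>. Unlike
  \<open>tensor_map\<close>, it can send a generator to a combination of generators, as the vertex
  maps must.\<close>

definition tensor_lift :: "('c \<Rightarrow> 'r :: ring_1) \<Rightarrow> 'c tensor \<Rightarrow> 'r" where
  "tensor_lift f x = (\<Sum>w\<in>Poly_Mapping.keys x. of_int (Poly_Mapping.lookup x w) * prod_list (map f (letters w)))"

lemma tensor_lift_superset:
  assumes "finite S" "Poly_Mapping.keys x \<subseteq> S"
  shows "tensor_lift f x = (\<Sum>w\<in>S. of_int (Poly_Mapping.lookup x w) * prod_list (map f (letters w)))"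
  unfolding tensor_lift_def using assms by (intro sum.mono_neutral_left) (auto simp: in_keys_iff)

lemma tensor_lift_diff: "tensor_lift f (x - y) = tensor_lift f x - tensor_lift f y"
proof -
  let ?S = "Poly_Mapping.keys x \<union> Poly_Mapping.keys y"
  have "Poly_Mapping.keys (x - y) \<subseteq> ?S" using keys_diff[of x y] .
  then show ?thesis
    using tensor_lift_superset[of ?S x f] tensor_lift_superset[of ?S y f] tensor_lift_superset[of ?S "x - y" f]
    by (simp add: lookup_minus left_diff_distrib sum_subtractf)
qed

lemma tensor_lift_of: "tensor_lift f (frag_of w) = prod_list (map f (letters w))"
  by (simp add: tensor_lift_def)

lemma tensor_lift_mult: "tensor_lift f (x * y) = tensor_lift f x * tensor_lift f y"
proof (induction x rule: tensor_induct)
  case (of_word w)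
  show ?case
    by (induction y rule: tensor_induct)
       (simp_all add: tensor_lift_diff right_diff_distrib frag_of_mult tensor_lift_of plus_tensor_word_def)
qed (simp add: tensor_lift_diff left_diff_distrib)

lemma tensor_lift_degree_one:
  fixes f :: "'c \<Rightarrow> 'd exterior"
  assumes "\<And>c. f c \<in> ext_degree_one" "v \<in> degree_one" shows "tensor_lift f v \<in> ext_degree_one"
proof -
  have "tensor_lift f x \<in> ext_degree_one" if "Poly_Mapping.keys x \<subseteq> {w. length (letters w) = 1}" for x
    using that
  proof (induction x rule: frag_induction)
    case (one w)
    then obtain c where "letters w = [c]" by (auto simp: length_Suc_conv)
    then show ?case using assms(1) by (simp add: tensor_lift_of)
  qed (simp_all add: tensor_lift_diff ext_degree_one_diff, simp add: tensor_lift_def)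
  then show ?thesis using assms(2) by (auto simp: degree_one_def)
qed

lemma tensor_lift_ideal:
  fixes f :: "'c \<Rightarrow> 'd exterior"
  assumes "\<And>c. f c \<in> ext_degree_one" "x \<in> ext_ideal" shows "tensor_lift f x = 0"
  using assms(2)
proof (induction rule: ext_ideal.induct)
  case (square v a b)
  have "tensor_lift f v * tensor_lift f v = 0"
    by (rule ext_degree_one_square[OF tensor_lift_degree_one[of f, OF assms(1) square]])
  then show ?case by (simp add: tensor_lift_mult)
qed (simp_all add: tensor_lift_diff, simp add: tensor_lift_def)

text \<open>The value is independent of the representative once every \<open>f c\<close> has degree
  one, hence the assumption of the next context.\<close>

definition ext_lift :: "('c \<Rightarrow> 'd exterior) \<Rightarrow> 'c exterior \<Rightarrow> 'd exterior" where
  "ext_lift f x = tensor_lift f (rep_exterior x)"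

context
  fixes f :: "'c \<Rightarrow> 'd exterior"
  assumes f: "\<And>c. f c \<in> ext_degree_one"
begin

lemma ext_lift_abs: "ext_lift f (abs_exterior t) = tensor_lift f t"
proof -
  have "rep_exterior (abs_exterior t) - t \<in> ext_ideal"
    using Quotient3_abs_rep[OF Quotient3_exterior, of "abs_exterior t"] abs_exterior_eq_iff by blast
  from tensor_lift_ideal[OF f this] show ?thesis by (simp add: ext_lift_def tensor_lift_diff)
qed

lemma ext_lift_diff: "ext_lift f (x - y) = ext_lift f x - ext_lift f y"
  using abs_exterior_surj[of x] abs_exterior_surj[of y]
  by (auto simp: ext_lift_abs tensor_lift_diff simp flip: abs_exterior_simps)

lemma ext_lift_mult: "ext_lift f (x * y) = ext_lift f x * ext_lift f y"
  using abs_exterior_surj[of x] abs_exterior_surj[of y]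
  by (auto simp: ext_lift_abs tensor_lift_mult simp flip: abs_exterior_simps)

lemma ext_lift_0: "ext_lift f 0 = 0"
  using ext_lift_diff[of 0 0] by simp

lemma ext_lift_uminus: "ext_lift f (- x) = - ext_lift f x"
  using ext_lift_diff[of 0 x] by (simp add: ext_lift_0)

lemma ext_lift_add: "ext_lift f (x + y) = ext_lift f x + ext_lift f y"
  using ext_lift_diff[of x "- y"] by (simp add: ext_lift_uminus)

lemma ext_lift_1: "ext_lift f 1 = 1"
proof -
  have one: "(1 :: 'c tensor) = frag_of (Word [])" by (simp add: single_one flip: zero_tensor_word_def)
  have "tensor_lift f 1 = 1" unfolding one tensor_lift_of by simp
  then show ?thesis using ext_lift_abs[of 1] by (simp add: abs_exterior_simps)
qed

lemma ext_lift_gen: "ext_lift f (gen c) = f c"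
  unfolding gen_def by (simp add: ext_lift_abs tensor_lift_of)

end

lemma exterior_map_eq_lift: "exterior_map f = ext_lift (\<lambda>c. gen (f c))"
proof
  fix x :: "'a exterior"
  obtain t where t: "x = abs_exterior t" using abs_exterior_surj by blast
  have word: "abs_exterior (frag_of (Word l)) = prod_list (map gen l)" for l :: "'b list"
  proof (induction l)
    case Nil
    then show ?case
      by (simp add: single_one abs_exterior_simps flip: zero_tensor_word_def)
  next
    case (Cons c l)
    have "frag_of (Word (c # l)) = frag_of (Word [c]) * (frag_of (Word l) :: 'b tensor)"
      by (simp only: frag_of_mult plus_tensor_word_def) simp
    then show ?case using Cons by (simp add: abs_exterior_simps gen_def)
  qed
  have "abs_exterior (tensor_map f t) = tensor_lift (\<lambda>c. gen (f c)) t"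
  proof (induction t rule: tensor_induct)
    case (of_word w)
    then show ?case by (simp add: tensor_map_def tensor_lift_of word comp_def)
  qed (simp add: tensor_map_diff tensor_lift_diff abs_exterior_simps)
  then show "exterior_map f x = ext_lift (\<lambda>c. gen (f c)) x"
    using t by (simp add: ext_lift_abs exterior_map.abs_eq)
qed

lemma exterior_map_simps:
  "exterior_map f (x - y) = exterior_map f x - exterior_map f y"
  "exterior_map f (x * y) = exterior_map f x * exterior_map f y"
  "exterior_map f 0 = 0" "exterior_map f 1 = 1" "exterior_map f (gen c) = gen (f c)"
  "exterior_map f (x + y) = exterior_map f x + exterior_map f y"
  by (simp_all add: exterior_map_eq_lift ext_lift_diff ext_lift_mult ext_lift_0 ext_lift_1 ext_lift_gen
      ext_lift_add)

section \<open>Subalgebras spanned by sets of generators\<close>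

lemma exterior_on_1 [simp]: "1 \<in> exterior_on R"
proof -
  have "(1 :: 'a tensor) \<in> {x. \<forall>w\<in>Poly_Mapping.keys x. set (letters w) \<subseteq> R}"
    by (simp add: zero_tensor_word_def)
  then show ?thesis unfolding exterior_on_def abs_exterior_simps(5)[symmetric] by (rule imageI)
qed

lemma exterior_on_gen [simp]: "c \<in> R \<Longrightarrow> gen c \<in> exterior_on R"
  unfolding exterior_on_def gen_def by (rule imageI) simp

lemma exterior_on_diff:
  assumes "x \<in> exterior_on R" "y \<in> exterior_on R" shows "x - y \<in> exterior_on R"
proof -
  obtain u v where uv: "x = abs_exterior u" "y = abs_exterior v"
    "\<forall>w\<in>Poly_Mapping.keys u. set (letters w) \<subseteq> R" "\<forall>w\<in>Poly_Mapping.keys v. set (letters w) \<subseteq> R"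
    using assms by (auto simp: exterior_on_def)
  then have "\<forall>w\<in>Poly_Mapping.keys (u - v). set (letters w) \<subseteq> R"
    using keys_diff[of u v] by blast
  then show ?thesis unfolding exterior_on_def uv(1,2) by (auto simp flip: abs_exterior_simps)
qed

lemma exterior_on_0 [simp]: "0 \<in> exterior_on R"
  using exterior_on_diff[OF exterior_on_1 exterior_on_1] by simp

lemma exterior_on_uminus: "x \<in> exterior_on R \<Longrightarrow> - x \<in> exterior_on R"
  using exterior_on_diff[OF exterior_on_0] by fastforce

lemma exterior_on_add: "x \<in> exterior_on R \<Longrightarrow> y \<in> exterior_on R \<Longrightarrow> x + y \<in> exterior_on R"
  using exterior_on_diff[OF _ exterior_on_uminus] by fastforce

lemma exterior_on_mult:
  assumes "x \<in> exterior_on R" "y \<in> exterior_on R" shows "x * y \<in> exterior_on R"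
proof -
  obtain u v where uv: "x = abs_exterior u" "y = abs_exterior v"
    "\<forall>w\<in>Poly_Mapping.keys u. set (letters w) \<subseteq> R" "\<forall>w\<in>Poly_Mapping.keys v. set (letters w) \<subseteq> R"
    using assms by (auto simp: exterior_on_def)
  then have "\<forall>w\<in>Poly_Mapping.keys (u * v). set (letters w) \<subseteq> R"
    using keys_mult[of u v] by (fastforce simp: plus_tensor_word_def)
  then show ?thesis unfolding exterior_on_def uv(1,2) by (auto simp flip: abs_exterior_simps)
qed

lemma exterior_on_induct [consumes 1, case_names one gen_mult diff]:
  assumes "x \<in> exterior_on R" and one: "P 1"
    and gen_mult: "\<And>c x. c \<in> R \<Longrightarrow> P x \<Longrightarrow> P (gen c * x)"
    and diff: "\<And>x y. P x \<Longrightarrow> P y \<Longrightarrow> P (x - y)"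
  shows "P x"
proof -
  obtain t where t: "x = abs_exterior t" "Poly_Mapping.keys t \<subseteq> {w. set (letters w) \<subseteq> R}"
    using assms(1) by (auto simp: exterior_on_def)
  have word: "P (abs_exterior (frag_of (Word l)))" if "set l \<subseteq> R" for l
    using that
  proof (induction l)
    case Nil
    then show ?case using one by (simp add: single_one abs_exterior_simps flip: zero_tensor_word_def)
  next
    case (Cons c l)
    have "frag_of (Word (c # l)) = frag_of (Word [c]) * (frag_of (Word l) :: 'a tensor)"
      by (simp only: frag_of_mult plus_tensor_word_def) simp
    then show ?case using Cons gen_mult by (simp add: abs_exterior_simps gen_def)
  qed
  have "P (abs_exterior t)"
    using t(2)
  proof (induction t rule: frag_induction)
    case zero
    show ?case using diff[OF one one] by (simp add: abs_exterior_simps)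
  next
    case (one w)
    then show ?case using word[of "letters w"] by simp
  next
    case (diff a b)
    then show ?case using assms(4) by (simp add: abs_exterior_simps)
  qed
  then show ?thesis using t(1) by simp
qed

lemma ext_lift_exterior_on:
  fixes f :: "'c \<Rightarrow> 'd exterior"
  assumes "\<And>c. f c \<in> ext_degree_one" "\<And>c. c \<in> R \<Longrightarrow> f c \<in> exterior_on S" "x \<in> exterior_on R"
  shows "ext_lift f x \<in> exterior_on S"
  using assms(3)
  by (induction rule: exterior_on_induct)
     (simp_all add: assms(1,2) ext_lift_1 ext_lift_mult ext_lift_gen ext_lift_diff exterior_on_mult
       exterior_on_diff)

text \<open>An element of degree one has no constant term, so by the Leibniz rule a product with two
  such factors has no linear term.\<close>

lemma ext_ideal_linear_coeff: "x \<in> ext_ideal \<Longrightarrow> Poly_Mapping.lookup x (Word [c]) = 0"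
proof (induction rule: ext_ideal.induct)
  case (square v a b)
  let ?e = "\<lambda>x. Poly_Mapping.lookup x (0 :: 'a tensor_word)"
  let ?l = "\<lambda>x. Poly_Mapping.lookup x (Word [c])"
  have mult: "?e (x * y) = ?e x * ?e y \<and> ?l (x * y) = ?l x * ?e y + ?e x * ?l y" for x y :: "'a tensor"
  proof (induction x rule: tensor_induct)
    case (of_word w)
    show ?case
    proof (induction y rule: tensor_induct)
      case (of_word u)
      show ?case
        unfolding frag_of_mult
        by (cases w; cases u)
           (auto simp: lookup_single zero_tensor_word_def plus_tensor_word_def when_def Cons_eq_append_conv)
    qed (simp add: right_diff_distrib lookup_minus algebra_simps)
  qed (simp add: left_diff_distrib lookup_minus algebra_simps)
  have "?e v = 0"
    using square unfolding degree_one_def zero_tensor_word_def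
    by (metis (mono_tags, lifting) in_keys_iff list.size(3) mem_Collect_eq
        tensor_word.sel zero_neq_one)
  then show ?case by (simp add: mult)
qed (auto simp: lookup_minus)

text \<open>Makes the difference of two distinct circles nonzero, which is what allows colours to be
  read off from potentials.\<close>

lemma gen_eq_iff [simp]: "gen c = gen d \<longleftrightarrow> c = d"
proof
  assume "gen c = gen d"
  then have "frag_of (Word [c]) - frag_of (Word [d]) \<in> ext_ideal"
    by (simp add: gen_def abs_exterior_eq_iff)
  from ext_ideal_linear_coeff[OF this, of c] show "c = d"
    by (auto simp: lookup_minus lookup_single when_def split: if_splits)
qed simp

section \<open>Potentials and the isomorphism at a vertex\<close>

context planar_diagram
begin

text \<open>One chosen end in each graph component; the potentials vanish there, so the vertex maps
  fix the circle through it.\<close>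

definition base :: "dpoint \<Rightarrow> dpoint" where "base p = (SOME q. q \<in> conn `` {p})"

lemma base_conn:
  assumes "p \<in> ends D" shows "(p, base p) \<in> conn"
proof -
  have "base p \<in> conn `` {p}"
    unfolding base_def by (rule someI[of _ p]) (rule equiv_class_self[OF equiv_conn assms])
  then show ?thesis by simp
qed

lemma base_cong: "(p, q) \<in> conn \<Longrightarrow> base p = base q"
  using equiv_class_eq[OF equiv_conn, of p q] by (simp add: base_def)

lemma base_in_ends [simp]: "p \<in> ends D \<Longrightarrow> base p \<in> ends D"
  using base_conn[of p] equiv_conn by (auto simp: equiv_def)

lemma base_base: "p \<in> ends D \<Longrightarrow> base (base p) = base p"
  using base_cong[OF base_conn] by simp

lemma base_arc [simp]: "p \<in> ends D \<Longrightarrow> base (arc D p) = base p"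
  using base_cong[of p "arc D p"] by (simp add: conn_def reach_step)

lemma base_turn [simp]: "p \<in> ends D \<Longrightarrow> base (turn p) = base p"
  using base_cong[of p "turn p"] by (simp add: conn_def reach_step)

lemma component_induct [consumes 1, case_names base arc turn]:
  assumes "p \<in> ends D" "P (base p)" "\<And>q. q \<in> ends D \<Longrightarrow> P q \<Longrightarrow> P (arc D q)"
    "\<And>q. q \<in> ends D \<Longrightarrow> P q \<Longrightarrow> P (turn q)"
  shows "P p"
proof -
  have "(base p, p) \<in> conn" using equiv_symD[OF equiv_conn base_conn[OF assms(1)]] .
  then have "(base p, p) \<in> ({(p, arc D p) | p. p \<in> ends D} \<union> {(p, turn p) | p. p \<in> ends D})\<^sup>*"
    by (simp add: conn_def reach_def)
  then show ?thesis
    by (induction rule: rtrancl_induct) (use assms in auto)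
qed

text \<open>Increments and the value at the base determine a potential. Applied to images of
  potentials, this yields their compatibility with merges, splits and vertex maps.\<close>

lemma potential_unique:
  fixes G H w :: "dpoint \<Rightarrow> 'g :: ab_group_add"
  assumes "p \<in> ends D"
    and G: "\<And>q. q \<in> ends D \<Longrightarrow> G (turn q) = G q + w q" "\<And>q. q \<in> ends D \<Longrightarrow> G (arc D q) = G q"
    and H: "\<And>q. q \<in> ends D \<Longrightarrow> H (turn q) = H q + w q" "\<And>q. q \<in> ends D \<Longrightarrow> H (arc D q) = H q"
    and "G (base p) = H (base p)"
  shows "G p = H p"
  using assms(1) by (induction rule: component_induct) (simp_all add: assms)

text \<open>The corner between \<open>p\<close> and \<open>turn p\<close> lies on the right of a
  strand entering at \<open>p\<close>, so \<open>col p\<close> means that this corner is white: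
  differences across white corners are kept, those across black ones dropped.\<close>

definition pot_step :: "nat set \<Rightarrow> dpoint \<Rightarrow> circle exterior" where
  "pot_step A p = (if col p then gen (circle_at D A (turn p)) - gen (circle_at D A p) else 0)"

definition is_pot :: "nat set \<Rightarrow> (dpoint \<Rightarrow> circle exterior) \<Rightarrow> bool" where
  "is_pot A H \<longleftrightarrow> (\<forall>p\<in>ends D. H (turn p) = H p + pot_step A p \<and> H (arc D p) = H p \<and> H (base p) = 0)"

text \<open>
  The differences of circles that meet in a black region and those of circles that meet in a
  white region span complementary summands of the differences of circles of one component.
  The value at an end is the projection to one of the summands of the difference between the
  circle there and the circle at the base point.
\<close>

definition pot :: "nat set \<Rightarrow> dpoint \<Rightarrow> circle exterior" where
  "pot A = (SOME H. is_pot A H)"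

text \<open>At a crossing the two white corners contribute 0 each or two opposite differences,
  depending on the resolution. A face has a constant value of \<open>col\<close> on its orbit, so
  either all its contributions are 0 or they are differences of consecutive circles and
  telescope.\<close>

lemma pot_exists: "\<exists>H. is_pot A H"
proof -
  let ?c = "\<lambda>p. gen (circle_at D A p)"
  \<comment> \<open>Three turns are an inverse turn: \<open>w\<close> records at the end of a turn
    the step taken from its start.\<close>
  define w where "w t = (if col t then 0 else ?c t - ?c (turn (turn (turn t))))" for t
  have wt: "w (turn p) = pot_step A p" if "p \<in> ends D" for p
    using that by (simp add: w_def pot_step_def)
  have "\<exists>H. (\<forall>p\<in>ends D. H (turn p) = H p + w (turn p)) \<and> (\<forall>p\<in>ends D. H (arc D p) = H p)"
  proof (rule potential_exists)
    fix i assume i: "i \<in> crossings D"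
    show "w (End i North) + w (End i West) + w (End i South) + w (End i East) = 0"
    proof (cases "i \<in> A")
      case True
      show ?thesis
        using circle_at_ends1[OF i True] i by (simp add: w_def algebra_simps)
    next
      case False
      show ?thesis
        using circle_at_ends0[OF i False] i by (simp add: w_def algebra_simps)
    qed
  next
    fix h assume h: "h \<in> ends D"
    let ?C = "orbit_rel (face_step D) (ends D) `` {h}"
    have eq: "equiv (ends D) (orbit_rel (face_step D) (ends D))"
      by (rule equiv_orbit_rel[OF finite_ends bij_face_step])
    show "sum w ?C = 0"
    proof (rule sum_telescope_bij)
      show "bij_betw (face_step D) ?C ?C"
        by (rule bij_betw_class[OF finite_ends bij_face_step eq subset_refl h])
    next
      fix p assume "p \<in> ?C"
      then have "p \<in> ends D" using eq by (auto simp: equiv_def)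
      then show "w (face_step D p) =
          (if col (face_step D p) then 0 else ?c (face_step D p)) - (if col p then 0 else ?c p)"
        by (simp add: w_def face_step_def)
    qed
  qed
  then obtain H where H: "\<And>p. p \<in> ends D \<Longrightarrow> H (turn p) = H p + w (turn p)"
    "\<And>p. p \<in> ends D \<Longrightarrow> H (arc D p) = H p" by blast
  have "is_pot A (\<lambda>p. H p - H (base p))"
    unfolding is_pot_def using H wt by (simp add: base_base)
  then show ?thesis by blast
qed

lemma is_pot_pot: "is_pot A (pot A)"
  unfolding pot_def using someI_ex[OF pot_exists] .

lemma pot_turn: "p \<in> ends D \<Longrightarrow> pot A (turn p) = pot A p + pot_step A p"
  and pot_arc: "p \<in> ends D \<Longrightarrow> pot A (arc D p) = pot A p"
  and pot_base: "p \<in> ends D \<Longrightarrow> pot A (base p) = 0"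
  using is_pot_pot[of A] by (auto simp: is_pot_def)

text \<open>A smoothing passes one corner, in one direction or the other, between two ends of the
  same circle, where the step is 0.\<close>

lemma pot_smooth: "p \<in> ends D \<Longrightarrow> pot A (smooth A p) = pot A p"
proof -
  have turn: "pot A (turn q) = pot A q" if "q \<in> ends D" "turn q = smooth A q" for q
  proof -
    have "circle_at D A (turn q) = circle_at D A q" using circle_at_smooth[OF that(1)] that(2) by simp
    then show ?thesis using pot_turn[OF that(1)] by (simp add: pot_step_def)
  qed
  have "turn p = smooth A p \<or> turn (smooth A p) = smooth A (smooth A p)"
  proof (cases p)
    case (End i d) then show ?thesis by (cases d; cases "i \<in> A") (simp_all add: smooth_def)
  qed (simp add: smooth_def)
  moreover assume "p \<in> ends D"
  ultimately show ?thesis using turn[of p] turn[of "smooth A p"] by auto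
qed

lemma pot_circle:
  assumes "p \<in> ends D" "q \<in> ends D" "circle_at D A p = circle_at D A q"
  shows "pot A p = pot A q"
proof -
  have "same_circle A \<subseteq> {(p, q). p \<in> ends D \<and> q \<in> ends D \<and> pot A p = pot A q}" (is "_ \<subseteq> ?R")
    unfolding same_circle_def
  proof (rule reach_least)
    show "equiv (ends D) ?R" by (auto intro!: equivI simp: refl_on_def sym_def trans_def)
  qed (simp_all add: pot_arc pot_smooth)
  then show ?thesis using assms circle_at_eq_iff by blast
qed

lemma circle_in_circles: "p \<in> ends D \<Longrightarrow> circle_at D A p \<in> circles D A"
  by (simp add: circles_def points_def)

lemma loop_in_circles: "j < nloops D \<Longrightarrow> {Loop j} \<in> circles D A"
  unfolding circles_def by (rule image_eqI[of _ _ "Loop j"]) (simp_all add: points_def)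

lemma pot_step_in: "p \<in> ends D \<Longrightarrow> pot_step A p \<in> ext_degree_one \<and> pot_step A p \<in> exterior_on (circles D A)"
  by (simp add: pot_step_def ext_degree_one_diff exterior_on_diff circle_in_circles)

lemma pot_in:
  assumes "p \<in> ends D" shows "pot A p \<in> ext_degree_one \<and> pot A p \<in> exterior_on (circles D A)"
  using assms
  by (induction rule: component_induct)
     (simp_all add: assms pot_base pot_arc pot_turn pot_step_in ext_degree_one_add exterior_on_add)

text \<open>The involution 1 - 2q on a generator. The choice of an end on \<open>C\<close> is
  immaterial by \<open>pot_circle\<close>. Sets that are not circles through an end are fixed, so
  that every value has degree one, as \<open>ext_lift\<close> requires.\<close>

definition circle_map :: "nat set \<Rightarrow> circle \<Rightarrow> circle exterior" where
  "circle_map A C = (if \<exists>p\<in>ends D. C = circle_at D A p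
     then gen C - (let h = pot A (SOME p. p \<in> ends D \<and> C = circle_at D A p) in h + h) else gen C)"

lemma circle_map_end:
  assumes "p \<in> ends D"
  shows "circle_map A (circle_at D A p) = gen (circle_at D A p) - (pot A p + pot A p)"
proof -
  let ?q = "SOME q. q \<in> ends D \<and> circle_at D A p = circle_at D A q"
  have "?q \<in> ends D \<and> circle_at D A p = circle_at D A ?q"
    by (rule someI[of _ p]) (simp add: assms)
  then have "pot A ?q = pot A p" using pot_circle[of ?q p A] assms by simp
  then show ?thesis using assms by (auto simp: circle_map_def Let_def)
qed

lemma circle_map_loop: "circle_map A {Loop j} = gen {Loop j}"
proof -
  have "{Loop j} \<noteq> circle_at D A p" if "p \<in> ends D" for p
    using circle_at_self[OF that, of A] that Loop_notin_ends by (metis singletonD)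
  then show ?thesis by (auto simp: circle_map_def)
qed

lemma circle_map_degree_one: "circle_map A C \<in> ext_degree_one"
proof (cases "\<exists>p\<in>ends D. C = circle_at D A p")
  case True
  then show ?thesis
    using circle_map_end pot_in by (auto intro!: ext_degree_one_diff ext_degree_one_add)
qed (simp add: circle_map_def)

lemma circlesE:
  assumes "C \<in> circles D A"
  obtains p where "p \<in> ends D" "C = circle_at D A p" | j where "j < nloops D" "C = {Loop j}"
  using assms by (auto simp: circles_def points_def)

lemma circle_map_exterior_on: "C \<in> circles D A \<Longrightarrow> circle_map A C \<in> exterior_on (circles D A)"
  by (erule circlesE)
     (simp_all add: circle_map_end circle_map_loop circle_in_circles loop_in_circles pot_in
       exterior_on_diff exterior_on_add)

definition vertex_map :: "nat set \<Rightarrow> circle exterior \<Rightarrow> circle exterior" where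
  "vertex_map A = ext_lift (circle_map A)"

lemma vertex_map_simps:
  "vertex_map A (x + y) = vertex_map A x + vertex_map A y"
  "vertex_map A (x - y) = vertex_map A x - vertex_map A y"
  "vertex_map A (x * y) = vertex_map A x * vertex_map A y"
  "vertex_map A (- x) = - vertex_map A x"
  "vertex_map A 0 = 0" "vertex_map A 1 = 1" "vertex_map A (gen C) = circle_map A C"
  unfolding vertex_map_def
  by (simp_all add: circle_map_degree_one ext_lift_add ext_lift_diff ext_lift_mult ext_lift_uminus
      ext_lift_0 ext_lift_1 ext_lift_gen)

lemma vertex_map_exterior_on:
  "x \<in> exterior_on (circles D A) \<Longrightarrow> vertex_map A x \<in> exterior_on (circles D A)"
  unfolding vertex_map_def
  by (rule ext_lift_exterior_on[OF circle_map_degree_one circle_map_exterior_on])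

text \<open>A step goes to itself minus twice the increment of the potential, which is the step
  again. So steps are negated, and with them the potential.\<close>

lemma vertex_map_pot:
  assumes "p \<in> ends D" shows "vertex_map A (pot A p) = - pot A p"
proof (rule potential_unique[where w = "\<lambda>q. - pot_step A q", OF assms])
  fix q assume q: "q \<in> ends D"
  have "vertex_map A (pot_step A q) = - pot_step A q"
    using q pot_turn[OF q, of A]
    by (auto simp: pot_step_def vertex_map_simps circle_map_end algebra_simps)
  then show "vertex_map A (pot A (turn q)) = vertex_map A (pot A q) + - pot_step A q"
    using pot_turn[OF q] by (simp add: vertex_map_simps)
  show "vertex_map A (pot A (arc D q)) = vertex_map A (pot A q)"
    "- pot A (turn q) = - pot A q + - pot_step A q" "- pot A (arc D q) = - pot A q"
    using q by (simp_all add: pot_arc pot_turn)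
qed (simp add: assms pot_base vertex_map_simps)

lemma vertex_map_involution:
  assumes "x \<in> exterior_on (circles D A)" shows "vertex_map A (vertex_map A x) = x"
  using assms
proof (induction rule: exterior_on_induct)
  case (gen_mult C x)
  have "vertex_map A (circle_map A C) = gen C"
    using gen_mult(1)
    by (rule circlesE) (auto simp: circle_map_end circle_map_loop vertex_map_simps vertex_map_pot)
  then show ?case using gen_mult by (simp add: vertex_map_simps)
qed (simp_all add: vertex_map_simps)

text \<open>A merge takes the circle through a point to the new circle through the same point, hence
  increments to increments and potentials to potentials.\<close>

lemma vertex_map_merge:
  fixes A i
  defines "f \<equiv> (\<lambda>c. if c = circle_at D A (End i South) \<or> c = circle_at D A (End i North)
    then circle_at D (insert i A) (End i West) else c)"
  assumes i: "i \<in> crossings D" "i \<notin> A" "merges A i" and x: "x \<in> exterior_on (circles D A)"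
  shows "vertex_map (insert i A) (exterior_map f x) = exterior_map f (vertex_map A x)"
  using x
proof (induction rule: exterior_on_induct)
  case (gen_mult C x)
  have f: "f (circle_at D A p) = circle_at D (insert i A) p" if "p \<in> points D" for p
    using circle_at_merge[OF i that] by (simp add: f_def)
  have ends: "p \<in> points D" if "p \<in> ends D" for p using that by (simp add: points_def)
  have step: "exterior_map f (pot_step A q) = pot_step (insert i A) q" if "q \<in> ends D" for q
    using that f ends by (simp add: pot_step_def exterior_map_simps)
  have pot: "exterior_map f (pot A p) = pot (insert i A) p" if "p \<in> ends D" for p
    by (rule potential_unique[where w = "pot_step (insert i A)", OF that])
       (simp_all add: that pot_turn pot_arc pot_base step exterior_map_simps)
  have "circle_map (insert i A) (f C) = exterior_map f (circle_map A C)"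
    using gen_mult(1)
  proof (rule circlesE)
    fix p assume "p \<in> ends D" "C = circle_at D A p"
    then show ?thesis by (simp add: circle_map_end f ends pot exterior_map_simps)
  next
    fix j assume j: "j < nloops D" "C = {Loop j}"
    then have "f {Loop j} = {Loop j}" using f[of "Loop j"] by (simp add: points_def)
    then show ?thesis using j(2) by (simp add: circle_map_loop exterior_map_simps)
  qed
  then show ?case using gen_mult by (simp add: vertex_map_simps exterior_map_simps)
qed (simp_all add: vertex_map_simps exterior_map_simps)

text \<open>
  Two ring homomorphisms that agree on generators after multiplication by an element \<open>d\<close> of
  degree one agree everywhere after multiplication by \<open>d\<close>, because \<open>d\<close> anticommutes with the
  images of the generators.
\<close>

lemma vertex_map_split:
  fixes A i e0 e1
  defines "f \<equiv> (\<lambda>c. if c = circle_at D A (End i South) then circle_at D (insert i A) e0 else c)"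
    and "d \<equiv> gen (circle_at D (insert i A) e0) - gen (circle_at D (insert i A) e1)"
  assumes i: "i \<in> crossings D" "i \<notin> A" "\<not> merges A i"
    and e: "e0 = End i West \<and> e1 = End i East \<or> e0 = End i East \<and> e1 = End i West"
    and x: "x \<in> exterior_on (circles D A)"
  shows "vertex_map (insert i A) (d * exterior_map f x)
    = (if black i then - (d * exterior_map f (vertex_map A x)) else d * exterior_map f (vertex_map A x))"
proof -
  let ?A = "insert i A"
  have ends: "p \<in> points D" if "p \<in> ends D" for p using that by (simp add: points_def)
  have e_ends: "e0 \<in> ends D" "e1 \<in> ends D" using e i(1) by auto
  have split: "circle_at D A p = (if circle_at D ?A p = circle_at D ?A e0 \<or> circle_at D ?A p = circle_at D ?A e1
      then circle_at D A (End i South) else circle_at D ?A p)" if "p \<in> points D" for p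
    using circle_at_split[OF i that] e by auto
  have south: "circle_at D ?A (End i South) = circle_at D ?A (End i East)"
    using circle_at_ends1[OF i(1), of ?A] by simp
  have d_one: "d \<in> ext_degree_one" by (simp add: d_def ext_degree_one_diff)
  \<comment> \<open>From \<open>d * d = 0\<close>: after multiplication by \<open>d\<close>, either
    new circle may represent the split one.\<close>
  have d_gen: "d * gen (circle_at D ?A e0) = d * gen (circle_at D ?A e1)"
    using ext_degree_one_square[OF d_one] unfolding d_def by (simp add: algebra_simps)
  have fC: "d * gen (f (circle_at D A p)) = d * gen (circle_at D ?A p)" if p: "p \<in> points D" for p
  proof (cases "circle_at D ?A p = circle_at D ?A e0 \<or> circle_at D ?A p = circle_at D ?A e1")
    case True
    then show ?thesis using split[OF p] d_gen by (auto simp: f_def)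
  next
    case False
    then have eq: "circle_at D A p = circle_at D ?A p" using split[OF p] by simp
    \<comment> \<open>An untouched circle equal to the split one would contain
      \<open>End i South\<close>, which lies on one of the two new circles.\<close>
    have "circle_at D A p \<noteq> circle_at D A (End i South)"
    proof
      assume "circle_at D A p = circle_at D A (End i South)"
      then have "End i South \<in> circle_at D ?A p" using eq circle_at_self[of "End i South" A] i(1) by simp
      moreover have "p \<in> ends D"
        using p calculation i(1) by (auto simp: points_def)
      ultimately have "circle_at D ?A p = circle_at D ?A (End i South)"
        using circle_at_eq_iff[of p "End i South" ?A] i(1) by (simp add: circle_at_eq)
      then show False using False south e by auto
    qed
    then show ?thesis using eq by (simp add: f_def)
  qed
  have step: "d * exterior_map f (pot_step A q) = d * pot_step ?A q" if "q \<in> ends D" for q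
    using that fC ends by (simp add: pot_step_def exterior_map_simps right_diff_distrib)
  have pot: "d * exterior_map f (pot A p) = d * pot ?A p" if "p \<in> ends D" for p
    by (rule potential_unique[where w = "\<lambda>q. d * pot_step ?A q", OF that])
       (simp_all add: that pot_turn pot_arc pot_base step exterior_map_simps distrib_left)
  have gen: "d * circle_map ?A (f C) = d * exterior_map f (circle_map A C)" if C: "C \<in> circles D A" for C
    using C
  proof (rule circlesE)
    fix p assume p: "p \<in> ends D" "C = circle_at D A p"
    \<comment> \<open>An end is wanted whose new circle is literally \<open>f C\<close>, not merely
      equal to it after multiplication by \<open>d\<close>; on the split circle \<open>e0\<close> is
      one.\<close>
    have "\<exists>q\<in>ends D. C = circle_at D A q \<and> f C = circle_at D ?A q"
    proof (cases "C = circle_at D A (End i South)")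
      case True
      moreover have "circle_at D A e0 = circle_at D A (End i South)" using split[OF ends[OF e_ends(1)]] by simp
      ultimately show ?thesis using e_ends(1) by (intro bexI[of _ e0]) (simp_all add: f_def)
    next
      case False
      then show ?thesis using p split[OF ends[OF p(1)]] by (intro bexI[of _ p]) (auto simp: f_def)
    qed
    then obtain q where q: "q \<in> ends D" "C = circle_at D A q" "f C = circle_at D ?A q" by blast
    then have eqs: "circle_map ?A (f C) = gen (f C) - (pot ?A q + pot ?A q)"
      "exterior_map f (circle_map A C) = gen (f C) - (exterior_map f (pot A q) + exterior_map f (pot A q))"
      by (simp_all add: circle_map_end exterior_map_simps)
    show ?thesis unfolding eqs by (simp add: right_diff_distrib distrib_left pot[OF q(1)])
  next
    fix j assume j: "j < nloops D" "C = {Loop j}"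
    have "Loop j \<notin> circle_at D A (End i South)"
      using i(1) equiv_same_circle[of A] by (auto simp: circle_at_eq equiv_def)
    then have "f {Loop j} = {Loop j}" by (auto simp: f_def)
    then show ?thesis using j(2) by (simp add: circle_map_loop exterior_map_simps)
  qed
  have main: "d * vertex_map ?A (exterior_map f x) = d * exterior_map f (vertex_map A x)"
    using x
  proof (induction rule: exterior_on_induct)
    case (gen_mult C x)
    let ?u = "circle_map ?A (f C)" and ?v = "exterior_map f (circle_map A C)"
    let ?F = "vertex_map ?A (exterior_map f x)" and ?G = "exterior_map f (vertex_map A x)"
    have u: "d * ?u = - (?u * d)" using ext_degree_one_anticommute[OF d_one circle_map_degree_one] .
    have "d * (?u * ?F) = - (?u * (d * ?F))" using u by (simp flip: mult.assoc)
    also have "\<dots> = - (?u * (d * ?G))" using gen_mult(2) by simp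
    also have "\<dots> = d * ?u * ?G" using u by (simp flip: mult.assoc)
    also have "\<dots> = d * ?v * ?G" using gen[OF gen_mult(1)] by simp
    finally show ?case by (simp add: vertex_map_simps exterior_map_simps mult.assoc)
  qed (simp_all add: vertex_map_simps exterior_map_simps right_diff_distrib)
  \<comment> \<open>If \<open>i\<close> is black, \<open>d\<close> is up to sign the step at
    \<open>End i West\<close> and is negated; otherwise the potentials of the two new circles agree
    and \<open>d\<close> is fixed.\<close>
  have "pot ?A (End i South) = pot ?A (End i West) + pot_step ?A (End i West)"
    using pot_turn[of "End i West" ?A] i(1) by simp
  moreover have "pot ?A (End i South) = pot ?A (End i East)"
    using pot_circle[OF _ _ south] i(1) by simp
  moreover have "pot_step ?A (End i West)
      = (if black i then gen (circle_at D ?A (End i East)) - gen (circle_at D ?A (End i West)) else 0)"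
    by (simp add: pot_step_def black_def south)
  ultimately have "vertex_map ?A d = (if black i then - d else d)"
    using e i(1) unfolding d_def
    by (auto simp: vertex_map_simps circle_map_end algebra_simps)
  then show ?thesis using main by (auto simp: vertex_map_simps)
qed

section \<open>Vertex maps against edge maps\<close>

lemma edge_map_merge:
  "merges A i \<Longrightarrow> edge_map D arr A i = exterior_map
    (\<lambda>c. if c = circle_at D A (End i South) \<or> c = circle_at D A (End i North)
      then circle_at D (insert i A) (End i West) else c)"
  by (simp add: edge_map_def merges_def merge_map_def Let_def)

lemma edge_map_split:
  assumes "\<not> merges A i"
  obtains e0 e1 where "e0 = End i West \<and> e1 = End i East \<or> e0 = End i East \<and> e1 = End i West"
    "edge_map D arr A i = (\<lambda>x. (gen (circle_at D (insert i A) e0) - gen (circle_at D (insert i A) e1)) *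
      exterior_map (\<lambda>c. if c = circle_at D A (End i South) then circle_at D (insert i A) e0 else c) x)"
proof (cases "arr i")
  case SW_to_NE
  then show ?thesis
    using assms by (intro that[of "End i West" "End i East"])
      (auto simp: edge_map_def merges_def split_map_def Let_def fun_eq_iff)
next
  case NE_to_SW
  then show ?thesis
    using assms by (intro that[of "End i East" "End i West"])
      (auto simp: edge_map_def merges_def split_map_def Let_def fun_eq_iff)
qed

lemma edge_map_diff: "edge_map D arr A i (x - y) = edge_map D arr A i x - edge_map D arr A i y"
proof (cases "merges A i")
  case False
  then show ?thesis by (rule edge_map_split[of A i arr]) (simp add: exterior_map_simps right_diff_distrib)
qed (simp add: edge_map_merge exterior_map_simps)

lemma edge_map_0 [simp]: "edge_map D arr A i 0 = 0"
  using edge_map_diff[of arr A i 0 0] by simp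

lemma edge_map_uminus: "edge_map D arr A i (- x) = - edge_map D arr A i x"
  using edge_map_diff[of arr A i 0 x] by simp

lemma edge_map_sign: "s = 1 \<or> s = - 1 \<Longrightarrow> edge_map D arr A i (of_int s * x) = of_int s * edge_map D arr A i x"
  by (auto simp: edge_map_uminus)

lemma vertex_map_edge:
  assumes "i \<in> crossings D" "i \<notin> A" "x \<in> exterior_on (circles D A)"
  shows "vertex_map (insert i A) (edge_map D arr A i x)
    = of_int (if black i \<and> \<not> merges A i then - 1 else 1) * edge_map D arr A i (vertex_map A x)"
proof (cases "merges A i")
  case True
  then show ?thesis using vertex_map_merge[OF assms(1,2) _ assms(3)] by (simp add: edge_map_merge)
next
  case False
  obtain e0 e1 where e: "e0 = End i West \<and> e1 = End i East \<or> e0 = End i East \<and> e1 = End i West"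
    "edge_map D arr A i = (\<lambda>x. (gen (circle_at D (insert i A) e0) - gen (circle_at D (insert i A) e1)) *
      exterior_map (\<lambda>c. if c = circle_at D A (End i South) then circle_at D (insert i A) e0 else c) x)"
    by (rule edge_map_split[OF False])
  show ?thesis unfolding e(2) vertex_map_split[OF assms(1,2) False e(1) assms(3)] using False by simp
qed

definition black_sign :: "nat set \<Rightarrow> int" where "black_sign A = (- 1) ^ card {i \<in> A. black i}"

text \<open>The discrepancy left after \<open>black_sign\<close> is included. It is not closed: its
  product around a face detects the degenerate faces.\<close>

definition twist :: "nat set \<Rightarrow> nat \<Rightarrow> int" where
  "twist A i = (if black i \<and> merges A i then - 1 else 1)"

lemma black_sign_insert:
  "finite A \<Longrightarrow> i \<notin> A \<Longrightarrow> black_sign (insert i A) = (if black i then - black_sign A else black_sign A)"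
proof -
  assume "finite A" "i \<notin> A"
  moreover have "{j \<in> insert i A. black j} = (if black i then insert i {j \<in> A. black j} else {j \<in> A. black j})"
    by auto
  ultimately show ?thesis by (simp add: black_sign_def)
qed

lemma sign_vertex_map_edge:
  assumes "i \<in> crossings D" "i \<notin> A" "finite A" "x \<in> exterior_on (circles D A)"
  shows "of_int (black_sign (insert i A)) * vertex_map (insert i A) (edge_map D arr A i x)
    = of_int (twist A i * black_sign A) * edge_map D arr A i (vertex_map A x)"
  using vertex_map_edge[OF assms(1,2,4), of arr] black_sign_insert[OF assms(3,2)]
  by (auto simp: twist_def)

end

section \<open>Interleaved arcs\<close>

context
  fixes f :: "'a \<Rightarrow> 'a" and B :: "'a set"
  assumes B: "finite B" "bij_betw f B B"
begin

text \<open>After the cut the cycle of \<open>y\<close> consists of the points after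
  \<open>x\<close> up to \<open>y\<close>, so it contains \<open>u\<close> and misses
  \<open>v\<close>.\<close>

lemma cyclic_order_cut:
  assumes "cyclic_order f x u y v" "x \<in> B" "x \<noteq> y"
  shows "(x, y) \<in> orbit_rel f B" "(x, u) \<in> orbit_rel f B" "(x, v) \<in> orbit_rel f B"
    "(y, u) \<in> orbit_rel (f \<circ> transpose x y) B" "(y, v) \<notin> orbit_rel (f \<circ> transpose x y) B"
proof -
  obtain p q r where pqr: "0 < p" "p < q" "q < r" "(f ^^ p) x = u" "(f ^^ q) x = y" "(f ^^ r) x = v"
    and ret: "\<And>m. 0 < m \<Longrightarrow> m \<le> r \<Longrightarrow> (f ^^ m) x \<noteq> x"
    using assms(1) unfolding cyclic_order_def by blast
  show "(x, y) \<in> orbit_rel f B" "(x, u) \<in> orbit_rel f B" "(x, v) \<in> orbit_rel f B"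
    using pqr orbit_relI[OF assms(2)] by metis+
  have inj: "m = n" if mn: "(f ^^ m) x = (f ^^ n) x" "m \<le> r" "n \<le> r" for m n
  proof -
    have *: "a = b" if "(f ^^ a) x = (f ^^ b) x" "a \<le> b" "b \<le> r" for a b
    proof (rule ccontr)
      assume "a \<noteq> b"
      have "(f ^^ a) ((f ^^ (b - a)) x) = (f ^^ a) x"
        using that by (metis funpow_add le_add_diff_inverse o_apply)
      then have "(f ^^ (b - a)) x = x"
        by (rule funpow_inj_on[OF B(2) funpow_closed[OF B(2) assms(2)] assms(2)])
      then show False using ret[of "b - a"] that \<open>a \<noteq> b\<close> by simp
    qed
    show ?thesis using *[of m n] *[of n m] mn by (cases "m \<le> n") auto
  qed
  have hit: "(f ^^ m) x \<noteq> x \<and> (f ^^ m) x \<noteq> y" if "0 < m" "m < q" for m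
    using ret[of m] inj[of m q] that pqr by auto
  have q: "0 < q" using pqr by simp
  have cl: "orbit_rel (f \<circ> transpose x y) B `` {y} = (\<lambda>m. (f ^^ m) x) ` {1..q}"
    by (rule orbit_rel_cut_class[OF B assms(2,3) q pqr(5) hit])
  have "u \<in> (\<lambda>m. (f ^^ m) x) ` {1..q}" using pqr by (intro image_eqI[of _ _ p]) auto
  then show "(y, u) \<in> orbit_rel (f \<circ> transpose x y) B" using cl by blast
  have "v \<notin> (\<lambda>m. (f ^^ m) x) ` {1..q}"
  proof
    assume "v \<in> (\<lambda>m. (f ^^ m) x) ` {1..q}"
    then obtain m where "m \<in> {1..q}" "v = (f ^^ m) x" by (rule imageE)
    then show False using inj[of m r] pqr by simp
  qed
  then show "(y, v) \<notin> orbit_rel (f \<circ> transpose x y) B" using cl by blast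
qed

lemma cyclic_orderI:
  assumes "(x, y) \<in> orbit_rel f B" "x \<noteq> y" "u \<noteq> y" "v \<noteq> x"
    "(x, v) \<in> orbit_rel f B" "(y, u) \<in> orbit_rel (f \<circ> transpose x y) B"
    "(y, v) \<notin> orbit_rel (f \<circ> transpose x y) B"
  shows "cyclic_order f x u y v"
proof -
  have x: "x \<in> B" using assms(1) by (simp add: orbit_rel_def)
  obtain k where k: "0 < k" "(f ^^ k) x = y" "\<And>m. 0 < m \<Longrightarrow> m < k \<Longrightarrow> (f ^^ m) x \<noteq> x \<and> (f ^^ m) x \<noteq> y"
    using orbit_rel_first_hit[OF B assms(1,2)] by metis
  have cl: "orbit_rel (f \<circ> transpose x y) B `` {y} = (\<lambda>m. (f ^^ m) x) ` {1..k}"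
    by (rule orbit_rel_cut_class[OF B x assms(2) k])
  have "u \<in> (\<lambda>m. (f ^^ m) x) ` {1..k}" using assms(6) cl by blast
  then obtain p where p: "p \<in> {1..k}" "u = (f ^^ p) x" by (rule imageE)
  then have pk: "0 < p" "p < k" using assms(3) k(2) by (auto simp: nat_less_le)
  obtain N where N: "0 < N" "(f ^^ N) x = x" "\<And>m. 0 < m \<Longrightarrow> m < N \<Longrightarrow> (f ^^ m) x \<noteq> x"
    using funpow_period[OF B x] by metis
  obtain n where "v = (f ^^ n) x" using assms(5) by (auto simp: orbit_rel_def)
  \<comment> \<open>Reduction modulo the period puts \<open>v\<close> into a single run; missing the
    stretch up to \<open>y\<close> then puts it after \<open>y\<close>.\<close>
  then have v: "v = (f ^^ (n mod N)) x" using funpow_mod_eq[OF N(2)] by simp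
  have n0: "0 < n mod N" using v assms(4) by (cases "n mod N = 0") auto
  have nk: "k < n mod N"
  proof (rule ccontr)
    assume "\<not> k < n mod N"
    then have "v \<in> (\<lambda>m. (f ^^ m) x) ` {1..k}" using v n0 by (intro image_eqI[of _ _ "n mod N"]) auto
    then show False using cl assms(7) by blast
  qed
  have "n mod N < N" using N(1) by simp
  then have "\<forall>m. 0 < m \<and> m \<le> n mod N \<longrightarrow> (f ^^ m) x \<noteq> x" using N(3) by (meson le_less_trans)
  then show ?thesis
    unfolding cyclic_order_def
    by (intro exI[of _ p] exI[of _ k] exI[of _ "n mod N"]) (use pk nk p(2) k(2) v in auto)
qed

text \<open>Interleaving as a surgery condition: cutting at one pair separates the other. All four
  points then lie on one cycle, since the cut separates only points of the cycle that it
  divides.\<close>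

lemma interleaved_iff:
  assumes "x \<in> B" "x \<noteq> y" "u \<notin> {x, y}" "v \<notin> {x, y}"
  shows "cyclic_order f x u y v \<or> cyclic_order f x v y u \<longleftrightarrow>
    (x, y) \<in> orbit_rel f B \<and> (u, v) \<in> orbit_rel f B \<and> (u, v) \<notin> orbit_rel (f \<circ> transpose x y) B"
    "\<not> (cyclic_order f x u y v \<and> cyclic_order f x v y u)"
proof -
  have eq: "equiv B (orbit_rel f B)" by (rule equiv_orbit_rel[OF B])
  have fwd: "(x, y) \<in> orbit_rel f B \<and> (u, v) \<in> orbit_rel f B \<and> (v, u) \<in> orbit_rel f B \<and>
      (u, v) \<notin> orbit_rel (f \<circ> transpose x y) B \<and> (v, u) \<notin> orbit_rel (f \<circ> transpose x y) B"
    if c: "cyclic_order f x u y v" for u v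
  proof -
    note cut = cyclic_order_cut[OF c assms(1,2)]
    have "y \<in> B" using cut(1) eq by (auto simp: equiv_def)
    then have eqg: "equiv B (orbit_rel (f \<circ> transpose x y) B)"
      using equiv_orbit_rel[OF B(1) bij_betw_transpose_comp[OF B(2) assms(1)]] by blast
    show ?thesis
      using cut equiv_symD[OF eq] equiv_transD[OF eq] equiv_symD[OF eqg] equiv_transD[OF eqg] by metis
  qed
  show "cyclic_order f x u y v \<or> cyclic_order f x v y u \<longleftrightarrow>
    (x, y) \<in> orbit_rel f B \<and> (u, v) \<in> orbit_rel f B \<and> (u, v) \<notin> orbit_rel (f \<circ> transpose x y) B" (is "?L \<longleftrightarrow> ?R")
  proof
    assume ?L then show ?R using fwd by blast
  next
    assume R: ?R
    have y: "y \<in> B" using R eq by (auto simp: equiv_def)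
    let ?g = "f \<circ> transpose x y"
    have eqg: "equiv B (orbit_rel ?g B)"
      using equiv_orbit_rel[OF B(1) bij_betw_transpose_comp[OF B(2) assms(1) y]] .
    have join: "orbit_rel f B = join_rel (orbit_rel ?g B) x y"
      by (rule orbit_rel_split[OF B]) (use R assms(2) in auto)
    have cut: "(x, y) \<notin> orbit_rel ?g B" by (rule orbit_rel_cut[OF B]) (use R assms(2) in auto)
    have le: "orbit_rel ?g B \<subseteq> orbit_rel f B" unfolding join by (auto simp: join_rel_def)
    have "(u, x) \<in> orbit_rel ?g B \<and> (y, v) \<in> orbit_rel ?g B \<or> (u, y) \<in> orbit_rel ?g B \<and> (x, v) \<in> orbit_rel ?g B"
      using R unfolding join by (auto simp: join_rel_def)
    then show ?L
    proof
      assume 1: "(u, x) \<in> orbit_rel ?g B \<and> (y, v) \<in> orbit_rel ?g B"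
      have "cyclic_order f x v y u"
      proof (rule cyclic_orderI)
        show "(x, u) \<in> orbit_rel f B" using 1 le equiv_symD[OF eq] by blast
        show "(y, u) \<notin> orbit_rel ?g B"
          using 1 cut equiv_symD[OF eqg] equiv_transD[OF eqg] by blast
      qed (use 1 R assms in auto)
      then show ?thesis ..
    next
      assume 1: "(u, y) \<in> orbit_rel ?g B \<and> (x, v) \<in> orbit_rel ?g B"
      have "cyclic_order f x u y v"
      proof (rule cyclic_orderI)
        show "(x, v) \<in> orbit_rel f B" using 1 le by blast
        show "(y, u) \<in> orbit_rel ?g B" using 1 equiv_symD[OF eqg] by blast
        show "(y, v) \<notin> orbit_rel ?g B"
          using 1 cut equiv_symD[OF eqg] equiv_transD[OF eqg] by blast
      qed (use 1 R assms in auto)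
      then show ?thesis ..
    qed
  qed
  show "\<not> (cyclic_order f x u y v \<and> cyclic_order f x v y u)"
    using cyclic_order_cut(4)[OF _ assms(1,2)] cyclic_order_cut(5)[OF _ assms(1,2)] by blast
qed

lemma cyclic_order_period:
  assumes "cyclic_order f h0 h1 h2 h3" "h0 \<in> B"
  obtains p q r N where "0 < p" "p < q" "q < r" "r < N" "(f ^^ p) h0 = h1" "(f ^^ q) h0 = h2"
    "(f ^^ r) h0 = h3" "(f ^^ N) h0 = h0" "\<And>m. 0 < m \<Longrightarrow> m < N \<Longrightarrow> (f ^^ m) h0 \<noteq> h0"
proof -
  obtain N where N: "0 < N" "(f ^^ N) h0 = h0" "\<And>m. 0 < m \<Longrightarrow> m < N \<Longrightarrow> (f ^^ m) h0 \<noteq> h0"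
    using funpow_period[OF B assms(2)] by metis
  obtain p q r where pqr: "0 < p" "p < q" "q < r" "(f ^^ p) h0 = h1" "(f ^^ q) h0 = h2" "(f ^^ r) h0 = h3"
    and ret: "\<And>m. 0 < m \<Longrightarrow> m \<le> r \<Longrightarrow> (f ^^ m) h0 \<noteq> h0"
    using assms(1) unfolding cyclic_order_def by blast
  have "r < N" using ret[of N] N(1,2) by (meson not_le)
  then show ?thesis using that pqr N by blast
qed

lemma cyclic_order_rotate:
  assumes "cyclic_order f h0 h1 h2 h3" "h0 \<in> B" shows "cyclic_order f h1 h2 h3 h0"
proof -
  obtain p q r N where *: "0 < p" "p < q" "q < r" "r < N" "(f ^^ p) h0 = h1" "(f ^^ q) h0 = h2"
    "(f ^^ r) h0 = h3" "(f ^^ N) h0 = h0" "\<And>m. 0 < m \<Longrightarrow> m < N \<Longrightarrow> (f ^^ m) h0 \<noteq> h0"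
    using cyclic_order_period[OF assms] by metis
  have shift: "(f ^^ (n - p)) h1 = (f ^^ n) h0" if "p \<le> n" for n
    using that *(5) by (metis comp_apply funpow_add le_add_diff_inverse2)
  have ret: "(f ^^ m) h1 \<noteq> h1" if "0 < m" "m < N" for m
  proof
    assume "(f ^^ m) h1 = h1"
    then have "(f ^^ p) ((f ^^ m) h0) = (f ^^ p) h0"
      using *(5) by (metis add.commute comp_apply funpow_add)
    then have "(f ^^ m) h0 = h0"
      by (rule funpow_inj_on[OF B(2) funpow_closed[OF B(2) assms(2)] assms(2)])
    then show False using *(9) that by blast
  qed
  show ?thesis
    unfolding cyclic_order_def
    by (intro exI[of _ "q - p"] exI[of _ "r - p"] exI[of _ "N - p"])
       (use * shift ret in auto)
qed

text \<open>The condition on \<open>s\<close> says that it conjugates \<open>f\<close> to its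
  inverse, so the cycle is run backwards.\<close>

lemma cyclic_order_reverse:
  assumes "cyclic_order f h0 h1 h2 h3" "h0 \<in> B"
    and s: "\<And>x. x \<in> B \<Longrightarrow> s x \<in> B \<and> s (s x) = x \<and> f (s (f x)) = s x"
  shows "cyclic_order f (s h0) (s h3) (s h2) (s h1)"
proof -
  obtain p q r N where *: "0 < p" "p < q" "q < r" "r < N" "(f ^^ p) h0 = h1" "(f ^^ q) h0 = h2"
    "(f ^^ r) h0 = h3" "(f ^^ N) h0 = h0" "\<And>m. 0 < m \<Longrightarrow> m < N \<Longrightarrow> (f ^^ m) h0 \<noteq> h0"
    using cyclic_order_period[OF assms(1,2)] by metis
  have rev: "(f ^^ n) (s ((f ^^ n) x)) = s x" if "x \<in> B" for n x
  proof (induction n)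
    case (Suc n)
    have "(f ^^ Suc n) (s ((f ^^ Suc n) x)) = (f ^^ n) (f (s (f ((f ^^ n) x))))"
      by (simp add: funpow_swap1)
    then show ?case using Suc s funpow_closed[OF B(2) that] by simp
  qed simp
  have bwd: "(f ^^ (N - n)) (s h0) = s ((f ^^ n) h0)" if "n \<le> N" for n
  proof -
    have "(f ^^ (N - n)) ((f ^^ n) h0) = h0"
      using that *(8) by (metis comp_apply funpow_add le_add_diff_inverse2)
    then show ?thesis using rev[OF funpow_closed[OF B(2) assms(2)], of "N - n" n] by simp
  qed
  have ret: "(f ^^ m) (s h0) \<noteq> s h0" if "0 < m" "m < N" for m
  proof
    assume "(f ^^ m) (s h0) = s h0"
    then have "(f ^^ m) (s h0) = (f ^^ m) (s ((f ^^ m) h0))" using rev[OF assms(2)] by simp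
    moreover have "s h0 \<in> B" "s ((f ^^ m) h0) \<in> B"
      using s[OF assms(2)] s[OF funpow_closed[OF B(2) assms(2)]] by blast+
    ultimately have "s h0 = s ((f ^^ m) h0)" using funpow_inj_on[OF B(2)] by blast
    then have "h0 = (f ^^ m) h0"
      using s[OF assms(2)] s[OF funpow_closed[OF B(2) assms(2)]] by metis
    then show False using *(9)[OF that] by simp
  qed
  show ?thesis
    unfolding cyclic_order_def
    by (intro exI[of _ "N - r"] exI[of _ "N - q"] exI[of _ "N - p"])
       (use * bwd ret in auto)
qed

end

section \<open>Faces of the cube\<close>

context planar_diagram
begin

lemma joined_pair:
  assumes join: "circle_rel A' = join_rel (circle_rel A) u v"
    and "u \<in> black_ends" "v \<in> black_ends" "p \<in> ends D" "q \<in> ends D"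
    "circle_at D A' p = circle_at D A' q" "circle_at D A p \<noteq> circle_at D A q"
  shows "circle_at D A p = circle_at D A u \<and> circle_at D A q = circle_at D A v \<or>
    circle_at D A p = circle_at D A v \<and> circle_at D A q = circle_at D A u"
proof -
  have uv: "u \<in> ends D" "v \<in> ends D" "black_end u = u" "black_end v = v" using assms(2,3) black_ends_sub by auto
  have "(black_end p, black_end q) \<in> join_rel (circle_rel A) u v"
    "(black_end p, black_end q) \<notin> circle_rel A"
    using assms(6,7) circle_at_eq_iff_rel[OF assms(4,5)] join by auto
  then have "(black_end p, u) \<in> circle_rel A \<and> (black_end q, v) \<in> circle_rel A \<or>
      (black_end p, v) \<in> circle_rel A \<and> (black_end q, u) \<in> circle_rel A"
    using equiv_symD[OF equiv_circle_rel] by (auto simp: join_rel_def)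
  then show ?thesis using uv assms(4,5) by (simp add: circle_at_eq_iff_rel)
qed

text \<open>The two 0-resolved strands face each other along the surgery arc. Their difference has
  no white part if the arc is black, and is wholly white otherwise.\<close>

lemma pot_crossing0:
  assumes "j \<in> crossings D" "j \<notin> A"
  shows "pot A (End j South) - pot A (End j North) =
    (if black j then 0 else gen (circle_at D A (End j South)) - gen (circle_at D A (End j North)))"
proof -
  have "pot A (End j South) = pot A (End j West)"
    using pot_circle[of "End j South" "End j West" A] circle_at_ends0[OF assms] assms(1) by simp
  then show ?thesis
    using pot_turn[of "End j North" A] circle_at_ends0[OF assms] assms(1)
    by (simp add: pot_step_def black_def)
qed

text \<open>The 1-resolved strands face each other across the region of the other colour, so the two
  cases are exchanged.\<close>

lemma pot_crossing1:
  assumes "j \<in> crossings D" "j \<in> A"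
  shows "pot A (End j West) - pot A (End j East) =
    (if black j then gen (circle_at D A (End j West)) - gen (circle_at D A (End j East)) else 0)"
proof -
  have "pot A (End j South) = pot A (End j East)"
    using pot_circle[of "End j South" "End j East" A] circle_at_ends1[OF assms] assms(1) by simp
  then show ?thesis
    using pot_turn[of "End j West" A] circle_at_ends1[OF assms] assms(1)
    by (simp add: pot_step_def black_def algebra_simps)
qed

text \<open>The face in which one circle is surgered along interleaved arcs: either surgery splits
  it, and the other one then merges the pieces.\<close>

definition degenerate :: "nat set \<Rightarrow> nat \<Rightarrow> nat \<Rightarrow> bool" where
  "degenerate A i j \<longleftrightarrow> \<not> merges A i \<and> \<not> merges A j \<and> merges (insert i A) j"

context
  fixes A i j
  assumes ij: "i \<in> crossings D" "j \<in> crossings D" "i \<notin> A" "j \<notin> A" "i \<noteq> j"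
begin

lemma degenerate_circles:
  assumes "degenerate A i j"
  defines "A' \<equiv> insert i A"
  shows "circle_at D A' (End j South) = circle_at D A' (End i West) \<and>
      circle_at D A' (End j North) = circle_at D A' (End i East) \<or>
    circle_at D A' (End j South) = circle_at D A' (End i East) \<and>
      circle_at D A' (End j North) = circle_at D A' (End i West)"
proof -
  have 1: "\<not> merges A i" and 2: "circle_at D A (End j South) = circle_at D A (End j North)"
    and 3: "circle_at D A' (End j South) \<noteq> circle_at D A' (End j North)"
    using assms by (simp_all add: degenerate_def merges_def)
  have 4: "End j South \<in> ends D" "End j North \<in> ends D" using ij by simp_all
  have 5: "i \<in> A'" by (simp add: A'_def)
  show ?thesis
    using joined_pair[OF circle_rel_split(1)[OF ij(1,3) 1, folded A'_def] nw_se_black[OF ij(1)] 4 2 3]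
    unfolding circle_at_nw_se1[OF ij(1) 5] .
qed

text \<open>After surgery at \<open>i\<close> both crossings join the same two distinct circles,
  \<open>i\<close> as a 1-resolution and \<open>j\<close> as a 0-resolution. The difference of
  potentials is all or nothing, and the two resolutions read it with opposite colours.\<close>

lemma degenerate_colours:
  assumes "degenerate A i j" shows "black i \<longleftrightarrow> \<not> black j"
proof -
  let ?A = "insert i A"
  have neq: "circle_at D ?A (End i West) \<noteq> circle_at D ?A (End i East)"
    using split_circles_neq[OF ij(1,3)] assms by (simp add: degenerate_def)
  have E: "End i West \<in> ends D" "End i East \<in> ends D" "End j South \<in> ends D" "End j North \<in> ends D"
    using ij by auto
  have j: "j \<notin> ?A" using ij by simp
  note p0 = pot_crossing0[OF ij(2) j] and p1 = pot_crossing1[OF ij(1), of ?A, simplified]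
  from degenerate_circles[OF assms] show ?thesis
  proof
    assume *: "circle_at D ?A (End j South) = circle_at D ?A (End i West) \<and>
      circle_at D ?A (End j North) = circle_at D ?A (End i East)"
    then have "pot ?A (End j South) = pot ?A (End i West)" "pot ?A (End j North) = pot ?A (End i East)"
      using pot_circle[OF E(3,1)] pot_circle[OF E(4,2)] by blast+
    then show ?thesis using p0 p1 * neq by (simp split: if_splits)
  next
    assume *: "circle_at D ?A (End j South) = circle_at D ?A (End i East) \<and>
      circle_at D ?A (End j North) = circle_at D ?A (End i West)"
    then have "pot ?A (End j South) = pot ?A (End i East)" "pot ?A (End j North) = pot ?A (End i West)"
      using pot_circle[OF E(3,2)] pot_circle[OF E(4,1)] by blast+
    then have "pot ?A (End i West) - pot ?A (End i East) =
        (if black j then 0 else gen (circle_at D ?A (End i West)) - gen (circle_at D ?A (End i East)))"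
      using p0 * by (metis minus_diff_eq neg_0_equal_iff_equal)
    then show ?thesis using p1 neq by (simp split: if_splits)
  qed
qed

text \<open>Both crossings, 0-resolved, join the same two circles, so the difference of potentials
  is read with the same colour.\<close>

lemma merge_merge_split_colours:
  assumes "merges A i" "merges A j" "\<not> merges (insert i A) j" shows "black i \<longleftrightarrow> black j"
proof -
  have E: "End i South \<in> ends D" "End i North \<in> ends D" "End j South \<in> ends D" "End j North \<in> ends D"
    using ij by auto
  note p = pot_crossing0[OF ij(2,4)] pot_crossing0[OF ij(1,3)]
  have neq: "circle_at D A (End i South) \<noteq> circle_at D A (End i North)"
    using assms(1) by (simp add: merges_def)
  have "circle_at D A (End j South) = circle_at D A (nw_end i) \<and> circle_at D A (End j North) = circle_at D A (se_end i) \<or>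
    circle_at D A (End j South) = circle_at D A (se_end i) \<and> circle_at D A (End j North) = circle_at D A (nw_end i)"
    using joined_pair[OF circle_rel_merge[OF ij(1,3) assms(1)] nw_se_black[OF ij(1)] E(3,4)] assms(2,3)
    by (simp add: merges_def)
  then have "circle_at D A (End j South) = circle_at D A (End i South) \<and>
      circle_at D A (End j North) = circle_at D A (End i North) \<or>
    circle_at D A (End j South) = circle_at D A (End i North) \<and>
      circle_at D A (End j North) = circle_at D A (End i South)"
    unfolding circle_at_nw_se0[OF ij(1,3)] by (cases "black i") auto
  then show ?thesis
  proof
    assume *: "circle_at D A (End j South) = circle_at D A (End i South) \<and>
      circle_at D A (End j North) = circle_at D A (End i North)"
    then have "pot A (End j South) = pot A (End i South)" "pot A (End j North) = pot A (End i North)"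
      using pot_circle[OF E(3,1)] pot_circle[OF E(4,2)] by blast+
    then show ?thesis using p * neq by (simp split: if_splits)
  next
    assume *: "circle_at D A (End j South) = circle_at D A (End i North) \<and>
      circle_at D A (End j North) = circle_at D A (End i South)"
    then have "pot A (End j South) = pot A (End i North)" "pot A (End j North) = pot A (End i South)"
      using pot_circle[OF E(3,2)] pot_circle[OF E(4,1)] by blast+
    then have "pot A (End i South) - pot A (End i North) =
        (if black j then 0 else gen (circle_at D A (End i South)) - gen (circle_at D A (End i North)))"
      using p(1) * by (metis minus_diff_eq neg_0_equal_iff_equal)
    then show ?thesis using p(2) neq by (simp split: if_splits)
  qed
qed

text \<open>The split multiplies by the difference of two circles that the merge identifies.\<close>

lemma degenerate_composition:
  assumes "degenerate A i j" shows "face_composition D arr A i j x = 0"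
proof -
  let ?A = "insert i A"
  have "\<not> merges A i" "merges ?A j" using assms by (auto simp: degenerate_def)
  obtain e0 e1 where e: "e0 = End i West \<and> e1 = End i East \<or> e0 = End i East \<and> e1 = End i West"
    "edge_map D arr A i = (\<lambda>x. (gen (circle_at D ?A e0) - gen (circle_at D ?A e1)) *
      exterior_map (\<lambda>c. if c = circle_at D A (End i South) then circle_at D ?A e0 else c) x)"
    by (rule edge_map_split[OF \<open>\<not> merges A i\<close>])
  have "circle_at D ?A e \<in> {circle_at D ?A (End j South), circle_at D ?A (End j North)}" if "e \<in> {e0, e1}" for e
    using degenerate_circles[OF assms] e(1) that by auto
  then show ?thesis
    unfolding face_composition_def e(2) edge_map_merge[OF \<open>merges ?A j\<close>]
    by (auto simp: exterior_map_simps)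
qed

text \<open>Both paths end at the same resolution, and its number of circles determines how many of
  the two surgeries are merges.\<close>

lemma merges_count:
  "of_bool (merges A i) + of_bool (merges (insert i A) j)
    = (of_bool (merges A j) + of_bool (merges (insert j A) i) :: int)"
proof -
  have "int (card (black_ends // circle_rel (insert j (insert i A)))) = int (card (black_ends // circle_rel A))
      + (if merges A i then - 1 else 1) + (if merges (insert i A) j then - 1 else 1)"
    using card_circle_rel[OF ij(1,3)] card_circle_rel[OF ij(2), of "insert i A"] ij by simp
  moreover have "int (card (black_ends // circle_rel (insert i (insert j A)))) = int (card (black_ends // circle_rel A))
      + (if merges A j then - 1 else 1) + (if merges (insert j A) i then - 1 else 1)"
    using card_circle_rel[OF ij(2,4)] card_circle_rel[OF ij(1), of "insert j A"] ij by simp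
  moreover have "insert j (insert i A) = insert i (insert j A)" by blast
  ultimately show ?thesis
    by (cases "merges A i"; cases "merges A j"; cases "merges (insert i A) j";
        cases "merges (insert j A) i") simp_all
qed

end

lemma degenerate_sym:
  assumes "i \<in> crossings D" "j \<in> crossings D" "i \<notin> A" "j \<notin> A" "i \<noteq> j"
  shows "degenerate A i j \<longleftrightarrow> degenerate A j i"
  using merges_count[OF assms] by (auto simp: degenerate_def of_bool_def split: if_splits)

text \<open>If parallel edges are of the same kind, their factors cancel. Otherwise, by
  \<open>merges_count\<close>, either both edges from \<open>A\<close> merge and the later ones
  split, with equal colours and so 0 or 2 black merges; or the face is degenerate, with different
  colours and exactly one.\<close>

lemma twist_face:
  assumes "i \<in> crossings D" "j \<in> crossings D" "i \<notin> A" "j \<notin> A" "i \<noteq> j"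
  shows "twist A i * twist (insert i A) j * twist A j * twist (insert j A) i
    = (if degenerate A i j then - 1 else 1)"
  using merges_count[OF assms] degenerate_colours[OF assms] degenerate_sym[OF assms]
    merge_merge_split_colours[OF assms] merge_merge_split_colours[OF assms(2,1,4,3)] assms(5)
  by (cases "merges A i"; cases "merges A j"; cases "merges (insert i A) j"; cases "merges (insert j A) i";
      cases "black i"; cases "black j") (simp_all add: twist_def degenerate_def)

section \<open>Types of faces\<close>

lemma traverse_col: "p \<in> ends D \<Longrightarrow> col ((traverse D A ^^ n) p) = col p"
proof (induction n)
  case (Suc n)
  have "(traverse D A ^^ n) p \<in> ends D" using funpow_closed[OF bij_traverse_ends] Suc.prems .
  then have "col (traverse D A ((traverse D A ^^ n) p)) = col ((traverse D A ^^ n) p)"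
    by (simp add: traverse_def[of D A "(traverse D A ^^ n) p"])
  then show ?case using Suc by simp
qed simp

lemma cyclic_order_col:
  assumes "cyclic_order (traverse D A) h0 h1 h2 h3" "h0 \<in> ends D"
  shows "col h1 = col h0" "col h2 = col h0" "col h3 = col h0"
  using assms traverse_col unfolding cyclic_order_def by blast+

text \<open>A walk keeps the colour on its left, so meeting one arc on the left and the other on the
  right forces different colours.\<close>

lemma arcs_of_type_same_colour:
  assumes "a \<in> crossings D" "b \<in> crossings D" "black a = black b"
  shows "\<not> arcs_of_type t D arr A a b"
proof
  assume c: "arcs_of_type t D arr A a b"
  have E: "tail_left arr a \<in> ends D" using assms by simp
  have "col (tail_left arr a) = black a" "col (head_right arr b) = (\<not> black b)" "col (tail_right arr b) = (\<not> black b)"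
    using assms by (auto simp: black_def split: arrow.split)
  then show False
    using c assms(3) cyclic_order_col(1)[OF _ E, of A] by (cases t) (auto simp del: tail_left.simps head_left.simps tail_right.simps head_right.simps)
qed

text \<open>Running the circle backwards, by way of \<open>smooth A\<close>, exchanges left and
  right and reverses the order; up to rotation this turns each pattern into itself with
  \<open>a\<close> and \<open>b\<close> exchanged.\<close>

lemma arcs_of_type_swap:
  assumes "a \<in> crossings D" "b \<in> crossings D" "a \<notin> A" "b \<notin> A" "arcs_of_type t D arr A a b"
  shows "arcs_of_type t D arr A b a"
proof -
  have s: "smooth A x \<in> ends D \<and> smooth A (smooth A x) = x \<and> traverse D A (smooth A (traverse D A x)) = smooth A x"
    if "x \<in> ends D" for x using that by (simp add: traverse_def)
  have sm: "smooth A (tail_left arr k) = tail_right arr k" "smooth A (tail_right arr k) = tail_left arr k"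
    "smooth A (head_left arr k) = head_right arr k" "smooth A (head_right arr k) = head_left arr k"
    if "k \<notin> A" for k using that by (auto simp: smooth_def split: arrow.split)
  have E: "tail_left arr k \<in> ends D" "tail_right arr k \<in> ends D" "head_left arr k \<in> ends D" "head_right arr k \<in> ends D"
    if "k \<in> crossings D" for k using that by simp_all
  note rot = cyclic_order_rotate[OF finite_ends bij_traverse_ends]
  note rev = cyclic_order_reverse[OF finite_ends bij_traverse_ends _ _ s]
  show ?thesis
  proof (cases t)
    case TypeY
    then have "cyclic_order (traverse D A) (tail_left arr a) (head_right arr b) (head_left arr a) (tail_right arr b)"
      using assms(5) by simp
    from rot[OF rev[OF this E(1)[OF assms(1)]]] show ?thesis
      using TypeY sm[OF assms(3)] sm[OF assms(4)] E assms(1,2) by simp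
  next
    case TypeX
    then have "cyclic_order (traverse D A) (tail_left arr a) (tail_right arr b) (head_left arr a) (head_right arr b)"
      using assms(5) by simp
    from rev[OF this E(1)[OF assms(1)]]
    have "cyclic_order (traverse D A) (tail_right arr a) (head_left arr b) (head_right arr a) (tail_left arr b)"
      by (simp only: sm[OF assms(3)] sm[OF assms(4)])
    from rot[OF rot[OF rot[OF this]]] show ?thesis
      using TypeX E assms(1,2) by simp
  qed
qed

text \<open>All four points are black ends here, and reversing an arrow only exchanges the two at
  its crossing. Cutting at the ends of \<open>a\<close> is surgery at \<open>a\<close>, so
  \<open>interleaved_iff\<close> becomes a statement about merges and splits.\<close>

lemma arcs_of_type_degenerate:
  assumes "a \<in> crossings D" "b \<in> crossings D" "a \<notin> A" "b \<notin> A" "black a" "\<not> black b"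
  shows "arcs_of_type TypeX D arr A a b \<or> arcs_of_type TypeY D arr A a b \<longleftrightarrow> degenerate A a b"
    "\<not> (arcs_of_type TypeX D arr A a b \<and> arcs_of_type TypeY D arr A a b)"
proof -
  have ab: "a \<noteq> b" using assms by blast
  let ?x = "tail_left arr a" and ?y = "head_left arr a" and ?u = "tail_right arr b" and ?v = "head_right arr b"
  have xy: "?x = nw_end a \<and> ?y = se_end a \<or> ?x = se_end a \<and> ?y = nw_end a"
    using assms(5) by (auto simp: nw_end_def se_end_def split: arrow.split)
  have uv: "?u = nw_end b \<and> ?v = se_end b \<or> ?u = se_end b \<and> ?v = nw_end b"
    using assms(6) by (auto simp: nw_end_def se_end_def split: arrow.split)
  have ne: "nw_end b \<noteq> nw_end a" "nw_end b \<noteq> se_end a" "se_end b \<noteq> nw_end a" "se_end b \<noteq> se_end a"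
    using ab by (simp_all add: nw_end_def se_end_def)
  have hyps: "?x \<in> black_ends" "?x \<noteq> ?y" "?u \<notin> {?x, ?y}" "?v \<notin> {?x, ?y}"
    using xy uv nw_se_black[OF assms(1)] nw_neq_se[of a] nw_neq_se[of a, symmetric] ne by (metis insert_iff singletonD)+
  have tr: "transpose ?x ?y = transpose (nw_end a) (se_end a)" using xy by (metis transpose_commute)
  have sym: "(p, q) \<in> circle_rel X \<longleftrightarrow> (q, p) \<in> circle_rel X" for p q X
    using equiv_symD[OF equiv_circle_rel] by blast
  have "(?x, ?y) \<in> circle_rel A \<longleftrightarrow> \<not> merges A a"
    using xy sym by (auto simp: merges_iff[OF assms(1,3)] simp del: tail_left.simps head_left.simps)
  moreover have "(?u, ?v) \<in> circle_rel A \<longleftrightarrow> \<not> merges A b"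
    using uv sym by (auto simp: merges_iff[OF assms(2,4)] simp del: tail_right.simps head_right.simps)
  moreover have "(?u, ?v) \<in> circle_rel (insert a A) \<longleftrightarrow> \<not> merges (insert a A) b"
    using uv sym ab assms(4) by (auto simp: merges_iff[OF assms(2)] simp del: tail_right.simps head_right.simps)
  ultimately show "arcs_of_type TypeX D arr A a b \<or> arcs_of_type TypeY D arr A a b \<longleftrightarrow> degenerate A a b"
    "\<not> (arcs_of_type TypeX D arr A a b \<and> arcs_of_type TypeY D arr A a b)"
    using interleaved_iff[OF finite_black_ends bij_traverse[of A] hyps]
    unfolding tr circle_rel_insert[OF assms(1,3), symmetric] circle_rel_def[symmetric]
    by (simp_all add: degenerate_def del: tail_left.simps head_left.simps tail_right.simps head_right.simps)
qed

lemma face_of_type_iff: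
  assumes "i \<in> crossings D" "j \<in> crossings D" "i \<notin> A" "j \<notin> A" "i \<noteq> j"
  shows "face_of_type TypeX D arr A i j \<or> face_of_type TypeY D arr A i j \<longleftrightarrow> degenerate A i j"
    "\<not> (face_of_type TypeX D arr A i j \<and> face_of_type TypeY D arr A i j)"
proof -
  have sym: "arcs_of_type t D arr A i j \<longleftrightarrow> arcs_of_type t D arr A j i" for t
    using arcs_of_type_swap assms by blast
  consider "black i = black j" | "black i" "\<not> black j" | "\<not> black i" "black j" by blast
  then have "(face_of_type TypeX D arr A i j \<or> face_of_type TypeY D arr A i j \<longleftrightarrow> degenerate A i j) \<and>
    \<not> (face_of_type TypeX D arr A i j \<and> face_of_type TypeY D arr A i j)"
  proof cases
    case 1
    then show ?thesis
      using arcs_of_type_same_colour[OF assms(1,2)] degenerate_colours[OF assms]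
      unfolding face_of_type_def sym[symmetric] by blast
  next
    case 2
    then show ?thesis
      using arcs_of_type_degenerate[OF assms(1-4)] unfolding face_of_type_def sym[symmetric] by blast
  next
    case 3
    then show ?thesis
      using arcs_of_type_degenerate[OF assms(2,1,4,3)] degenerate_sym[OF assms]
      unfolding face_of_type_def sym by blast
  qed
  then show "face_of_type TypeX D arr A i j \<or> face_of_type TypeY D arr A i j \<longleftrightarrow> degenerate A i j"
    "\<not> (face_of_type TypeX D arr A i j \<and> face_of_type TypeY D arr A i j)" by auto
qed

text \<open>On a degenerate face the compositions vanish, so each convention consults the type, and
  exactly one of them gives -1. On any other face neither type occurs and both conventions evaluate
  the same expression.\<close>

lemma face_sign_product:
  assumes "i \<in> crossings D" "j \<in> crossings D" "i \<notin> A" "j \<notin> A" "i \<noteq> j"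
  shows "degenerate A i j \<Longrightarrow> face_sign TypeX D arr A i j * face_sign TypeY D arr A i j = - 1"
    "\<not> degenerate A i j \<Longrightarrow> face_sign TypeX D arr A i j = face_sign TypeY D arr A i j"
proof -
  assume "degenerate A i j"
  then show "face_sign TypeX D arr A i j * face_sign TypeY D arr A i j = - 1"
    using face_of_type_iff[OF assms, of arr] degenerate_composition[OF assms, of arr]
    by (auto simp: face_sign_def Let_def)
next
  assume "\<not> degenerate A i j"
  then show "face_sign TypeX D arr A i j = face_sign TypeY D arr A i j"
    using face_of_type_iff[OF assms, of arr] by (simp add: face_sign_def)
qed

end

section \<open>Comparison of the sign assignments\<close>

lemma sign_mult: "a = 1 \<or> a = - 1 \<Longrightarrow> b = 1 \<or> b = - 1 \<Longrightarrow> a * b = 1 \<or> a * b = - 1" for a b :: int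
  by auto

text \<open>
  A primitive of the cochain \<open>w\<close>: the product of its values along the path from the empty set to
  \<open>A\<close> that adds the elements in increasing order.
\<close>

definition vertex_sign :: "(nat set \<Rightarrow> nat \<Rightarrow> int) \<Rightarrow> nat set \<Rightarrow> int" where
  "vertex_sign w A = (\<Prod>j\<in>A. w {k \<in> A. k < j} j)"

lemma vertex_sign_insert_top:
  assumes "finite A" "\<forall>a\<in>A. a < i" shows "vertex_sign w (insert i A) = vertex_sign w A * w A i"
proof -
  have i: "i \<notin> A" using assms(2) by blast
  have "{k \<in> insert i A. k < j} = {k \<in> A. k < j}" if "j \<in> A" for j
    using assms(2) that by auto
  then have "(\<Prod>j\<in>A. w {k \<in> insert i A. k < j} j) = vertex_sign w A"
    unfolding vertex_sign_def by (intro prod.cong) simp_all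
  moreover have "{k \<in> insert i A. k < i} = A" using assms(2) by auto
  ultimately show ?thesis
    using assms(1) i by (simp add: vertex_sign_def mult.commute)
qed

text \<open>Closed sign cochains on a cube are coboundaries. If \<open>i\<close> is not above the
  largest element \<open>m\<close>, the face spanned by \<open>i\<close> and \<open>m\<close> allows
  \<open>m\<close> to be added last.\<close>

lemma vertex_sign_insert:
  assumes "finite C"
    and sign: "\<And>A i. A \<subseteq> C \<Longrightarrow> i \<in> C - A \<Longrightarrow> w A i = 1 \<or> w A i = - 1"
    and face: "\<And>A i j. A \<subseteq> C \<Longrightarrow> i \<in> C - A \<Longrightarrow> j \<in> C - A \<Longrightarrow> i \<noteq> j \<Longrightarrow>
      w A i * w (insert i A) j * w A j * w (insert j A) i = 1"
    and "A \<subseteq> C" "i \<in> C - A"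
  shows "vertex_sign w (insert i A) = vertex_sign w A * w A i"
proof -
  have "finite A" using assms(1,4) finite_subset by blast
  then show ?thesis
    using assms(4,5)
  proof (induction A arbitrary: i rule: finite_linorder_max_induct)
    case empty
    then show ?case using vertex_sign_insert_top[of "{}" i w] by simp
  next
    case (insert m A)
    show ?case
    proof (cases "m < i")
      case True
      then have "\<forall>a\<in>insert m A. a < i" using insert.hyps by auto
      then show ?thesis using vertex_sign_insert_top insert.hyps(1) by simp
    next
      case False
      have m: "m \<notin> A" "m \<in> C" "A \<subseteq> C" "i \<in> C - A" "i \<noteq> m" using insert by auto
      then have "\<forall>a\<in>insert i A. a < m" using False insert.hyps(2) by auto
      then have "vertex_sign w (insert m (insert i A)) = vertex_sign w A * w A i * w (insert i A) m"
        using vertex_sign_insert_top[of "insert i A" m w] insert.hyps(1) insert.IH[OF m(3,4)] by simp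
      moreover have "vertex_sign w (insert m A) = vertex_sign w A * w A m"
        using vertex_sign_insert_top insert.hyps by simp
      \<comment> \<open>Signs square to 1, so a product 1 around the face says that its two paths
        have equal products.\<close>
      moreover have "w A i * w (insert i A) m = w A m * w (insert m A) i"
        using face[OF m(3,4) _ m(5)] m sign[OF m(3,4)] sign[of A m] sign[of "insert i A" m]
          sign[of "insert m A" i] by auto
      ultimately show ?thesis by (simp add: insert_commute mult.assoc)
    qed
  qed
qed

lemma vertex_sign_values:
  assumes "finite C" "\<And>A i. A \<subseteq> C \<Longrightarrow> i \<in> C - A \<Longrightarrow> w A i = 1 \<or> w A i = - 1" "A \<subseteq> C"
  shows "vertex_sign w A = 1 \<or> vertex_sign w A = - 1"
proof -
  have prod: "prod g F = 1 \<or> prod g F = - 1" if "\<And>j. j \<in> F \<Longrightarrow> g j = 1 \<or> g j = - 1" for g :: "nat \<Rightarrow> int" and F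
    using that
  proof (induction F rule: infinite_finite_induct)
    case (insert x F)
    then show ?case using sign_mult[of "g x" "prod g F"] by simp
  qed simp_all
  have "w {k \<in> A. k < j} j = 1 \<or> w {k \<in> A. k < j} j = - 1" if "j \<in> A" for j
    using assms(2)[of "{k \<in> A. k < j}" j] assms(3) that by auto
  then show ?thesis unfolding vertex_sign_def by (rule prod)
qed

section \<open>The isomorphism of complexes\<close>

lemma group_exterior_group: "group (exterior_group R)"
proof (rule groupI)
  fix x assume "x \<in> carrier (exterior_group R)"
  then show "\<exists>y\<in>carrier (exterior_group R). y \<otimes>\<^bsub>exterior_group R\<^esub> x = \<one>\<^bsub>exterior_group R\<^esub>"
    by (intro bexI[of _ "- x"]) (simp_all add: exterior_group_def exterior_on_uminus)
qed (simp_all add: exterior_group_def exterior_on_add add.assoc)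

context planar_diagram
begin

lemma finite_cube_vertices [simp]: "finite (cube_vertices D k)"
  unfolding cube_vertices_def by (rule finite_subset[of _ "Pow (crossings D)"]) auto

lemma carrier_cochains:
  "carrier (sum_group (cube_vertices D k) (\<lambda>A. exterior_group (circles D A)))
    = (\<Pi>\<^sub>E A\<in>cube_vertices D k. exterior_on (circles D A))"
  using carrier_sum_group[of "cube_vertices D k" "\<lambda>A. exterior_group (circles D A)"]
  by (simp add: group_exterior_group) (simp add: exterior_group_def)

definition cochain_map :: "(nat set \<Rightarrow> int) \<Rightarrow> int \<Rightarrow> (nat set \<Rightarrow> circle exterior) \<Rightarrow> nat set \<Rightarrow> circle exterior" where
  "cochain_map s k x = (\<lambda>A\<in>cube_vertices D k. of_int (s A) * vertex_map A (x A))"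

text \<open>Vertex maps and signs are involutions, so the map is its own inverse.\<close>

lemma cochain_map_iso:
  assumes s: "\<And>A. A \<subseteq> crossings D \<Longrightarrow> s A = 1 \<or> s A = - 1"
  shows "cochain_map s k \<in> iso (sum_group (cube_vertices D k) (\<lambda>A. exterior_group (circles D A)))
    (sum_group (cube_vertices D k) (\<lambda>A. exterior_group (circles D A)))" (is "_ \<in> iso ?G ?G")
proof -
  let ?V = "cube_vertices D k"
  have sV: "s A = 1 \<or> s A = - 1" if "A \<in> ?V" for A using s that by (simp add: cube_vertices_def)
  have closed: "cochain_map s k x \<in> carrier ?G" if "x \<in> carrier ?G" for x
    unfolding carrier_cochains cochain_map_def
  proof (rule restrict_PiE_iff[THEN iffD2], intro ballI)
    fix A assume A: "A \<in> ?V"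
    then have "x A \<in> exterior_on (circles D A)" using that by (auto simp: carrier_cochains)
    then show "of_int (s A) * vertex_map A (x A) \<in> exterior_on (circles D A)"
      using sV[OF A] vertex_map_exterior_on[of "x A" A] exterior_on_uminus[of "vertex_map A (x A)"] by auto
  qed
  have inverse: "cochain_map s k (cochain_map s k x) = x" if "x \<in> carrier ?G" for x
  proof
    fix A
    show "cochain_map s k (cochain_map s k x) A = x A"
    proof (cases "A \<in> ?V")
      case True
      then have "x A \<in> exterior_on (circles D A)" using that by (auto simp: carrier_cochains)
      then have "of_int (s A) * vertex_map A (of_int (s A) * vertex_map A (x A)) = x A"
        using sV[OF True] by (auto simp: vertex_map_simps vertex_map_involution)
      then show ?thesis using True by (simp add: cochain_map_def)
    next
      case False
      then show ?thesis using that by (auto simp: carrier_cochains cochain_map_def)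
    qed
  qed
  have "cochain_map s k \<in> hom ?G ?G"
  proof (rule homI)
    fix x y assume "x \<in> carrier ?G" "y \<in> carrier ?G"
    show "cochain_map s k (x \<otimes>\<^bsub>?G\<^esub> y) = cochain_map s k x \<otimes>\<^bsub>?G\<^esub> cochain_map s k y"
      by (auto simp: cochain_map_def exterior_group_def vertex_map_simps distrib_left)
  qed (rule closed)
  moreover have "bij_betw (cochain_map s k) (carrier ?G) (carrier ?G)"
    by (rule bij_betw_byWitness[where f' = "cochain_map s k"]) (use closed inverse in auto)
  ultimately show ?thesis by (simp add: iso_def)
qed

end

lemma sign_assignment_sign:
  assumes "sign_assignment t D arr e" "A \<subseteq> crossings D" "i \<in> crossings D - A"
  shows "e A i = 1 \<or> e A i = - 1"
  using conjunct1[OF assms(1)[unfolded sign_assignment_def], rule_format, OF conjI[OF assms(2,3)]] .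

lemma sign_assignment_face:
  assumes "sign_assignment t D arr e" "A \<subseteq> crossings D" "i \<in> crossings D - A" "j \<in> crossings D - A" "i \<noteq> j"
  shows "e A i * e (insert i A) j * e A j * e (insert j A) i * face_sign t D arr A i j = - 1"
  using conjunct2[OF assms(1)[unfolded sign_assignment_def], rule_format,
      OF conjI[OF assms(2) conjI[OF assms(3) conjI[OF assms(4,5)]]]] .

theorem proposition1:
  fixes D :: link_diagram and arr :: "nat \<Rightarrow> arrow"
    and eX eY :: "nat set \<Rightarrow> nat \<Rightarrow> int"
  assumes "is_link_diagram D"
    and "sign_assignment TypeX D arr eX"
    and "sign_assignment TypeY D arr eY"
  shows "isomorphic_complexes (odd_khovanov_complex D arr eX) (odd_khovanov_complex D arr eY)"
proof -
  interpret planar_diagram D by unfold_locales (rule assms(1))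
  let ?C = "crossings D"
  \<comment> \<open>The quotient of the assignments and \<open>twist\<close> both have product -1
    around exactly the degenerate faces; together they are closed.\<close>
  define w where "w A i = eX A i * eY A i * twist A i" for A i
  have signs: "eX A i = 1 \<or> eX A i = - 1" "eY A i = 1 \<or> eY A i = - 1" if "A \<subseteq> ?C" "i \<in> ?C - A" for A i
    using sign_assignment_sign[OF assms(2) that] sign_assignment_sign[OF assms(3) that] .
  have twist: "twist A i = 1 \<or> twist A i = - 1" for A i by (simp add: twist_def)
  have w: "w A i = 1 \<or> w A i = - 1" if "A \<subseteq> ?C" "i \<in> ?C - A" for A i
    using signs[OF that] twist[of A i] by (auto simp: w_def)
  have face: "w A i * w (insert i A) j * w A j * w (insert j A) i = 1"
    if A: "A \<subseteq> ?C" "i \<in> ?C - A" "j \<in> ?C - A" "i \<noteq> j" for A i j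
  proof -
    have ij: "i \<in> ?C" "j \<in> ?C" "i \<notin> A" "j \<notin> A" "i \<noteq> j" using A by auto
    let ?X = "eX A i * eX (insert i A) j * eX A j * eX (insert j A) i"
    let ?Y = "eY A i * eY (insert i A) j * eY A j * eY (insert j A) i"
    let ?T = "twist A i * twist (insert i A) j * twist A j * twist (insert j A) i"
    let ?fX = "face_sign TypeX D arr A i j" and ?fY = "face_sign TypeY D arr A i j"
    have X: "?X * ?fX = - 1" and Y: "?Y * ?fY = - 1"
      using sign_assignment_face[OF assms(2) A] sign_assignment_face[OF assms(3) A] .
    have X1: "?X = 1 \<or> ?X = - 1" and Y1: "?Y = 1 \<or> ?Y = - 1"
      by (intro sign_mult signs; use A in auto)+
    have "?X * ?Y * ?T = 1"
    proof (cases "degenerate A i j")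
      case True
      then have "?fX * ?fY = - 1" "?T = - 1"
        using face_sign_product(1)[OF ij True] twist_face[OF ij] by auto
      then show ?thesis using X Y X1 Y1 by auto
    next
      case False
      then have "?fX = ?fY" "?T = 1"
        using face_sign_product(2)[OF ij False] twist_face[OF ij] by auto
      then show ?thesis using X Y X1 Y1 by auto
    qed
    then show ?thesis by (simp add: w_def mult_ac)
  qed
  \<comment> \<open>\<open>vertex_sign w\<close> is a primitive of \<open>w\<close>, and
    \<open>black_sign\<close> moves the sign of the vertex maps from black splits to black
    merges.\<close>
  define s where "s A = vertex_sign w A * black_sign A" for A
  have s: "s A = 1 \<or> s A = - 1" if "A \<subseteq> ?C" for A
    unfolding s_def
    by (intro sign_mult vertex_sign_values[OF finite_crossings w that])
       (simp_all add: black_sign_def minus_one_power_iff)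
  have s_insert: "vertex_sign w (insert i A) = vertex_sign w A * w A i" if "A \<subseteq> ?C" "i \<in> ?C - A" for A i
    by (rule vertex_sign_insert[OF finite_crossings w face that])
  have edge: "of_int (s (insert i A)) * vertex_map (insert i A) (of_int (eX A i) * edge_map D arr A i x)
      = of_int (eY A i) * edge_map D arr A i (of_int (s A) * vertex_map A x)"
    if A: "A \<subseteq> ?C" "i \<in> ?C - A" and x: "x \<in> exterior_on (circles D A)" for A i x
  proof -
    have fin: "finite A" using A(1) finite_crossings finite_subset by blast
    have i: "i \<in> ?C" "i \<notin> A" using A by auto
    have "of_int (s (insert i A)) * vertex_map (insert i A) (of_int (eX A i) * edge_map D arr A i x)
        = of_int (vertex_sign w (insert i A) * eX A i) *
          (of_int (black_sign (insert i A)) * vertex_map (insert i A) (edge_map D arr A i x))"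
      using signs(1)[OF A] by (auto simp: s_def vertex_map_simps mult.assoc)
    also have "\<dots> = of_int (vertex_sign w (insert i A) * eX A i * (twist A i * black_sign A)) *
        edge_map D arr A i (vertex_map A x)"
      unfolding sign_vertex_map_edge[OF i fin x] by (simp add: mult.assoc)
    \<comment> \<open>In \<open>w A i\<close> the factors \<open>eX A i\<close> and
      \<open>twist A i\<close> meet themselves and cancel, which leaves
      \<open>eY A i\<close>.\<close>
    also have "vertex_sign w (insert i A) * eX A i * (twist A i * black_sign A) = eY A i * s A"
      using signs(1)[OF A] twist[of A i] by (auto simp: s_insert[OF A] w_def s_def)
    finally show ?thesis using edge_map_sign[OF s[OF A(1)]] by (simp add: mult.assoc)
  qed
  show ?thesis
    unfolding isomorphic_complexes_def
  proof (intro exI[of _ "cochain_map s"] allI conjI ballI)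
    fix k
    show "cochain_map s k \<in> iso (group_at (odd_khovanov_complex D arr eX) k)
        (group_at (odd_khovanov_complex D arr eY) k)"
      using cochain_map_iso[of s k] s by (simp add: odd_khovanov_complex_def)
    fix x assume "x \<in> carrier (group_at (odd_khovanov_complex D arr eX) k)"
    then have x: "x A \<in> exterior_on (circles D A)" if "A \<in> cube_vertices D k" for A
      using that by (auto simp: odd_khovanov_complex_def carrier_cochains)
    show "cochain_map s (k + 1) (diff_at (odd_khovanov_complex D arr eX) k x) =
        diff_at (odd_khovanov_complex D arr eY) k (cochain_map s k x)"
    proof
      fix B
      show "cochain_map s (k + 1) (diff_at (odd_khovanov_complex D arr eX) k x) B =
          diff_at (odd_khovanov_complex D arr eY) k (cochain_map s k x) B"
      proof (cases "B \<in> cube_vertices D (k + 1)")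
        case True
        then have B: "B \<subseteq> ?C" "int (card B) - int (card (negative_crossings D)) = k + 1"
          by (auto simp: cube_vertices_def)
        have finB: "finite B" using B(1) finite_crossings finite_subset by blast
        have "of_int (s B) * vertex_map B (\<Sum>i\<in>B. of_int (eX (B - {i}) i) * edge_map D arr (B - {i}) i (x (B - {i})))
          = (\<Sum>i\<in>B. of_int (s B) * vertex_map B (of_int (eX (B - {i}) i) * edge_map D arr (B - {i}) i (x (B - {i}))))"
        proof -
          have "vertex_map B (sum g F) = (\<Sum>i\<in>F. vertex_map B (g i))" if "finite F" for g and F :: "nat set"
            using that by (induction F) (simp_all add: vertex_map_simps)
          then show ?thesis using finB by (simp add: sum_distrib_left)
        qed
        also have "\<dots> = (\<Sum>i\<in>B. of_int (eY (B - {i}) i) * edge_map D arr (B - {i}) i (cochain_map s k x (B - {i})))"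
        proof (rule sum.cong[OF refl])
          fix i assume i: "i \<in> B"
          let ?A = "B - {i}"
          have A: "?A \<in> cube_vertices D k" "insert i ?A = B" "?A \<subseteq> ?C" "i \<in> ?C - ?A"
            using i B finB card_Suc_Diff1[OF finB i] by (auto simp: cube_vertices_def)
          show "of_int (s B) * vertex_map B (of_int (eX ?A i) * edge_map D arr ?A i (x ?A))
              = of_int (eY ?A i) * edge_map D arr ?A i (cochain_map s k x ?A)"
            using edge[OF A(3,4) x[OF A(1)]] A(1,2) by (simp add: cochain_map_def)
        qed
        finally show ?thesis using True by (simp add: cochain_map_def odd_khovanov_complex_def)
      next
        case False
        then show ?thesis by (simp add: cochain_map_def odd_khovanov_complex_def)
      qed
    qed
  qed
qed

end
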